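(* Let $r \ge r_P$ and suppose that $u_D|_{(-r,r)} \in L^\infty_G(-r,r)$ (respectively, $u_D|_{(-r,r)} \in L^\infty_{BV}(-r,r)$). Then every local solution $\bar u \in L^2(\mathbb{R})$ of problem (P) satisfies $$\bar u = \max\left(0, u_D - \frac{\nu_1}{\nu_2}\right) \text{ a.e. in } \mathbb{R}\setminus(-r,r) \qquad\text{and}\qquad \bar u|_{(-r,r)} \in L^\infty_G(-r,r) \ \text{ (respectively, } \bar u|_{(-r,r)} \in L^\infty_{BV}(-r,r)\text{)}.$$
   Context: Standing assumptions: $d\in\{1,2,3\}$; $\Omega\subset\mathbb{R}^d$ is a bounded domain that is convex or of class $C^{1,1}$; $y_D\in L^2(\Omega)$ and $u_D\in L^2(\mathbb{R})$ are given; $\nu_1\ge 0$ and $\nu_2>0$; $f\in L^2(\Omega)$ is not identically zero. For $u\in L^1_{loc}(\mathbb{R})$ set $g_u(t):=\int_0^t u(s)\,ds$, $t\in\mathbb{R}$ (with $\int_0^t u\,ds:=-\int_t^0 u\,ds$ for $t<0$); $g_u$ also denotes the induced Nemytskii operator $v\mapsto g_u(v)$. For every $0\le u\in L^2(\mathbb{R})$ the equation $-\Delta y+g_u(y)=f$ in $\Omega$, $y=0$ on $\partial\Omega$, has a unique weak solution $y=:S(u)\in H_0^1(\Omega)\cap H^2(\Omega)$. Let $y_P\in H_0^1(\Omega)\cap H^2(\Omega)\subset C(\overline\Omega)$ be the solution of $-\Delta y_P=f$ in $\Omega$, $y_P=0$ on $\partial\Omega$, and $r_P:=2\|y_P\|_\infty>0$.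 Problem (P): minimize $J(S(u),u)$ over all $u\in L^2(\mathbb{R})$ with $u\ge 0$ a.e. in $\mathbb{R}$, where $J(y,u):=\frac12\|y-y_D\|_{L^2(\Omega)}^2+\nu_1\|u\|_{L^1(\mathbb{R})}+\frac{\nu_2}{2}\|u-u_D\|_{L^2(\mathbb{R})}^2\in[0,\infty]$ (the $L^1$-term is $0$ if $\nu_1=0$). A function $0\le\bar u\in L^2(\mathbb{R})$ is a local solution (local minimizer) of (P) if there is $\rho>0$ with $J(S(u),u)\ge J(S(\bar u),\bar u)$ for all $0\le u\in L^2(\mathbb{R})$ with $\|u-\bar u\|_{L^2(\mathbb{R})}\le\rho$. $G[-r,r]$ is the space of regulated functions $v\colon[-r,r]\to\mathbb{R}$ (finite left limits at all points of $(-r,r]$, finite right limits at all points of $[-r,r)$); $BV[-r,r]$ is the space of functions $v\colon[-r,r]\to\mathbb{R}$ of bounded variation. $L^\infty_G(-r,r)$ (resp. $L^\infty_{BV}(-r,r)$) is the set of all $v\in L^\infty(-r,r)$ that have a representative in $G[-r,r]$ (resp. $BV[-r,r]$). *)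

theory Defs
  imports "HOL-Analysis.Analysis" "HOL-Probability.Essential_Supremum"
begin

section \<open>Lebesgue spaces\<close>

text \<open>Elements of Lebesgue spaces are represented by (everywhere defined) functions; membership
  and norms depend only on the a.e. equivalence class on the measure space. Thus
  \<open>f \<in> L2 (lebesgue_on \<Omega>)\<close> only concerns the restriction of \<open>f\<close> to \<open>\<Omega>\<close>.\<close>

definition L2 :: "'a measure \<Rightarrow> ('a \<Rightarrow> 'b::euclidean_space) set" where
  "L2 M = {f \<in> borel_measurable M. integrable M (\<lambda>x. (norm (f x))\<^sup>2)}"

definition L2norm :: "'a measure \<Rightarrow> ('a \<Rightarrow> 'b::euclidean_space) \<Rightarrow> real" where
  "L2norm M f = sqrt (\<integral>x. (norm (f x))\<^sup>2 \<partial>M)"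

definition Linfty :: "'a measure \<Rightarrow> ('a \<Rightarrow> real) set" where
  "Linfty M = {f \<in> borel_measurable M. \<exists>C. AE x in M. \<bar>f x\<bar> \<le> C}"

definition Linfty_norm :: "'a measure \<Rightarrow> ('a \<Rightarrow> real) \<Rightarrow> ereal" where
  "Linfty_norm M f = esssup M (\<lambda>x. ereal \<bar>f x\<bar>)"

definition L1_norm :: "'a measure \<Rightarrow> ('a \<Rightarrow> real) \<Rightarrow> ennreal" where
  "L1_norm M f = (\<integral>\<^sup>+x. ennreal \<bar>f x\<bar> \<partial>M)"

section \<open>Domains\<close>

definition bounded_domain :: "'a::euclidean_space set \<Rightarrow> bool" where
  "bounded_domain \<Omega> \<longleftrightarrow> open \<Omega> \<and> connected \<Omega> \<and> \<Omega> \<noteq> {} \<and> bounded \<Omega>"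

text \<open>Near each boundary point, in suitable orthonormal coordinates with last coordinate
  direction \<open>e\<close>, the set is the strict epigraph of a \<open>C\<^sup>1\<^sup>,\<^sup>1\<close> function of the remaining coordinates.
  The function \<open>\<gamma>\<close> is only evaluated on the hyperplane orthogonal to \<open>e\<close>; a \<open>C\<^sup>1\<^sup>,\<^sup>1\<close> function
  on this hyperplane extends to the whole space by composition with the orthogonal projection.\<close>

definition C11_boundary :: "'a::euclidean_space set \<Rightarrow> bool" where
  "C11_boundary \<Omega> \<longleftrightarrow>
    (\<forall>x0\<in>frontier \<Omega>. \<exists>\<rho>>0. \<exists>e \<gamma> \<gamma>' L.
       norm e = 1 \<and>
       (\<forall>x. GDERIV \<gamma> x :> \<gamma>' x) \<and>
       (\<forall>x y. norm (\<gamma>' x - \<gamma>' y) \<le> L * norm (x - y)) \<and>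
       \<Omega> \<inter> ball x0 \<rho> = {x \<in> ball x0 \<rho>. x \<bullet> e > \<gamma> (x - (x \<bullet> e) *\<^sub>R e)})"

section \<open>Sobolev spaces\<close>

primrec Ck :: "nat \<Rightarrow> ('a::euclidean_space \<Rightarrow> real) \<Rightarrow> bool" where
  "Ck 0 f \<longleftrightarrow> continuous_on UNIV f"
| "Ck (Suc k) f \<longleftrightarrow> (\<forall>x. f differentiable (at x)) \<and>
     (\<forall>b\<in>Basis. Ck k (\<lambda>x. frechet_derivative f (at x) b))"

definition test_functions :: "'a::euclidean_space set \<Rightarrow> ('a \<Rightarrow> real) set" where
  "test_functions \<Omega> = {\<phi>. (\<forall>k. Ck k \<phi>) \<and> compact (closure {x. \<phi> x \<noteq> 0}) \<and>
     closure {x. \<phi> x \<noteq> 0} \<subseteq> \<Omega>}"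

definition grad :: "('a::euclidean_space \<Rightarrow> real) \<Rightarrow> 'a \<Rightarrow> 'a" where
  "grad \<phi> x = (\<Sum>b\<in>Basis. frechet_derivative \<phi> (at x) b *\<^sub>R b)"

text \<open>\<open>y \<in> H\<^sup>1(\<Omega>)\<close> iff \<open>has_weak_gradient \<Omega> y G\<close> for some \<open>G\<close>.\<close>

definition has_weak_gradient ::
    "'a::euclidean_space set \<Rightarrow> ('a \<Rightarrow> real) \<Rightarrow> ('a \<Rightarrow> 'a) \<Rightarrow> bool" where
  "has_weak_gradient \<Omega> y G \<longleftrightarrow>
     y \<in> L2 (lebesgue_on \<Omega>) \<and> G \<in> L2 (lebesgue_on \<Omega>) \<and>
     (\<forall>\<phi>\<in>test_functions \<Omega>. \<forall>b\<in>Basis.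
        (\<integral>x. y x * (grad \<phi> x \<bullet> b) \<partial>lebesgue_on \<Omega>) = - (\<integral>x. (G x \<bullet> b) * \<phi> x \<partial>lebesgue_on \<Omega>))"

text \<open>\<open>H\<^sub>0\<^sup>1(\<Omega>)\<close>, the closure of the test functions in \<open>H\<^sup>1(\<Omega>)\<close>.\<close>

definition H10 :: "'a::euclidean_space set \<Rightarrow> ('a \<Rightarrow> real) set" where
  "H10 \<Omega> = {y. \<exists>G \<phi>. has_weak_gradient \<Omega> y G \<and> (\<forall>n. \<phi> n \<in> test_functions \<Omega>) \<and>
      (\<lambda>n::nat. L2norm (lebesgue_on \<Omega>) (\<lambda>x. y x - \<phi> n x)) \<longlonglongrightarrow> 0 \<and>
      (\<lambda>n. L2norm (lebesgue_on \<Omega>) (\<lambda>x. G x - grad (\<phi> n) x)) \<longlonglongrightarrow> 0}"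

section \<open>The state equation\<close>

text \<open>Primitive with the oriented integral. The measure is \<open>lebesgue\<close>, not the default
  \<open>lborel\<close> of interval integrals, since \<open>u\<close> need not be Borel measurable.\<close>

definition g_of :: "(real \<Rightarrow> real) \<Rightarrow> real \<Rightarrow> real" where
  "g_of u t = interval_lebesgue_integral lebesgue 0 (ereal t) u"

text \<open>Weak solutions of \<open>-\<Delta>y + g(y) = f\<close> in \<open>\<Omega>\<close>, \<open>y = 0\<close> on \<open>\<partial>\<Omega>\<close>. If \<open>g = g_of u\<close> with \<open>u\<close> square
  integrable, then \<open>\<bar>g t\<bar> \<le> \<parallel>u\<parallel> \<bar>t\<bar>\<^sup>1\<^sup>/\<^sup>2\<close>, so \<open>g(y)\<close> is square integrable on the bounded set \<open>\<Omega>\<close> and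
  all integrals below converge.\<close>

definition weak_solution ::
    "'a::euclidean_space set \<Rightarrow> ('a \<Rightarrow> real) \<Rightarrow> (real \<Rightarrow> real) \<Rightarrow> ('a \<Rightarrow> real) \<Rightarrow> bool" where
  "weak_solution \<Omega> f g y \<longleftrightarrow> y \<in> H10 \<Omega> \<and>
     (\<exists>G. has_weak_gradient \<Omega> y G \<and>
       (\<forall>v V. v \<in> H10 \<Omega> \<longrightarrow> has_weak_gradient \<Omega> v V \<longrightarrow>
          (\<integral>x. G x \<bullet> V x \<partial>lebesgue_on \<Omega>) + (\<integral>x. g (y x) * v x \<partial>lebesgue_on \<Omega>)
            = (\<integral>x. f x * v x \<partial>lebesgue_on \<Omega>)))"

text \<open>The choice operator picks a representative of the weak solution, which is unique up to
  equality a.e. in \<open>\<Omega>\<close> for the nondecreasing \<open>g\<close> used below.\<close>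

definition pde_solution :: "'a::euclidean_space set \<Rightarrow> ('a \<Rightarrow> real) \<Rightarrow> (real \<Rightarrow> real) \<Rightarrow> 'a \<Rightarrow> real" where
  "pde_solution \<Omega> f g = (SOME y. weak_solution \<Omega> f g y)"

definition S :: "'a::euclidean_space set \<Rightarrow> ('a \<Rightarrow> real) \<Rightarrow> (real \<Rightarrow> real) \<Rightarrow> 'a \<Rightarrow> real" where
  "S \<Omega> f u = pde_solution \<Omega> f (g_of u)"

definition r_P :: "'a::euclidean_space set \<Rightarrow> ('a \<Rightarrow> real) \<Rightarrow> ereal" where
  "r_P \<Omega> f = 2 * Linfty_norm (lebesgue_on \<Omega>) (pde_solution \<Omega> f (\<lambda>_. 0))"

section \<open>The optimization problem\<close>

text \<open>The value may be \<open>\<infinity>\<close>; in \<open>ennreal\<close>, \<open>0 * \<infinity> = 0\<close>, so the \<open>L\<^sup>1\<close> term vanishes for \<open>\<nu>1 = 0\<close>.\<close>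

definition J :: "'a::euclidean_space set \<Rightarrow> ('a \<Rightarrow> real) \<Rightarrow> (real \<Rightarrow> real) \<Rightarrow> real \<Rightarrow> real \<Rightarrow>
    ('a \<Rightarrow> real) \<Rightarrow> (real \<Rightarrow> real) \<Rightarrow> ennreal" where
  "J \<Omega> yD uD \<nu>1 \<nu>2 y u =
     ennreal (1/2 * (L2norm (lebesgue_on \<Omega>) (\<lambda>x. y x - yD x))\<^sup>2)
     + ennreal \<nu>1 * L1_norm lebesgue u
     + ennreal (\<nu>2 / 2 * (L2norm lebesgue (\<lambda>t. u t - uD t))\<^sup>2)"

definition admissible :: "(real \<Rightarrow> real) set" where
  "admissible = {u \<in> L2 lebesgue. AE t in lebesgue. 0 \<le> u t}"

definition local_solution :: "'a::euclidean_space set \<Rightarrow> ('a \<Rightarrow> real) \<Rightarrow> ('a \<Rightarrow> real) \<Rightarrow>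
    (real \<Rightarrow> real) \<Rightarrow> real \<Rightarrow> real \<Rightarrow> (real \<Rightarrow> real) \<Rightarrow> bool" where
  "local_solution \<Omega> f yD uD \<nu>1 \<nu>2 ubar \<longleftrightarrow> ubar \<in> admissible \<and>
     (\<exists>\<rho>>0. \<forall>u\<in>admissible. L2norm lebesgue (\<lambda>t. u t - ubar t) \<le> \<rho> \<longrightarrow>
        J \<Omega> yD uD \<nu>1 \<nu>2 (S \<Omega> f u) u \<ge> J \<Omega> yD uD \<nu>1 \<nu>2 (S \<Omega> f ubar) ubar)"

section \<open>Regulated functions and functions of bounded variation\<close>

definition regulated_on :: "real \<Rightarrow> real \<Rightarrow> (real \<Rightarrow> real) \<Rightarrow> bool" where
  "regulated_on a b v \<longleftrightarrow>
     (\<forall>t\<in>{a<..b}. \<exists>l. (v \<longlongrightarrow> l) (at_left t)) \<and>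
     (\<forall>t\<in>{a..<b}. \<exists>l. (v \<longlongrightarrow> l) (at_right t))"

definition BV_on :: "real \<Rightarrow> real \<Rightarrow> (real \<Rightarrow> real) \<Rightarrow> bool" where
  "BV_on a b v \<longleftrightarrow> (\<exists>C. \<forall>(n::nat) t.
     (\<forall>i\<le>n. t i \<in> {a..b}) \<and> (\<forall>i<n. t i \<le> t (Suc i)) \<longrightarrow>
       (\<Sum>i<n. \<bar>v (t (Suc i)) - v (t i)\<bar>) \<le> C)"

definition Linfty_G :: "real \<Rightarrow> (real \<Rightarrow> real) set" where
  "Linfty_G r = {v \<in> Linfty (lebesgue_on {-r<..<r}).
     \<exists>w. regulated_on (-r) r w \<and> (AE t in lebesgue_on {-r<..<r}. v t = w t)}"

definition Linfty_BV :: "real \<Rightarrow> (real \<Rightarrow> real) set" where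
  "Linfty_BV r = {v \<in> Linfty (lebesgue_on {-r<..<r}).
     \<exists>w. BV_on (-r) r w \<and> (AE t in lebesgue_on {-r<..<r}. v t = w t)}"

end

theory Submission
  imports Defs
begin

text \<open>
  The proof rests on a single Lipschitz estimate. Write \<open>F u\<close> for the tracking term
  \<open>1/2 \<parallel>S u - yD\<parallel>\<^sup>2\<close> and \<open>g\<^sub>u\<close> for the primitive of \<open>u\<close>. Then there is a constant \<open>C\<close> with
  \<open>\<bar>F u - F v\<bar> \<le> C * sup {\<bar>g\<^sub>u s - g\<^sub>v s\<bar> | \<bar>s\<bar> \<le> r}\<close> for all admissible \<open>u\<close>, \<open>v\<close>
  (\<open>tracking_term_lipschitz\<close>). Two facts about the state equation are behind it. Since \<open>g\<^sub>u\<close> has the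
  sign of its argument, a state cannot exceed the solution of the linear problem by more than the
  maximum norm of the latter, so all states take values in \<open>[-r, r]\<close> (\<open>weak_solution_bound\<close>). Since
  \<open>g\<^sub>u\<close> is nondecreasing, testing the difference of two state equations with the difference of the
  states bounds it by the difference of the nonlinearities (\<open>weak_solution_stability\<close>).

  The other two terms of the objective are an \<open>L\<^sup>1\<close> norm, which is linear on nonnegative functions,
  and a square. Comparing the local minimizer \<open>u\<close> with \<open>u + t h\<close>, dividing by \<open>t\<close> and letting \<open>t\<close>
  tend to \<open>0\<close> therefore gives, with \<open>m = uD - \<nu>1 / \<nu>2\<close> and a new constant \<open>C\<close>,
  \<open>0 \<le> \<integral> (u - m) h + C * sup {\<bar>g\<^sub>h s\<bar> | \<bar>s\<bar> \<le> r}\<close> for all directions \<open>h\<close> with \<open>u + h \<ge> 0\<close>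
  (\<open>local_solution_descent_bound\<close>).

  Directions that live outside \<open>[-r, r]\<close> have \<open>g\<^sub>h = 0\<close> on \<open>[-r, r]\<close>, and what remains is the
  variational inequality of the projection: \<open>u = max 0 m\<close> there (\<open>descent_bound_outside\<close>).

  Inside, the supremum norm of the primitive is dual to total variation. Let
  \<open>t\<^sub>0 \<le> \<dots> \<le> t\<^sub>n\<close> be Lebesgue points. Let \<open>h\<close> move mass one from the larger to the smaller of the
  two values of \<open>u\<close> for each pair of consecutive points, by bumps of integral one next to the points.
  Mass is removed only where \<open>u\<close> is positive, so \<open>u + \<tau> h \<ge> 0\<close> for small \<open>\<tau> > 0\<close>; and since the
  primitives of the bumps are ordered steps from \<open>0\<close> to \<open>1\<close>, the primitive of \<open>h\<close> stays bounded by \<open>2\<close>,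
  whatever \<open>n\<close> is. When the bumps shrink, the inequality becomes
  \<open>\<Sum> \<bar>u t\<^sub>i\<^sub>+\<^sub>1 - u t\<^sub>i\<bar> \<le> 2 C + \<Sum> \<bar>m t\<^sub>i\<^sub>+\<^sub>1 - m t\<^sub>i\<bar>\<close> (\<open>descent_bound_chain_variation\<close>).
  A representative of \<open>u\<close> made of cluster values along the Lebesgue points inherits this estimate up to
  a constant. If \<open>m\<close> has bounded variation, then so has the representative. If \<open>m\<close> is regulated, it
  oscillates arbitrarily little to either side of a point; a representative without one-sided limit
  there would have chains of \<open>N\<close> jumps of a fixed height, for every \<open>N\<close>, against a right-hand side
  that grows only by a small multiple of \<open>N\<close>.

  States exist because they minimize a convex energy; the minimizing sequence is taken in the test
  functions, whose gradients are classical (\<open>weak_solution_exists\<close>).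
\<close>

section \<open>Square integrable functions\<close>

lemma L2_measurable [measurable_dest]: "f \<in> L2 M \<Longrightarrow> f \<in> borel_measurable M"
  by (simp add: L2_def)

lemma L2_sq_integrable: "f \<in> L2 M \<Longrightarrow> integrable M (\<lambda>x. (norm (f x))\<^sup>2)"
  by (simp add: L2_def)

lemma L2norm_nonneg [simp]: "0 \<le> L2norm M f"
  by (simp add: L2norm_def)

lemma L2norm_sq: "(L2norm M f)\<^sup>2 = (\<integral>x. (norm (f x))\<^sup>2 \<partial>M)"
  by (simp add: L2norm_def)

lemma L2norm_minus_commute: "L2norm M (\<lambda>x. f x - g x) = L2norm M (\<lambda>x. g x - f x)"
  by (simp add: L2norm_def norm_minus_commute)

lemma L2_inner_integrable:
  assumes "f \<in> L2 M" "g \<in> L2 M"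
  shows "integrable M (\<lambda>x. f x \<bullet> g x)"
proof (rule Bochner_Integration.integrable_bound)
  show "integrable M (\<lambda>x. (norm (f x))\<^sup>2 + (norm (g x))\<^sup>2)"
    using assms by (intro Bochner_Integration.integrable_add L2_sq_integrable)
  show "(\<lambda>x. f x \<bullet> g x) \<in> borel_measurable M"
    using assms by (intro borel_measurable_inner L2_measurable)
  show "AE x in M. norm (f x \<bullet> g x) \<le> norm ((norm (f x))\<^sup>2 + (norm (g x))\<^sup>2)"
  proof (rule AE_I2)
    fix x
    have "\<bar>f x \<bullet> g x\<bar> \<le> norm (f x) * norm (g x)" by (rule Cauchy_Schwarz_ineq2)
    also have "\<dots> \<le> (norm (f x))\<^sup>2 + (norm (g x))\<^sup>2"
      using sum_squares_bound[of "norm (f x)" "norm (g x)"]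
        mult_nonneg_nonneg[OF norm_ge_zero[of "f x"] norm_ge_zero[of "g x"]] by linarith
    finally show "norm (f x \<bullet> g x) \<le> norm ((norm (f x))\<^sup>2 + (norm (g x))\<^sup>2)" by simp
  qed
qed

lemma L2_mult_integrable:
  fixes f g :: "'a \<Rightarrow> real"
  shows "f \<in> L2 M \<Longrightarrow> g \<in> L2 M \<Longrightarrow> integrable M (\<lambda>x. f x * g x)"
  using L2_inner_integrable[of f M g] by simp

lemma L2_scaleR: "f \<in> L2 M \<Longrightarrow> (\<lambda>x. c *\<^sub>R f x) \<in> L2 M"
  by (auto simp: L2_def power_mult_distrib)

lemma L2_cmult: "f \<in> L2 M \<Longrightarrow> (\<lambda>x. c * f x :: real) \<in> L2 M"
  using L2_scaleR[of f M c] by simp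

lemma L2_uminus: "f \<in> L2 M \<Longrightarrow> (\<lambda>x. - f x) \<in> L2 M"
  by (auto simp: L2_def)

lemma L2_zero [simp]: "(\<lambda>x. 0) \<in> L2 M"
  by (auto simp: L2_def)

lemma L2_add:
  assumes "f \<in> L2 M" "g \<in> L2 M"
  shows "(\<lambda>x. f x + g x) \<in> L2 M"
proof -
  have "(\<lambda>x. (norm (f x + g x))\<^sup>2) = (\<lambda>x. (norm (f x))\<^sup>2 + 2 * (f x \<bullet> g x) + (norm (g x))\<^sup>2)"
    by (auto simp: power2_norm_eq_inner inner_add_left inner_add_right inner_commute)
  then show ?thesis using assms L2_inner_integrable[OF assms]
    by (auto simp: L2_def)
qed

lemma L2_diff: "f \<in> L2 M \<Longrightarrow> g \<in> L2 M \<Longrightarrow> (\<lambda>x. f x - g x) \<in> L2 M"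
  using L2_add[of f M "\<lambda>x. - g x"] L2_uminus[of g M] by simp

lemma L2_dominated:
  assumes "g \<in> L2 M" "f \<in> borel_measurable M" "AE x in M. norm (f x) \<le> norm (g x)"
  shows "f \<in> L2 M"
proof -
  have "integrable M (\<lambda>x. (norm (f x))\<^sup>2)"
    using assms(2) assms(3)
    by (intro Bochner_Integration.integrable_bound[OF L2_sq_integrable[OF assms(1)]])
       (auto elim!: eventually_mono intro!: power_mono)
  then show ?thesis using assms(2) by (simp add: L2_def)
qed

lemma L2_norm_fun: "f \<in> L2 M \<Longrightarrow> (\<lambda>x. norm (f x)) \<in> L2 M"
  by (auto simp: L2_def)

lemma L2norm_norm_fun: "L2norm M (\<lambda>x. norm (f x)) = L2norm M f"
  by (simp add: L2norm_def)

lemma L2_abs: fixes f :: "'a \<Rightarrow> real" shows "f \<in> L2 M \<Longrightarrow> (\<lambda>x. \<bar>f x\<bar>) \<in> L2 M"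
  using L2_norm_fun[of f M] by simp

lemma L2norm_abs: fixes f :: "'a \<Rightarrow> real" shows "L2norm M (\<lambda>x. \<bar>f x\<bar>) = L2norm M f"
  by (simp add: L2norm_def)

lemma L2norm_mono:
  assumes "g \<in> L2 M" "f \<in> borel_measurable M" "AE x in M. norm (f x) \<le> norm (g x)"
  shows "L2norm M f \<le> L2norm M g"
  unfolding L2norm_def using assms L2_dominated[OF assms]
  by (intro real_sqrt_le_mono integral_mono_AE L2_sq_integrable)
     (auto elim!: eventually_mono intro!: power_mono)

lemma L2norm_scaleR: "L2norm M (\<lambda>x. c *\<^sub>R f x) = \<bar>c\<bar> * L2norm M f"
  by (simp add: L2norm_def power_mult_distrib real_sqrt_mult)

lemma L2norm_eq_0_AE:
  assumes "f \<in> L2 M" "L2norm M f = 0"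
  shows "AE x in M. f x = 0"
proof -
  have "(\<integral>x. (norm (f x))\<^sup>2 \<partial>M) = 0"
    using assms(2) L2norm_sq[of M f] by simp
  then have "AE x in M. (norm (f x))\<^sup>2 = 0"
    using integral_nonneg_eq_0_iff_AE[OF L2_sq_integrable[OF assms(1)]] by simp
  then show ?thesis by simp
qed

lemma L2norm_sq_add:
  assumes "f \<in> L2 M" "g \<in> L2 M"
  shows "(L2norm M (\<lambda>x. f x + g x))\<^sup>2 = (L2norm M f)\<^sup>2 + 2 * (\<integral>x. f x \<bullet> g x \<partial>M) + (L2norm M g)\<^sup>2"
proof -
  have "(\<lambda>x. (norm (f x + g x))\<^sup>2) = (\<lambda>x. (norm (f x))\<^sup>2 + 2 * (f x \<bullet> g x) + (norm (g x))\<^sup>2)"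
    by (auto simp: power2_norm_eq_inner inner_add_left inner_add_right inner_commute)
  then show ?thesis using assms L2_inner_integrable[OF assms]
    by (simp add: L2norm_sq L2_sq_integrable)
qed

text \<open>With \<open>b = \<parallel>g\<parallel>\<close> and \<open>c = \<integral> f \<bullet> g\<close>, the norm of \<open>b\<^sup>2 f - c g\<close> is a square root of
  \<open>b\<^sup>2 ((\<parallel>f\<parallel> b)\<^sup>2 - c\<^sup>2)\<close>.\<close>

lemma L2_Cauchy_Schwarz:
  assumes "f \<in> L2 M" "g \<in> L2 M"
  shows "\<bar>\<integral>x. f x \<bullet> g x \<partial>M\<bar> \<le> L2norm M f * L2norm M g"
proof (cases "L2norm M g = 0")
  case True
  then have "AE x in M. f x \<bullet> g x = 0"
    using L2norm_eq_0_AE[OF assms(2)] by (auto elim!: eventually_mono)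
  then show ?thesis using True by (simp add: integral_eq_zero_AE)
next
  case False
  define a where "a = L2norm M f"
  define b where "b = L2norm M g"
  define c where "c = (\<integral>x. f x \<bullet> g x \<partial>M)"
  have ab: "0 \<le> a" "0 < b" using False by (auto simp: a_def b_def less_le)
  define d where "d = - c"
  have "0 \<le> (L2norm M (\<lambda>x. (b\<^sup>2) *\<^sub>R f x + d *\<^sub>R g x))\<^sup>2" by simp
  also have "\<dots> = (b\<^sup>2 * a)\<^sup>2 + 2 * b\<^sup>2 * d * c + (d * b)\<^sup>2"
    by (subst L2norm_sq_add)
       (simp_all add: assms L2_scaleR L2norm_scaleR a_def b_def c_def power_mult_distrib)
  also have "\<dots> = b\<^sup>2 * ((a * b)\<^sup>2 - c\<^sup>2)" by (simp add: d_def power2_eq_square algebra_simps)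
  finally have "c\<^sup>2 \<le> (a * b)\<^sup>2" using ab by (simp add: zero_le_mult_iff)
  then have "\<bar>c\<bar> \<le> a * b" using ab by (simp add: abs_le_square_iff[symmetric])
  then show ?thesis by (simp add: a_def b_def c_def)
qed

lemma L2_Cauchy_Schwarz_real:
  fixes f g :: "'a \<Rightarrow> real"
  shows "f \<in> L2 M \<Longrightarrow> g \<in> L2 M \<Longrightarrow> \<bar>\<integral>x. f x * g x \<partial>M\<bar> \<le> L2norm M f * L2norm M g"
  using L2_Cauchy_Schwarz[of f M g] by simp

lemma L2norm_triangle:
  assumes "f \<in> L2 M" "g \<in> L2 M"
  shows "L2norm M (\<lambda>x. f x + g x) \<le> L2norm M f + L2norm M g"
proof (rule power2_le_imp_le)
  show "(L2norm M (\<lambda>x. f x + g x))\<^sup>2 \<le> (L2norm M f + L2norm M g)\<^sup>2"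
    using L2norm_sq_add[OF assms] L2_Cauchy_Schwarz[OF assms]
    by (simp add: power2_sum abs_le_iff)
qed simp

lemma L2norm_triangle_diff:
  assumes "f \<in> L2 M" "g \<in> L2 M"
  shows "\<bar>L2norm M f - L2norm M g\<bar> \<le> L2norm M (\<lambda>x. f x - g x)"
  using L2norm_triangle[OF L2_diff[OF assms] assms(2)]
    L2norm_triangle[OF L2_diff[OF assms(2,1)] assms(1)] L2norm_minus_commute[of M f g]
  by (simp add: abs_le_iff)

lemma L2_bounded:
  assumes "finite_measure M" "f \<in> borel_measurable M" "AE x in M. norm (f x) \<le> c"
  shows "f \<in> L2 M"
proof -
  interpret finite_measure M by fact
  have "AE x in M. norm ((norm (f x))\<^sup>2) \<le> c\<^sup>2"
    using assms(3) by (auto elim!: eventually_mono intro!: power_mono)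
  then show ?thesis using assms(2)
    by (auto simp: L2_def intro!: integrable_const_bound)
qed

lemma L2norm_bounded:
  assumes "finite_measure M" "f \<in> borel_measurable M" "AE x in M. norm (f x) \<le> c" "0 \<le> c"
  shows "L2norm M f \<le> c * sqrt (measure M (space M))"
proof -
  interpret finite_measure M by fact
  have c: "(\<lambda>x. c) \<in> L2 M" by (rule L2_bounded) (use assms in auto)
  have "L2norm M f \<le> L2norm M (\<lambda>x. c)"
    using assms by (intro L2norm_mono[OF c]) auto
  also have "\<dots> = c * sqrt (measure M (space M))"
    using assms(4) by (simp add: L2norm_def real_sqrt_mult)
  finally show ?thesis .
qed

section \<open>Convergence in the quadratic mean\<close>

definition L2conv :: "'a measure \<Rightarrow> (nat \<Rightarrow> 'a \<Rightarrow> 'b::euclidean_space) \<Rightarrow> ('a \<Rightarrow> 'b) \<Rightarrow> bool" where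
  "L2conv M F f \<longleftrightarrow> (\<forall>n. F n \<in> L2 M) \<and> f \<in> L2 M \<and> (\<lambda>n. L2norm M (\<lambda>x. F n x - f x)) \<longlonglongrightarrow> 0"

lemma L2convD:
  assumes "L2conv M F f"
  shows "F n \<in> L2 M" "f \<in> L2 M" "(\<lambda>n. L2norm M (\<lambda>x. F n x - f x)) \<longlonglongrightarrow> 0"
  using assms by (auto simp: L2conv_def)

lemma L2conv_norm: assumes "L2conv M F f" shows "(\<lambda>n. L2norm M (F n)) \<longlonglongrightarrow> L2norm M f"
proof -
  have "(\<lambda>n. L2norm M (F n) - L2norm M f) \<longlonglongrightarrow> 0"
    using L2norm_triangle_diff L2convD[OF assms]
    by (intro Lim_null_comparison[OF _ L2convD(3)[OF assms]]) (auto intro!: always_eventually)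
  then show ?thesis by (simp add: LIM_zero_iff)
qed

lemma L2conv_const: "f \<in> L2 M \<Longrightarrow> L2conv M (\<lambda>n. f) f"
  by (simp add: L2conv_def) (simp add: L2norm_def)

lemma L2conv_dominated:
  assumes "\<And>n. F n \<in> L2 M" "f \<in> L2 M" "\<And>n. L2norm M (\<lambda>x. F n x - f x) \<le> e n" "e \<longlonglongrightarrow> 0"
  shows "L2conv M F f"
  unfolding L2conv_def using assms
  by (auto intro!: Lim_null_comparison[OF _ assms(4)] always_eventually)

lemma L2conv_scaleR:
  assumes "L2conv M F f" shows "L2conv M (\<lambda>n x. c *\<^sub>R F n x) (\<lambda>x. c *\<^sub>R f x)"
proof (rule L2conv_dominated)
  show "(\<lambda>n. \<bar>c\<bar> * L2norm M (\<lambda>x. F n x - f x)) \<longlonglongrightarrow> 0"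
    using tendsto_mult_right_zero[OF L2convD(3)[OF assms]] .
  show "L2norm M (\<lambda>x. c *\<^sub>R F n x - c *\<^sub>R f x) \<le> \<bar>c\<bar> * L2norm M (\<lambda>x. F n x - f x)" for n
    by (simp flip: scaleR_right_diff_distrib add: L2norm_scaleR)
qed (use L2convD[OF assms] in \<open>auto intro: L2_scaleR\<close>)

lemma L2conv_add:
  assumes "L2conv M F f" "L2conv M G g"
  shows "L2conv M (\<lambda>n x. F n x + G n x) (\<lambda>x. f x + g x)"
proof (rule L2conv_dominated)
  note a = L2convD[OF assms(1)] and b = L2convD[OF assms(2)]
  show "(\<lambda>n. L2norm M (\<lambda>x. F n x - f x) + L2norm M (\<lambda>x. G n x - g x)) \<longlonglongrightarrow> 0"
    using tendsto_add[OF a(3) b(3)] by simp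
  show "L2norm M (\<lambda>x. F n x + G n x - (f x + g x))
      \<le> L2norm M (\<lambda>x. F n x - f x) + L2norm M (\<lambda>x. G n x - g x)" for n
    using L2norm_triangle[OF L2_diff[OF a(1) a(2)] L2_diff[OF b(1) b(2)], of n n]
    by (simp add: algebra_simps)
qed (use L2convD[OF assms(1)] L2convD[OF assms(2)] in \<open>auto intro: L2_add\<close>)

lemma L2conv_uminus:
  assumes "L2conv M F f" shows "L2conv M (\<lambda>n x. - F n x) (\<lambda>x. - f x)"
  using L2conv_scaleR[OF assms, of "-1"] by simp

lemma L2conv_diff:
  assumes "L2conv M F f" "L2conv M G g"
  shows "L2conv M (\<lambda>n x. F n x - G n x) (\<lambda>x. f x - g x)"
  using L2conv_add[OF assms(1) L2conv_uminus[OF assms(2)]] by simp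

lemma L2conv_inner:
  assumes "L2conv M F f" "L2conv M G g"
  shows "(\<lambda>n. \<integral>x. F n x \<bullet> G n x \<partial>M) \<longlonglongrightarrow> (\<integral>x. f x \<bullet> g x \<partial>M)"
proof -
  note a = L2convD[OF assms(1)] and b = L2convD[OF assms(2)]
  have bound: "\<bar>(\<integral>x. F n x \<bullet> G n x \<partial>M) - (\<integral>x. f x \<bullet> g x \<partial>M)\<bar>
     \<le> L2norm M (F n) * L2norm M (\<lambda>x. G n x - g x) + L2norm M (\<lambda>x. F n x - f x) * L2norm M g" for n
  proof -
    have "(\<integral>x. F n x \<bullet> G n x \<partial>M) - (\<integral>x. f x \<bullet> g x \<partial>M)
      = (\<integral>x. F n x \<bullet> (G n x - g x) \<partial>M) + (\<integral>x. (F n x - f x) \<bullet> g x \<partial>M)"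
      using a(1,2) b(1,2)
      by (simp add: inner_diff_left inner_diff_right L2_inner_integrable)
    then show ?thesis
      using L2_Cauchy_Schwarz[OF a(1) L2_diff[OF b(1) b(2)], of n n]
        L2_Cauchy_Schwarz[OF L2_diff[OF a(1) a(2)] b(2), of n] by linarith
  qed
  have "(\<lambda>n. (\<integral>x. F n x \<bullet> G n x \<partial>M) - (\<integral>x. f x \<bullet> g x \<partial>M)) \<longlonglongrightarrow> 0"
  proof (rule Lim_null_comparison)
    show "\<forall>\<^sub>F n in sequentially. norm ((\<integral>x. F n x \<bullet> G n x \<partial>M) - (\<integral>x. f x \<bullet> g x \<partial>M))
      \<le> L2norm M (F n) * L2norm M (\<lambda>x. G n x - g x) + L2norm M (\<lambda>x. F n x - f x) * L2norm M g"
      using bound by simp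
    have "(\<lambda>n. L2norm M (F n) * L2norm M (\<lambda>x. G n x - g x) + L2norm M (\<lambda>x. F n x - f x) * L2norm M g)
        \<longlonglongrightarrow> L2norm M f * 0 + 0 * L2norm M g"
      by (intro tendsto_intros L2conv_norm[OF assms(1)] a(3) b(3))
    then show "(\<lambda>n. L2norm M (F n) * L2norm M (\<lambda>x. G n x - g x) + L2norm M (\<lambda>x. F n x - f x) * L2norm M g) \<longlonglongrightarrow> 0"
      by simp
  qed
  then show ?thesis by (simp add: LIM_zero_iff)
qed

lemma L2conv_mult:
  fixes f g :: "'a \<Rightarrow> real"
  assumes "L2conv M F f" "L2conv M G g"
  shows "(\<lambda>n. \<integral>x. F n x * G n x \<partial>M) \<longlonglongrightarrow> (\<integral>x. f x * g x \<partial>M)"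
  using L2conv_inner[OF assms] by simp

text \<open>On a finite measure space a Cauchy sequence in the quadratic mean is Cauchy in the mean, so a
  subsequence converges almost everywhere. Fatou's lemma bounds the distance of each member of the
  sequence to the pointwise limit.\<close>

lemma L2_complete:
  fixes F :: "nat \<Rightarrow> 'a \<Rightarrow> 'b::euclidean_space"
  assumes fin: "finite_measure M" and F: "\<And>n. F n \<in> L2 M"
    and Cauchy: "\<And>e. 0 < e \<Longrightarrow> \<exists>N. \<forall>i\<ge>N. \<forall>j\<ge>N. L2norm M (\<lambda>x. F i x - F j x) < e"
  obtains f where "L2conv M F f"
proof -
  interpret finite_measure M by fact
  define m where "m = L2norm M (\<lambda>x. 1::real)"
  have one: "(\<lambda>x. 1::real) \<in> L2 M" by (rule L2_bounded[OF fin]) auto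
  have D: "(\<lambda>x. F i x - F j x) \<in> L2 M" for i j using F by (intro L2_diff)
  have L1: "integrable M (F n)" for n
  proof -
    have "integrable M (\<lambda>x. norm (F n x))"
      using L2_mult_integrable[OF L2_norm_fun[OF F] one] by simp
    then show ?thesis using F L2_measurable by (simp add: integrable_norm_iff)
  qed
  have le: "(\<integral>x. norm (F i x - F j x) \<partial>M) \<le> m * L2norm M (\<lambda>x. F i x - F j x)" for i j
    using L2_Cauchy_Schwarz_real[OF one L2_norm_fun[OF D]]
    by (simp add: m_def L2norm_norm_fun)
  have m: "0 \<le> m" by (simp add: m_def)
  have "\<exists>N. \<forall>i\<ge>N. \<forall>j\<ge>N. (\<integral>x. norm (F i x - F j x) \<partial>M) < e" if "0 < e" for e
  proof -
    have "0 < e / (m + 1)" using m that by simp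
    then obtain N where N: "\<forall>i\<ge>N. \<forall>j\<ge>N. L2norm M (\<lambda>x. F i x - F j x) < e / (m + 1)"
      using Cauchy by blast
    have "(\<integral>x. norm (F i x - F j x) \<partial>M) < e" if "i \<ge> N" "j \<ge> N" for i j
    proof -
      have "(\<integral>x. norm (F i x - F j x) \<partial>M) \<le> (m + 1) * L2norm M (\<lambda>x. F i x - F j x)"
        using le[of i j] L2norm_nonneg[of M "\<lambda>x. F i x - F j x"] unfolding distrib_right by linarith
      also have "\<dots> < e" using N that m by (simp add: field_simps)
      finally show ?thesis .
    qed
    then show ?thesis by blast
  qed
  then obtain r where r: "strict_mono r" "AE x in M. Cauchy (\<lambda>i. F (r i) x)"
    using cauchy_L1_AE_cauchy_subseq[of M F, OF L1] by metis
  define f where "f x = lim (\<lambda>i. F (r i) x)" for x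
  have [measurable]: "F n \<in> borel_measurable M" for n using F by (rule L2_measurable)
  have fm [measurable]: "f \<in> borel_measurable M"
    unfolding f_def by (rule borel_measurable_lim_metric) simp
  have conv: "AE x in M. (\<lambda>i. F (r i) x) \<longlonglongrightarrow> f x"
    using r(2) unfolding f_def by eventually_elim (simp add: Cauchy_convergent_iff convergent_LIMSEQ_iff)
  have key: "(\<lambda>x. F n x - f x) \<in> L2 M \<and> L2norm M (\<lambda>x. F n x - f x) \<le> e"
    if e: "0 < e" and N: "\<forall>i\<ge>N. \<forall>j\<ge>N. L2norm M (\<lambda>x. F i x - F j x) < e" and n: "n \<ge> N" for e N n
  proof -
    have "(\<integral>\<^sup>+x. ennreal ((norm (F n x - f x))\<^sup>2) \<partial>M)
        = (\<integral>\<^sup>+x. liminf (\<lambda>i. ennreal ((norm (F n x - F (r i) x))\<^sup>2)) \<partial>M)"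
    proof (rule nn_integral_cong_AE)
      show "AE x in M. ennreal ((norm (F n x - f x))\<^sup>2)
          = liminf (\<lambda>i. ennreal ((norm (F n x - F (r i) x))\<^sup>2))"
        using conv
      proof eventually_elim
        case (elim x)
        have "(\<lambda>i. ennreal ((norm (F n x - F (r i) x))\<^sup>2)) \<longlonglongrightarrow> ennreal ((norm (F n x - f x))\<^sup>2)"
          by (intro tendsto_intros elim)
        from lim_imp_Liminf[OF _ this] show ?case by simp
      qed
    qed
    also have "\<dots> \<le> liminf (\<lambda>i. \<integral>\<^sup>+x. ennreal ((norm (F n x - F (r i) x))\<^sup>2) \<partial>M)"
      by (rule nn_integral_liminf) simp
    also have "\<dots> \<le> ennreal (e\<^sup>2)"
    proof (rule Liminf_le)
      have "(\<integral>\<^sup>+x. ennreal ((norm (F n x - F (r i) x))\<^sup>2) \<partial>M) \<le> ennreal (e\<^sup>2)" if "i \<ge> N" for i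
      proof -
        have "r i \<ge> N" using that seq_suble[OF r(1), of i] by simp
        then have "L2norm M (\<lambda>x. F n x - F (r i) x) \<le> e" using N n by (simp add: less_imp_le)
        then have "(L2norm M (\<lambda>x. F n x - F (r i) x))\<^sup>2 \<le> e\<^sup>2" by (intro power_mono) auto
        then show ?thesis
          using nn_integral_eq_integral[OF L2_sq_integrable[OF D[of n "r i"]]]
          by (simp add: L2norm_sq ennreal_leI)
      qed
      then show "\<forall>\<^sub>F i in sequentially. (\<integral>\<^sup>+x. ennreal ((norm (F n x - F (r i) x))\<^sup>2) \<partial>M) \<le> ennreal (e\<^sup>2)"
        by (auto simp: eventually_sequentially)
    qed auto
    finally have *: "(\<integral>\<^sup>+x. ennreal ((norm (F n x - f x))\<^sup>2) \<partial>M) \<le> ennreal (e\<^sup>2)" .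
    then have int: "integrable M (\<lambda>x. (norm (F n x - f x))\<^sup>2)"
      by (intro integrableI_nonneg) (auto simp: le_less_trans[OF _ ennreal_less_top])
    have "(\<integral>x. (norm (F n x - f x))\<^sup>2 \<partial>M) \<le> e\<^sup>2"
      using * nn_integral_eq_integral[OF int] by (simp add: ennreal_le_iff)
    then have "L2norm M (\<lambda>x. F n x - f x) \<le> sqrt (e\<^sup>2)"
      unfolding L2norm_def by (rule real_sqrt_le_mono)
    then show ?thesis using int e by (auto simp: L2_def)
  qed
  have fL2: "f \<in> L2 M"
  proof -
    obtain N where "\<forall>i\<ge>N. \<forall>j\<ge>N. L2norm M (\<lambda>x. F i x - F j x) < 1" using Cauchy[of 1] by auto
    then have "(\<lambda>x. F N x - f x) \<in> L2 M" using key[of 1 N N] by simp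
    then show ?thesis using L2_diff[OF F[of N], of "\<lambda>x. F N x - f x"] by simp
  qed
  have "(\<lambda>n. L2norm M (\<lambda>x. F n x - f x)) \<longlonglongrightarrow> 0"
  proof (rule LIMSEQ_I)
    fix e :: real assume "0 < e"
    then obtain N where "\<forall>i\<ge>N. \<forall>j\<ge>N. L2norm M (\<lambda>x. F i x - F j x) < e / 2"
      using Cauchy[of "e / 2"] by auto
    then have "L2norm M (\<lambda>x. F n x - f x) \<le> e / 2" if "n \<ge> N" for n
      using key[of "e/2" N n] that \<open>0 < e\<close> by simp
    then show "\<exists>N. \<forall>n\<ge>N. norm (L2norm M (\<lambda>x. F n x - f x) - 0) < e"
      using \<open>0 < e\<close> by (intro exI[of _ N]) force
  qed
  then have "L2conv M F f" using F fL2 by (simp add: L2conv_def)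
  then show ?thesis by (rule that)
qed

section \<open>A smooth function vanishing on the negative half line\<close>

text \<open>The functions \<open>exp (- 1 / s) / s\<^sup>j\<close>, extended by \<open>0\<close>. Derivatives of members of this family are
  linear combinations of members, so all of them are smooth. The function \<open>flat 0\<close> is a smooth
  substitute for the positive part: it is nondecreasing, and positive exactly on the positive numbers.\<close>

definition flat :: "nat \<Rightarrow> real \<Rightarrow> real" where
  "flat j s = (if 0 < s then exp (- (1 / s)) / s ^ j else 0)"

lemma flat_nonneg [simp]: "0 \<le> flat j s"
  by (simp add: flat_def)

lemma flat_nonpos [simp]: "s \<le> 0 \<Longrightarrow> flat j s = 0"
  by (simp add: flat_def)

lemma flat_pos: "0 < s \<Longrightarrow> 0 < flat j s"
  by (simp add: flat_def)

lemma power_le_fact_exp: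
  assumes "0 \<le> (t::real)" shows "t ^ k \<le> fact k * exp t"
proof -
  have "(\<Sum>n\<in>{k}. t ^ n /\<^sub>R fact n) \<le> (\<Sum>n. t ^ n /\<^sub>R fact n)"
    using assms by (intro sum_le_suminf summable_exp_generic) auto
  then show ?thesis by (simp add: exp_def field_simps)
qed

text \<open>Put \<open>t = 1 / s\<close> in \<open>t\<^sup>j \<le> j! exp t\<close>.\<close>

lemma flat_le: "flat j s \<le> fact j"
proof (cases "0 < s")
  case True
  have "(1 / s) ^ j \<le> fact j * exp (1 / s)" using True by (intro power_le_fact_exp) simp
  then show ?thesis using True
    by (simp add: flat_def exp_minus field_simps)
qed simp

text \<open>At \<open>0\<close> the difference quotient \<open>flat j h / h\<close> is \<open>h * flat (j + 2) h\<close> for \<open>h > 0\<close>, hence of order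
  \<open>h\<close> by the bound on the family.\<close>

lemma flat_deriv: "(flat j has_real_derivative flat (j + 2) s - real j * flat (j + 1) s) (at s)"
proof -
  consider "s < 0" | "s = 0" | "0 < s" by linarith
  then show ?thesis
  proof cases
    case 1
    have "((\<lambda>s. 0) has_real_derivative 0) (at s)" by simp
    then have "(flat j has_real_derivative 0) (at s)"
      by (rule has_field_derivative_transform_within_open[of _ _ _ "{..<0}"]) (use 1 in auto)
    then show ?thesis using 1 by simp
  next
    case 2
    have "((\<lambda>h. flat j h / h) \<longlongrightarrow> 0) (at 0)"
    proof (rule Lim_null_comparison)
      have "\<bar>flat j h / h\<bar> \<le> \<bar>h\<bar> * fact (j + 2)" for h :: real
      proof (cases "0 < h")
        case True
        then have "flat j h / h = h * flat (j + 2) h" by (simp add: flat_def power_add field_simps power2_eq_square)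
        then show ?thesis using True flat_le[of "j + 2" h] by (simp add: abs_mult mult_left_mono)
      next
        case False
        have "0 \<le> \<bar>h\<bar> * fact (j + 2)" by (rule mult_nonneg_nonneg) auto
        moreover have "\<bar>flat j h / h\<bar> = 0" using False by simp
        ultimately show ?thesis by linarith
      qed
      then show "\<forall>\<^sub>F h in at 0. norm (flat j h / h) \<le> \<bar>h\<bar> * fact (j + 2)" by simp
      show "((\<lambda>h. \<bar>h\<bar> * fact (j + 2)) \<longlongrightarrow> 0) (at (0::real))"
        by (rule tendsto_eq_intros refl)+ simp
    qed
    then show ?thesis using 2 by (simp add: DERIV_def)
  next
    case 3
    have "((\<lambda>s. exp (- (1 / s)) / s ^ j) has_real_derivative
        (exp (- (1 / s)) * (1 / s\<^sup>2) * s ^ j - exp (- (1 / s)) * (real j * s ^ (j - 1))) / (s ^ j * s ^ j)) (at s)"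
      using 3 by (auto intro!: derivative_eq_intros simp: power2_eq_square)
    also have "(exp (- (1 / s)) * (1 / s\<^sup>2) * s ^ j - exp (- (1 / s)) * (real j * s ^ (j - 1))) / (s ^ j * s ^ j)
       = flat (j + 2) s - real j * flat (j + 1) s"
      using 3 by (cases j) (auto simp: flat_def field_simps power2_eq_square power_add)
    finally show ?thesis
      by (rule has_field_derivative_transform_within_open[of _ _ _ "{0<..}"]) (use 3 in \<open>auto simp: flat_def\<close>)
  qed
qed

lemma flat_lipschitz: "\<bar>flat 0 s - flat 0 t\<bar> \<le> 2 * \<bar>s - t\<bar>"
proof -
  have "norm (flat 0 s - flat 0 t) \<le> 2 * norm (s - t)"
  proof (rule field_differentiable_bound[where S=UNIV and f'="flat 2"])
    show "(flat 0 has_field_derivative flat 2 z) (at z within UNIV)" for z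
      using flat_deriv[of 0 z] by (simp add: numeral_2_eq_2)
    show "norm (flat 2 z) \<le> 2" for z using flat_le[of 2 z] by (simp add: fact_2)
  qed auto
  then show ?thesis by simp
qed

section \<open>Test functions\<close>

lemma frechet_derivativeI: "(f has_derivative f') (at x) \<Longrightarrow> frechet_derivative f (at x) b = f' b"
  using frechet_derivative_at by metis

text \<open>The definition of \<open>Ck\<close> speaks of \<open>frechet_derivative\<close>, which is a choice; this rule admits any
  explicit derivative.\<close>

lemma Ck_SucI:
  assumes "\<And>x. (f has_derivative D x) (at x)" "\<And>b. b \<in> Basis \<Longrightarrow> Ck k (\<lambda>x. D x b)"
  shows "Ck (Suc k) f"
proof -
  have "(\<lambda>x. frechet_derivative f (at x) b) = (\<lambda>x. D x b)" for b
    using frechet_derivativeI[OF assms(1)] by blast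
  then show ?thesis using assms by (auto simp: differentiable_def)
qed

lemma Ck_Suc_has_derivative:
  "Ck (Suc k) f \<Longrightarrow> (f has_derivative frechet_derivative f (at x)) (at x)"
  by (simp add: frechet_derivative_works[symmetric])

lemma Ck_Suc_partial: "Ck (Suc k) f \<Longrightarrow> b \<in> Basis \<Longrightarrow> Ck k (\<lambda>x. frechet_derivative f (at x) b)"
  by simp

lemma Ck_Suc_imp_Ck: "Ck (Suc k) f \<Longrightarrow> Ck k f"
proof (induction k arbitrary: f)
  case 0
  then show ?case
    by (auto intro!: continuous_at_imp_continuous_on differentiable_imp_continuous_within)
qed simp

lemma Ck_cmult: "Ck k f \<Longrightarrow> Ck k (\<lambda>x. c * f x)"
proof (induction k arbitrary: f)
  case 0
  then show ?case by (auto intro!: continuous_intros)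
next
  case (Suc k)
  show ?case
  proof (rule Ck_SucI)
    show "((\<lambda>x. c * f x) has_derivative (\<lambda>h. c * frechet_derivative f (at x) h)) (at x)" for x
      by (intro has_derivative_mult_right Ck_Suc_has_derivative[OF Suc.prems])
  qed (use Suc in simp)
qed

lemma Ck_add: "Ck k f \<Longrightarrow> Ck k g \<Longrightarrow> Ck k (\<lambda>x. f x + g x)"
proof (induction k arbitrary: f g)
  case 0
  then show ?case by (auto intro!: continuous_intros)
next
  case (Suc k)
  show ?case
  proof (rule Ck_SucI)
    show "((\<lambda>x. f x + g x) has_derivative
        (\<lambda>h. frechet_derivative f (at x) h + frechet_derivative g (at x) h)) (at x)" for x
      by (intro has_derivative_add Ck_Suc_has_derivative[OF Suc.prems(1)] Ck_Suc_has_derivative[OF Suc.prems(2)])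
  qed (use Suc in simp)
qed

lemma Ck_mult: "Ck k f \<Longrightarrow> Ck k g \<Longrightarrow> Ck k (\<lambda>x. f x * g x)"
proof (induction k arbitrary: f g)
  case 0
  then show ?case by (auto intro!: continuous_intros)
next
  case (Suc k)
  show ?case
  proof (rule Ck_SucI)
    show "((\<lambda>x. f x * g x) has_derivative
        (\<lambda>h. f x * frechet_derivative g (at x) h + frechet_derivative f (at x) h * g x)) (at x)" for x
      by (intro has_derivative_mult Ck_Suc_has_derivative[OF Suc.prems(1)] Ck_Suc_has_derivative[OF Suc.prems(2)])
    show "Ck k (\<lambda>x. f x * frechet_derivative g (at x) b + frechet_derivative f (at x) b * g x)"
      if "b \<in> Basis" for b
      by (rule Ck_add[OF Suc.IH[OF Ck_Suc_imp_Ck[OF Suc.prems(1)] Ck_Suc_partial[OF Suc.prems(2) that]]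
            Suc.IH[OF Ck_Suc_partial[OF Suc.prems(1) that] Ck_Suc_imp_Ck[OF Suc.prems(2)]]])
  qed
qed

lemma flat_comp_has_derivative:
  assumes "(f has_derivative f') (at x)"
  shows "((\<lambda>x. flat j (f x - M)) has_derivative
    (\<lambda>h. (flat (j + 2) (f x - M) - real j * flat (j + 1) (f x - M)) * f' h)) (at x)"
proof -
  have "((\<lambda>x. f x - M) has_derivative f') (at x)"
    using has_derivative_diff[OF assms has_derivative_const[of M]] by simp
  from has_derivative_compose[OF this flat_deriv[of j "f x - M", unfolded has_field_derivative_def]]
  show ?thesis by simp
qed

text \<open>The induction runs over all \<open>j\<close> at once, since the derivative of \<open>flat j\<close> involves \<open>flat (j + 1)\<close>
  and \<open>flat (j + 2)\<close>.\<close>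

lemma Ck_flat_comp: "(\<And>k. Ck k f) \<Longrightarrow> Ck k (\<lambda>x. flat j (f x - M))"
proof (induction k arbitrary: j)
  case 0
  have "(f has_derivative frechet_derivative f (at x)) (at x)" for x
    using 0[of "Suc 0"] by (rule Ck_Suc_has_derivative)
  then show ?case
    by (auto intro!: continuous_at_imp_continuous_on has_derivative_continuous flat_comp_has_derivative)
next
  case (Suc k)
  have f: "(f has_derivative frechet_derivative f (at x)) (at x)" for x
    using Suc.prems[of "Suc 0"] by (rule Ck_Suc_has_derivative)
  show ?case
  proof (rule Ck_SucI[OF flat_comp_has_derivative[OF f]])
    fix b :: 'a assume b: "b \<in> Basis"
    have "Ck k (\<lambda>x. flat (j + 2) (f x - M) + (- real j) * flat (j + 1) (f x - M))"
      using Suc by (intro Ck_add Ck_cmult Suc.IH) auto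
    then show "Ck k (\<lambda>x. (flat (j + 2) (f x - M) - real j * flat (j + 1) (f x - M))
        * frechet_derivative f (at x) b)"
      using Ck_Suc_partial[OF Suc.prems b] by (intro Ck_mult) auto
  qed
qed

lemma test_functionI:
  assumes "\<And>k. Ck k \<phi>" "compact K" "K \<subseteq> \<Omega>" "\<And>x. x \<notin> K \<Longrightarrow> \<phi> x = 0"
  shows "\<phi> \<in> test_functions \<Omega>"
proof -
  have "closure {x. \<phi> x \<noteq> 0} \<subseteq> K"
    using assms(2,4) by (intro closure_minimal compact_imp_closed) auto
  moreover have "bounded {x. \<phi> x \<noteq> 0}"
    by (rule bounded_subset[OF compact_imp_bounded[OF assms(2)]]) (use assms(4) in auto)
  ultimately show ?thesis using assms(1,3) by (auto simp: test_functions_def)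
qed

lemma test_functionE:
  assumes "\<phi> \<in> test_functions \<Omega>"
  obtains K where "compact K" "K \<subseteq> \<Omega>" "\<And>x. x \<notin> K \<Longrightarrow> \<phi> x = 0"
proof (rule that)
  show "compact (closure {x. \<phi> x \<noteq> 0})" "closure {x. \<phi> x \<noteq> 0} \<subseteq> \<Omega>"
    using assms by (auto simp: test_functions_def)
  show "\<phi> x = 0" if "x \<notin> closure {x. \<phi> x \<noteq> 0}" for x
    using that closure_subset[of "{x. \<phi> x \<noteq> 0}"] by auto
qed

lemma test_function_Ck: "\<phi> \<in> test_functions \<Omega> \<Longrightarrow> Ck k \<phi>"
  by (simp add: test_functions_def)

lemma test_function_has_derivative:
  "\<phi> \<in> test_functions \<Omega> \<Longrightarrow> (\<phi> has_derivative frechet_derivative \<phi> (at x)) (at x)"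
  using test_function_Ck[of \<phi> \<Omega> "Suc 0"] by (rule Ck_Suc_has_derivative)

lemma test_function_continuous: "\<phi> \<in> test_functions \<Omega> \<Longrightarrow> continuous_on A \<phi>"
  using test_function_Ck[of \<phi> \<Omega> 0] by (auto intro: continuous_on_subset)

lemma grad_inner_Basis: "b \<in> Basis \<Longrightarrow> grad \<phi> x \<bullet> b = frechet_derivative \<phi> (at x) b"
  unfolding grad_def by (rule inner_sum_left_Basis)

lemma test_function_zero: "(\<lambda>x. 0) \<in> test_functions \<Omega>"
proof -
  have "Ck k (\<lambda>x::'a::euclidean_space. 0)" for k
    by (induction k) (auto simp: frechet_derivative_const)
  then show ?thesis by (auto simp: test_functions_def)
qed

lemma test_function_cmult:
  assumes "\<phi> \<in> test_functions \<Omega>" shows "(\<lambda>x. c * \<phi> x) \<in> test_functions \<Omega>"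
proof -
  obtain K where "compact K" "K \<subseteq> \<Omega>" "\<And>x. x \<notin> K \<Longrightarrow> \<phi> x = 0"
    using test_functionE[OF assms] by blast
  then show ?thesis using test_function_Ck[OF assms]
    by (intro test_functionI[of _ K] Ck_cmult) auto
qed

lemma test_function_add:
  assumes "\<phi> \<in> test_functions \<Omega>" "\<psi> \<in> test_functions \<Omega>"
  shows "(\<lambda>x. \<phi> x + \<psi> x) \<in> test_functions \<Omega>"
proof -
  obtain K where "compact K" "K \<subseteq> \<Omega>" "\<And>x. x \<notin> K \<Longrightarrow> \<phi> x = 0"
    using test_functionE[OF assms(1)] by blast
  moreover obtain L where "compact L" "L \<subseteq> \<Omega>" "\<And>x. x \<notin> L \<Longrightarrow> \<psi> x = 0"
    using test_functionE[OF assms(2)] by blast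
  ultimately show ?thesis using test_function_Ck[OF assms(1)] test_function_Ck[OF assms(2)]
    by (intro test_functionI[of _ "K \<union> L"] Ck_add) auto
qed

lemma test_function_diff:
  "\<phi> \<in> test_functions \<Omega> \<Longrightarrow> \<psi> \<in> test_functions \<Omega> \<Longrightarrow> (\<lambda>x. \<phi> x - \<psi> x) \<in> test_functions \<Omega>"
  using test_function_add[of \<phi> \<Omega> "\<lambda>x. (-1) * \<psi> x"] test_function_cmult[of \<psi> \<Omega> "-1"] by simp

text \<open>The composite inherits the compact support because \<open>0 \<le> M\<close> makes \<open>flat 0 (0 - M)\<close> vanish.\<close>

lemma test_function_flat:
  assumes "\<phi> \<in> test_functions \<Omega>" "0 \<le> M"
  shows "(\<lambda>x. flat 0 (\<phi> x - M)) \<in> test_functions \<Omega>"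
proof -
  obtain K where "compact K" "K \<subseteq> \<Omega>" "\<And>x. x \<notin> K \<Longrightarrow> \<phi> x = 0"
    using test_functionE[OF assms(1)] by blast
  then show ?thesis using test_function_Ck[OF assms(1)] assms(2)
    by (intro test_functionI[of _ K] Ck_flat_comp) auto
qed

lemma has_derivative_zero_outside:
  fixes f :: "'a::euclidean_space \<Rightarrow> real"
  assumes "(f has_derivative f') (at x)" "closed K" "\<And>x. x \<notin> K \<Longrightarrow> f x = 0" "x \<notin> K"
  shows "f' b = 0"
proof -
  have "((\<lambda>x. 0) has_derivative f') (at x)"
    using has_derivative_transform_within_open[OF assms(1), of "- K" "\<lambda>x. 0"] assms(2-4)
    by (auto simp: open_closed)
  then have "f' = (\<lambda>h. 0)" using has_derivative_unique[OF has_derivative_const] by blast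
  then show ?thesis by simp
qed

lemma test_function_partial:
  assumes "\<phi> \<in> test_functions \<Omega>" "b \<in> Basis"
  shows "(\<lambda>x. frechet_derivative \<phi> (at x) b) \<in> test_functions \<Omega>"
proof -
  obtain K where K: "compact K" "K \<subseteq> \<Omega>" "\<And>x. x \<notin> K \<Longrightarrow> \<phi> x = 0"
    using test_functionE[OF assms(1)] by blast
  show ?thesis
  proof (rule test_functionI[OF _ K(1,2)])
    show "Ck k (\<lambda>x. frechet_derivative \<phi> (at x) b)" for k
      using Ck_Suc_partial[OF test_function_Ck[OF assms(1)] assms(2)] .
    show "frechet_derivative \<phi> (at x) b = 0" if "x \<notin> K" for x
      using has_derivative_zero_outside[OF test_function_has_derivative[OF assms(1)]
          compact_imp_closed[OF K(1)] K(3) that] by simp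
  qed
qed

lemma continuous_compact_support_bounded:
  fixes f :: "'a::euclidean_space \<Rightarrow> real"
  assumes "continuous_on UNIV f" "compact K" "\<And>x. x \<notin> K \<Longrightarrow> f x = 0"
  obtains C where "0 \<le> C" "\<And>x. \<bar>f x\<bar> \<le> C"
proof -
  have "bounded (f ` K)"
    using assms by (intro compact_imp_bounded compact_continuous_image continuous_on_subset[OF assms(1)]) auto
  then obtain C where "0 < C" "\<And>x. x \<in> K \<Longrightarrow> \<bar>f x\<bar> \<le> C" unfolding bounded_pos by auto
  then have "\<bar>f x\<bar> \<le> C" for x using assms(3)[of x] by (cases "x \<in> K") auto
  then show ?thesis using \<open>0 < C\<close> by (intro that[of C]) auto
qed

lemma grad_cmult:
  assumes "\<phi> \<in> test_functions \<Omega>" shows "grad (\<lambda>x. c * \<phi> x) x = c *\<^sub>R grad \<phi> x"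
  unfolding grad_def
  by (simp add: frechet_derivativeI[OF has_derivative_mult_right[OF test_function_has_derivative[OF assms]]]
      scaleR_sum_right)

lemma grad_add:
  assumes "\<phi> \<in> test_functions \<Omega>" "\<psi> \<in> test_functions \<Omega>"
  shows "grad (\<lambda>x. \<phi> x + \<psi> x) x = grad \<phi> x + grad \<psi> x"
  unfolding grad_def
  by (simp add: frechet_derivativeI[OF has_derivative_add[OF test_function_has_derivative[OF assms(1)]
      test_function_has_derivative[OF assms(2)]]] scaleR_add_left sum.distrib)

lemma grad_diff:
  assumes "\<phi> \<in> test_functions \<Omega>" "\<psi> \<in> test_functions \<Omega>"
  shows "grad (\<lambda>x. \<phi> x - \<psi> x) x = grad \<phi> x - grad \<psi> x"
  using grad_add[OF assms(1) test_function_cmult[OF assms(2), of "-1"], of x] grad_cmult[OF assms(2), of "-1" x]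
  by simp

lemma grad_flat:
  assumes "\<phi> \<in> test_functions \<Omega>"
  shows "grad (\<lambda>x. flat 0 (\<phi> x - M)) x = flat 2 (\<phi> x - M) *\<^sub>R grad \<phi> x"
  unfolding grad_def
  by (simp add: frechet_derivativeI[OF flat_comp_has_derivative[OF test_function_has_derivative[OF assms]]]
      scaleR_sum_right numeral_2_eq_2)

lemma borel_imp_lebesgue_on: "f \<in> borel_measurable borel \<Longrightarrow> f \<in> borel_measurable (lebesgue_on A)"
  by (intro measurable_restrict_space1 measurable_completion) simp

lemma test_function_borel: "\<phi> \<in> test_functions \<Omega> \<Longrightarrow> \<phi> \<in> borel_measurable borel"
  by (intro borel_measurable_continuous_onI test_function_continuous)

lemma finite_measure_lebesgue_on:
  "bounded_domain \<Omega> \<Longrightarrow> finite_measure (lebesgue_on \<Omega>)"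
  unfolding bounded_domain_def using lmeasurable_open[of \<Omega>] finite_measure_lebesgue_on by blast

lemma test_function_L2:
  assumes "bounded_domain \<Omega>" "\<phi> \<in> test_functions \<Omega>"
  shows "\<phi> \<in> L2 (lebesgue_on \<Omega>)"
proof -
  obtain K where K: "compact K" "K \<subseteq> \<Omega>" "\<And>x. x \<notin> K \<Longrightarrow> \<phi> x = 0"
    using test_functionE[OF assms(2)] by blast
  obtain C where "0 \<le> C" "\<And>x. \<bar>\<phi> x\<bar> \<le> C"
    using continuous_compact_support_bounded[OF test_function_continuous[OF assms(2)] K(1,3)] by blast
  then show ?thesis
    using assms by (intro L2_bounded[of _ _ C] finite_measure_lebesgue_on borel_imp_lebesgue_on test_function_borel) auto
qed

lemma grad_L2:
  assumes "bounded_domain \<Omega>" "\<phi> \<in> test_functions \<Omega>"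
  shows "grad \<phi> \<in> L2 (lebesgue_on \<Omega>)"
proof -
  have "(\<lambda>x. \<Sum>b\<in>B. frechet_derivative \<phi> (at x) b *\<^sub>R b) \<in> L2 (lebesgue_on \<Omega>)" if "finite B" "B \<subseteq> Basis" for B
    using that
  proof (induction rule: finite_induct)
    case (insert b B)
    have f: "(\<lambda>x. frechet_derivative \<phi> (at x) b) \<in> L2 (lebesgue_on \<Omega>)"
      using insert by (intro test_function_L2[OF assms(1) test_function_partial[OF assms(2)]]) auto
    have "(\<lambda>x. frechet_derivative \<phi> (at x) b *\<^sub>R b) \<in> L2 (lebesgue_on \<Omega>)"
      using insert L2_measurable[OF f] by (intro L2_dominated[OF f]) auto
    then show ?case using insert by (auto intro!: L2_add)
  qed auto
  from this[of Basis] show ?thesis by (simp add: grad_def[abs_def])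
qed

section \<open>Integration by parts and the Poincare inequality\<close>

lemma integrable_bounded_support:
  fixes f :: "'a::euclidean_space \<Rightarrow> real"
  assumes "f \<in> borel_measurable borel" "\<And>x. \<bar>f x\<bar> \<le> C" "\<And>x. x \<notin> cball 0 R \<Longrightarrow> f x = 0"
  shows "integrable lborel f"
proof (rule Bochner_Integration.integrable_bound)
  show "integrable lborel (\<lambda>x. C * indicator (cball 0 R) x :: real)"
    by (intro integrable_mult_right integrable_real_indicator emeasure_lborel_cball_finite) auto
  show "AE x in lborel. norm (f x) \<le> norm (C * indicator (cball 0 R) x :: real)"
  proof (rule AE_I2)
    fix x
    have "\<bar>f x\<bar> \<le> \<bar>C\<bar>" using assms(2)[of x] by linarith
    then show "norm (f x) \<le> norm (C * indicator (cball 0 R) x :: real)"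
      using assms(3)[of x] by (cases "x \<in> cball 0 R") (simp_all only: indicator_simps real_norm_def, simp_all)
  qed
qed (use assms in simp)

text \<open>Translation invariance of Lebesgue measure: all difference quotients of \<open>\<psi>\<close> in the direction \<open>b\<close>
  have integral zero, and they converge boundedly with a common bounded support.\<close>

lemma integral_directional_derivative:
  fixes \<psi> :: "'a::euclidean_space \<Rightarrow> real"
  assumes der: "\<And>x. (\<psi> has_derivative \<psi>' x) (at x)" and cont: "continuous_on UNIV (\<lambda>x. \<psi>' x b)"
    and K: "compact K" "\<And>x. x \<notin> K \<Longrightarrow> \<psi> x = 0"
  shows "(\<integral>x. \<psi>' x b \<partial>lborel) = 0"
proof -
  define D where "D = (\<lambda>x. \<psi>' x b)"
  have D0: "D x = 0" if "x \<notin> K" for x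
    unfolding D_def using has_derivative_zero_outside[OF der compact_imp_closed[OF K(1)] K(2) that] .
  obtain L where L: "0 \<le> L" "\<And>x. \<bar>D x\<bar> \<le> L"
    using continuous_compact_support_bounded[OF cont[folded D_def] K(1) D0] by blast
  have c\<psi>: "continuous_on UNIV \<psi>"
    using der has_derivative_continuous by (blast intro: continuous_at_imp_continuous_on)
  obtain C where C: "0 \<le> C" "\<And>x. \<bar>\<psi> x\<bar> \<le> C"
    using continuous_compact_support_bounded[OF c\<psi> K] by blast
  obtain R where R: "\<And>x. x \<in> K \<Longrightarrow> norm x \<le> R"
    using compact_imp_bounded[OF K(1)] by (auto simp: bounded_iff)
  have m\<psi> [measurable]: "\<psi> \<in> borel_measurable borel" using c\<psi> by (rule borel_measurable_continuous_onI)
  have mD [measurable]: "D \<in> borel_measurable borel"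
    unfolding D_def using cont by (rule borel_measurable_continuous_onI)
  have line: "((\<lambda>s. \<psi> (x + s *\<^sub>R b)) has_real_derivative D (x + s *\<^sub>R b)) (at s)" for x s
  proof -
    have 1: "((\<lambda>s. x + s *\<^sub>R b) has_derivative (\<lambda>h. h *\<^sub>R b)) (at s)"
      by (auto intro!: derivative_eq_intros)
    have "(\<lambda>h. \<psi>' (x + s *\<^sub>R b) (h *\<^sub>R b)) = (*) (D (x + s *\<^sub>R b))"
      using linear_scale[OF has_derivative_linear[OF der]] by (auto simp: D_def fun_eq_iff)
    then show ?thesis unfolding has_field_derivative_def
      using has_derivative_compose[OF 1 der] by simp
  qed
  define t where "t n = 1 / (real n + 1)" for n
  have t: "0 < t n" "t n \<le> 1" for n by (auto simp: t_def)
  have t_nz: "t n \<noteq> 0" for n using t(1)[of n] by simp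
  define q where "q n x = (\<psi> (x + t n *\<^sub>R b) - \<psi> x) / t n" for n x
  have q_le: "\<bar>q n x\<bar> \<le> L" for n x
  proof -
    obtain z where "\<psi> (x + t n *\<^sub>R b) - \<psi> (x + 0 *\<^sub>R b) = (t n - 0) * D (x + z *\<^sub>R b)"
      using MVT2[of 0 "t n" "\<lambda>s. \<psi> (x + s *\<^sub>R b)" "\<lambda>s. D (x + s *\<^sub>R b)"] t(1) line by blast
    then show ?thesis using t(1)[of n] L(2) by (simp add: q_def)
  qed
  have q0: "q n x = 0" if "x \<notin> cball 0 (R + norm b)" for n x
  proof -
    have n: "norm x > R + norm b" using that by simp
    then have "x \<notin> K" using R[of x] norm_ge_zero[of b] by auto
    moreover have "x + t n *\<^sub>R b \<notin> K"
    proof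
      assume "x + t n *\<^sub>R b \<in> K"
      then have "norm (x + t n *\<^sub>R b) \<le> R" by (rule R)
      moreover have "norm x \<le> norm (x + t n *\<^sub>R b) + norm (t n *\<^sub>R b)"
        using norm_triangle_ineq4[of "x + t n *\<^sub>R b" "t n *\<^sub>R b"] by simp
      moreover have "norm (t n *\<^sub>R b) \<le> norm b"
        using t[of n] by (simp add: mult_left_le_one_le less_imp_le)
      ultimately show False using n by linarith
    qed
    ultimately show ?thesis using K(2) by (simp add: q_def)
  qed
  have \<psi>int: "integrable lborel \<psi>"
    using C R K(2) by (intro integrable_bounded_support[of _ C R]) auto
  have trans: "integrable lborel (\<lambda>x. \<psi> (x + c))" "(\<integral>x. \<psi> (x + c) \<partial>lborel) = (\<integral>x. \<psi> x \<partial>lborel)" for c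
    using lborel_distr_plus[of c] integrable_distr_eq[of "(+) c" lborel borel \<psi>]
      integral_distr[of "(+) c" lborel borel \<psi>] \<psi>int by (auto simp: add.commute)
  have q_int: "(\<integral>x. q n x \<partial>lborel) = 0" for n
    unfolding q_def using trans \<psi>int by simp
  have "(\<lambda>n. \<integral>x. q n x \<partial>lborel) \<longlonglongrightarrow> (\<integral>x. D x \<partial>lborel)"
  proof (rule integral_dominated_convergence)
    show "integrable lborel (\<lambda>x::'a. L * indicator (cball 0 (R + norm b)) x :: real)"
      by (intro integrable_mult_right integrable_real_indicator emeasure_lborel_cball_finite) auto
    show "AE x in lborel. norm (q n x) \<le> L * indicator (cball 0 (R + norm b)) x" for n
      using q_le q0 by (intro AE_I2) (auto simp: indicator_def)
    show "AE x in lborel. (\<lambda>n. q n x) \<longlonglongrightarrow> D x"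
    proof (rule AE_I2)
      fix x
      have "((\<lambda>h. (\<psi> (x + h *\<^sub>R b) - \<psi> x) / h) \<longlongrightarrow> D x) (at 0)"
        using line[of x 0] by (simp add: DERIV_def)
      moreover have "t \<longlonglongrightarrow> 0" unfolding t_def
        using LIMSEQ_inverse_real_of_nat by (simp add: inverse_eq_divide add.commute)
      ultimately have "((\<lambda>n. (\<psi> (x + t n *\<^sub>R b) - \<psi> x) / t n) \<longlongrightarrow> D x) sequentially"
        using t_nz by (intro filterlim_compose[of "\<lambda>h. (\<psi> (x + h *\<^sub>R b) - \<psi> x) / h" _ "at 0" t])
          (auto simp: filterlim_at)
      then show "(\<lambda>n. q n x) \<longlonglongrightarrow> D x" by (simp add: q_def)
    qed
  qed (auto simp: q_def)
  then have "(\<lambda>n. 0::real) \<longlonglongrightarrow> (\<integral>x. D x \<partial>lborel)" by (simp add: q_int)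
  then show ?thesis unfolding D_def using LIMSEQ_unique tendsto_const by blast
qed

lemma integral_lebesgue_on_eq_lborel:
  fixes f :: "'a::euclidean_space \<Rightarrow> real"
  assumes "open \<Omega>" "f \<in> borel_measurable borel" "\<And>x. x \<notin> \<Omega> \<Longrightarrow> f x = 0"
  shows "(\<integral>x. f x \<partial>lebesgue_on \<Omega>) = (\<integral>x. f x \<partial>lborel)"
proof -
  have "(\<integral>x. f x \<partial>lebesgue_on \<Omega>) = (\<integral>x. indicator \<Omega> x *\<^sub>R f x \<partial>lebesgue)"
    using assms(1) by (subst integral_restrict_space) auto
  also have "(\<lambda>x. indicator \<Omega> x *\<^sub>R f x) = f" using assms(3) by (auto simp: indicator_def fun_eq_iff)
  also have "(\<integral>x. f x \<partial>lebesgue) = (\<integral>x. f x \<partial>lborel)"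
    using assms(2) by (intro integral_completion) simp
  finally show ?thesis .
qed

lemma test_function_integral_by_parts:
  assumes \<Omega>: "bounded_domain \<Omega>" and \<phi>: "\<phi> \<in> test_functions \<Omega>" and \<psi>: "\<psi> \<in> test_functions \<Omega>" and b: "b \<in> Basis"
  shows "(\<integral>x. \<phi> x * (grad \<psi> x \<bullet> b) \<partial>lebesgue_on \<Omega>) = - (\<integral>x. (grad \<phi> x \<bullet> b) * \<psi> x \<partial>lebesgue_on \<Omega>)"
proof -
  obtain K where K: "compact K" "K \<subseteq> \<Omega>" "\<And>x. x \<notin> K \<Longrightarrow> \<phi> x = 0"
    using test_functionE[OF \<phi>] by blast
  note L2 = test_function_L2[OF \<Omega>]
  let ?d\<phi> = "\<lambda>x. frechet_derivative \<phi> (at x) b" and ?d\<psi> = "\<lambda>x. frechet_derivative \<psi> (at x) b"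
  have d: "?d\<phi> \<in> test_functions \<Omega>" "?d\<psi> \<in> test_functions \<Omega>"
    using test_function_partial \<phi> \<psi> b by auto
  note cont = test_function_continuous[OF \<phi>] test_function_continuous[OF \<psi>]
    test_function_continuous[OF d(1)] test_function_continuous[OF d(2)]
  have "(\<integral>x. \<phi> x * ?d\<psi> x + ?d\<phi> x * \<psi> x \<partial>lborel) = 0"
    using K
    by (intro integral_directional_derivative[of "\<lambda>x. \<phi> x * \<psi> x" "\<lambda>x h. \<phi> x * frechet_derivative \<psi> (at x) h
          + frechet_derivative \<phi> (at x) h * \<psi> x" b K]
        has_derivative_mult test_function_has_derivative[OF \<phi>] test_function_has_derivative[OF \<psi>]
        continuous_intros cont) auto
  moreover have "(\<integral>x. \<phi> x * ?d\<psi> x + ?d\<phi> x * \<psi> x \<partial>lebesgue_on \<Omega>) = (\<integral>x. \<phi> x * ?d\<psi> x + ?d\<phi> x * \<psi> x \<partial>lborel)"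
  proof (rule integral_lebesgue_on_eq_lborel)
    show "open \<Omega>" using \<Omega> by (simp add: bounded_domain_def)
    show "(\<lambda>x. \<phi> x * ?d\<psi> x + ?d\<phi> x * \<psi> x) \<in> borel_measurable borel"
      by (intro borel_measurable_continuous_onI continuous_intros cont)
    show "\<phi> x * ?d\<psi> x + ?d\<phi> x * \<psi> x = 0" if "x \<notin> \<Omega>" for x
    proof -
      have "x \<notin> closure {x. \<psi> x \<noteq> 0}" using \<psi> that by (auto simp: test_functions_def)
      then have "\<psi> x = 0" using closure_subset[of "{x. \<psi> x \<noteq> 0}"] by auto
      moreover have "\<phi> x = 0" using K(3)[of x] K(2) that by auto
      ultimately show ?thesis by simp
    qed
  qed
  ultimately show ?thesis using b L2_mult_integrable[OF L2[OF \<phi>] L2[OF d(2)]] L2_mult_integrable[OF L2[OF d(1)] L2[OF \<psi>]]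
    by (simp add: grad_inner_Basis)
qed

text \<open>The derivative of \<open>\<phi>\<^sup>2 (x \<bullet> b)\<close> in a coordinate direction \<open>b\<close> is \<open>\<phi>\<^sup>2 + 2 (x \<bullet> b) \<phi> \<partial>\<^sub>b\<phi>\<close> and has
  integral zero. If \<open>\<bar>x \<bullet> b\<bar> \<le> R\<close> on the domain, this gives the constant \<open>2 R\<close>.\<close>

lemma poincare_test:
  assumes \<Omega>: "bounded_domain (\<Omega> :: 'a::euclidean_space set)"
  obtains C where "0 < C"
    "\<And>\<phi>. \<phi> \<in> test_functions \<Omega> \<Longrightarrow> L2norm (lebesgue_on \<Omega>) \<phi> \<le> C * L2norm (lebesgue_on \<Omega>) (grad \<phi>)"
proof -
  let ?M = "lebesgue_on \<Omega>"
  obtain R where R: "0 < R" "\<And>x. x \<in> \<Omega> \<Longrightarrow> norm x \<le> R"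
    using \<Omega> unfolding bounded_domain_def bounded_pos by auto
  obtain b :: 'a where b: "b \<in> Basis" using nonempty_Basis by blast
  have "L2norm ?M \<phi> \<le> 2 * R * L2norm ?M (grad \<phi>)" if \<phi>: "\<phi> \<in> test_functions \<Omega>" for \<phi>
  proof -
    obtain K where K: "compact K" "K \<subseteq> \<Omega>" "\<And>x. x \<notin> K \<Longrightarrow> \<phi> x = 0"
    using test_functionE[OF \<phi>] by blast
    let ?d = "\<lambda>x. frechet_derivative \<phi> (at x) b"
    let ?w = "\<lambda>x. (x \<bullet> b) * ?d x"
    have d: "?d \<in> test_functions \<Omega>" using test_function_partial \<phi> b by auto
    note cont = test_function_continuous[OF \<phi>] test_function_continuous[OF d]
    note L\<phi> = test_function_L2[OF \<Omega> \<phi>]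
    have w_le: "\<bar>?w x\<bar> \<le> R * norm (grad \<phi> x)" if "x \<in> \<Omega>" for x
    proof -
      have "\<bar>x \<bullet> b\<bar> \<le> R" using R(2)[OF that] Basis_le_norm[OF b, of x] by linarith
      moreover have "\<bar>?d x\<bar> \<le> norm (grad \<phi> x)"
        using Basis_le_norm[OF b, of "grad \<phi> x"] grad_inner_Basis[OF b, of \<phi> x] by simp
      ultimately show ?thesis using R(1) by (simp add: abs_mult mult_mono)
    qed
    have wm: "?w \<in> borel_measurable ?M"
      by (intro borel_imp_lebesgue_on borel_measurable_continuous_onI continuous_intros cont)
    have AEw: "AE x in ?M. norm (?w x) \<le> norm (R *\<^sub>R grad \<phi> x)"
      using w_le R(1) by (intro AE_I2) (auto simp: space_restrict_space)
    have Lg: "(\<lambda>x. R *\<^sub>R grad \<phi> x) \<in> L2 ?M" by (intro L2_scaleR grad_L2 \<Omega> \<phi>)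
    have Lw: "?w \<in> L2 ?M" by (rule L2_dominated[OF Lg wm AEw])
    have Nw: "L2norm ?M ?w \<le> R * L2norm ?M (grad \<phi>)"
      using L2norm_mono[OF Lg wm AEw] R(1) by (simp add: L2norm_scaleR)
    define \<psi>' where "\<psi>' x h = \<phi> x * \<phi> x * (h \<bullet> b) + (\<phi> x * frechet_derivative \<phi> (at x) h
       + frechet_derivative \<phi> (at x) h * \<phi> x) * (x \<bullet> b)" for x h
    have \<psi>'b: "\<psi>' x b = \<phi> x * \<phi> x + 2 * (\<phi> x * ?w x)" for x
      using b by (simp add: \<psi>'_def inner_Basis algebra_simps)
    have c: "continuous_on UNIV (\<lambda>x. \<psi>' x b)"
      unfolding \<psi>'b by (intro continuous_intros cont)
    have der: "((\<lambda>x. \<phi> x * \<phi> x * (x \<bullet> b)) has_derivative \<psi>' x) (at x)" for x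
      unfolding \<psi>'_def
      by (intro has_derivative_mult test_function_has_derivative[OF \<phi>] has_derivative_inner_left has_derivative_ident)
    have "(\<integral>x. \<psi>' x b \<partial>lborel) = 0"
      using K by (intro integral_directional_derivative[OF der c K(1)]) auto
    moreover have "(\<integral>x. \<psi>' x b \<partial>?M) = (\<integral>x. \<psi>' x b \<partial>lborel)"
    proof (rule integral_lebesgue_on_eq_lborel)
      show "open \<Omega>" using \<Omega> by (simp add: bounded_domain_def)
      show "(\<lambda>x. \<psi>' x b) \<in> borel_measurable borel" using c by (rule borel_measurable_continuous_onI)
      show "\<psi>' x b = 0" if "x \<notin> \<Omega>" for x
      proof -
        have "\<phi> x = 0" using K(2,3) that by blast
        then show ?thesis by (simp add: \<psi>'b)
      qed
    qed
    ultimately have "(\<integral>x. \<phi> x * \<phi> x \<partial>?M) = - 2 * (\<integral>x. \<phi> x * ?w x \<partial>?M)"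
      using L2_mult_integrable[OF L\<phi> L\<phi>] L2_mult_integrable[OF L\<phi> Lw] by (simp add: \<psi>'b)
    moreover have "(L2norm ?M \<phi>)\<^sup>2 = (\<integral>x. \<phi> x * \<phi> x \<partial>?M)"
      unfolding L2norm_sq by (simp add: power2_eq_square)
    ultimately have "(L2norm ?M \<phi>)\<^sup>2 \<le> 2 * (L2norm ?M \<phi> * L2norm ?M ?w)"
      using L2_Cauchy_Schwarz_real[OF L\<phi> Lw] by linarith
    also have "\<dots> \<le> 2 * (L2norm ?M \<phi> * (R * L2norm ?M (grad \<phi>)))"
      using Nw by (intro mult_left_mono) auto
    finally have "L2norm ?M \<phi> * L2norm ?M \<phi> \<le> L2norm ?M \<phi> * (2 * R * L2norm ?M (grad \<phi>))"
      by (simp add: power2_eq_square algebra_simps)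
    then show ?thesis
      using R(1) by (cases "L2norm ?M \<phi> = 0") (auto simp: mult_le_cancel_left less_le)
  qed
  then show ?thesis using R(1) by (intro that[of "2 * R"]) auto
qed

lemma test_function_has_weak_gradient:
  assumes "bounded_domain \<Omega>" "\<phi> \<in> test_functions \<Omega>"
  shows "has_weak_gradient \<Omega> \<phi> (grad \<phi>)"
  unfolding has_weak_gradient_def
  using test_function_L2[OF assms] grad_L2[OF assms] test_function_integral_by_parts[OF assms] by auto

section \<open>Weak solutions\<close>

text \<open>An element of \<open>H\<^sub>0\<^sup>1\<close> together with a weak gradient that is a limit of gradients of test functions.
  The predicate \<open>has_weak_gradient\<close> leaves open how \<open>G\<close> arises; here \<open>G\<close> comes from the same
  approximating sequence as \<open>y\<close>, so that identities for test functions pass to the limit.\<close>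

definition H10_limit :: "'a::euclidean_space set \<Rightarrow> ('a \<Rightarrow> real) \<Rightarrow> ('a \<Rightarrow> 'a) \<Rightarrow> bool" where
  "H10_limit \<Omega> y G \<longleftrightarrow> (\<exists>\<phi>. (\<forall>n. \<phi> n \<in> test_functions \<Omega>) \<and> L2conv (lebesgue_on \<Omega>) \<phi> y \<and>
     L2conv (lebesgue_on \<Omega>) (\<lambda>n. grad (\<phi> n)) G)"

lemma H10_limitE:
  assumes "H10_limit \<Omega> y G"
  obtains \<phi> where "\<And>n. \<phi> n \<in> test_functions \<Omega>" "L2conv (lebesgue_on \<Omega>) \<phi> y"
    "L2conv (lebesgue_on \<Omega>) (\<lambda>n. grad (\<phi> n)) G"
  using assms unfolding H10_limit_def by blast

lemma H10_limit_L2: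
  assumes "H10_limit \<Omega> y G" shows "y \<in> L2 (lebesgue_on \<Omega>)" "G \<in> L2 (lebesgue_on \<Omega>)"
  using assms L2convD(2) unfolding H10_limit_def by blast+

lemma H10_limit_test:
  assumes "bounded_domain \<Omega>" "\<phi> \<in> test_functions \<Omega>" shows "H10_limit \<Omega> \<phi> (grad \<phi>)"
  unfolding H10_limit_def
  using assms L2conv_const[OF test_function_L2[OF assms]] L2conv_const[OF grad_L2[OF assms]]
  by (intro exI[of _ "\<lambda>n. \<phi>"]) simp

lemma H10_limit_cmult:
  assumes "H10_limit \<Omega> y G" shows "H10_limit \<Omega> (\<lambda>x. c * y x) (\<lambda>x. c *\<^sub>R G x)"
proof -
  obtain \<phi> where \<phi>: "\<And>n. \<phi> n \<in> test_functions \<Omega>" "L2conv (lebesgue_on \<Omega>) \<phi> y"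
    "L2conv (lebesgue_on \<Omega>) (\<lambda>n. grad (\<phi> n)) G" using H10_limitE[OF assms] by blast
  have "grad (\<lambda>x. c * \<phi> n x) = (\<lambda>x. c *\<^sub>R grad (\<phi> n) x)" for n
    by (rule ext) (rule grad_cmult[OF \<phi>(1)])
  then show ?thesis unfolding H10_limit_def
    using L2conv_scaleR[OF \<phi>(2), of c] L2conv_scaleR[OF \<phi>(3), of c] test_function_cmult[OF \<phi>(1)]
    by (intro exI[of _ "\<lambda>n x. c * \<phi> n x"]) simp
qed

lemma H10_limit_diff:
  assumes "H10_limit \<Omega> y G" "H10_limit \<Omega> z H"
  shows "H10_limit \<Omega> (\<lambda>x. y x - z x) (\<lambda>x. G x - H x)"
proof -
  obtain \<phi> where \<phi>: "\<And>n. \<phi> n \<in> test_functions \<Omega>" "L2conv (lebesgue_on \<Omega>) \<phi> y"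
    "L2conv (lebesgue_on \<Omega>) (\<lambda>n. grad (\<phi> n)) G" using H10_limitE[OF assms(1)] by blast
  obtain \<psi> where \<psi>: "\<And>n. \<psi> n \<in> test_functions \<Omega>" "L2conv (lebesgue_on \<Omega>) \<psi> z"
    "L2conv (lebesgue_on \<Omega>) (\<lambda>n. grad (\<psi> n)) H" using H10_limitE[OF assms(2)] by blast
  have "grad (\<lambda>x. \<phi> n x - \<psi> n x) = (\<lambda>x. grad (\<phi> n) x - grad (\<psi> n) x)" for n
    by (rule ext) (rule grad_diff[OF \<phi>(1) \<psi>(1)])
  then show ?thesis unfolding H10_limit_def
    using L2conv_diff[OF \<phi>(2) \<psi>(2)] L2conv_diff[OF \<phi>(3) \<psi>(3)] test_function_diff[OF \<phi>(1) \<psi>(1)]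
    by (intro exI[of _ "\<lambda>n x. \<phi> n x - \<psi> n x"]) simp
qed

lemma L2_scaleR_Basis: "f \<in> L2 M \<Longrightarrow> b \<in> Basis \<Longrightarrow> (\<lambda>x. (f x :: real) *\<^sub>R b) \<in> L2 M"
  by (rule L2_dominated[of f M]) auto

lemma L2_inner_Basis: "f \<in> L2 M \<Longrightarrow> b \<in> Basis \<Longrightarrow> (\<lambda>x. f x \<bullet> b) \<in> L2 M"
  by (rule L2_dominated[of f M]) (auto intro: Basis_le_norm)

lemma H10_limit_weak_gradient:
  assumes \<Omega>: "bounded_domain \<Omega>" and y: "H10_limit \<Omega> y G"
  shows "has_weak_gradient \<Omega> y G"
  unfolding has_weak_gradient_def
proof (intro conjI ballI)
  show "y \<in> L2 (lebesgue_on \<Omega>)" "G \<in> L2 (lebesgue_on \<Omega>)" using H10_limit_L2[OF y] by auto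
  fix \<psi> b assume \<psi>: "\<psi> \<in> test_functions \<Omega>" and b: "(b::'a) \<in> Basis"
  obtain \<phi> where \<phi>: "\<And>n. \<phi> n \<in> test_functions \<Omega>" "L2conv (lebesgue_on \<Omega>) \<phi> y"
    "L2conv (lebesgue_on \<Omega>) (\<lambda>n. grad (\<phi> n)) G" using H10_limitE[OF y] by blast
  have 1: "(\<lambda>n. \<integral>x. \<phi> n x * (grad \<psi> x \<bullet> b) \<partial>lebesgue_on \<Omega>) \<longlonglongrightarrow> (\<integral>x. y x * (grad \<psi> x \<bullet> b) \<partial>lebesgue_on \<Omega>)"
    by (intro L2conv_mult[OF \<phi>(2) L2conv_const] L2_inner_Basis grad_L2 \<Omega> \<psi> b)
  have 2: "(\<lambda>n. - (\<integral>x. (grad (\<phi> n) x \<bullet> b) * \<psi> x \<partial>lebesgue_on \<Omega>)) \<longlonglongrightarrow> - (\<integral>x. (G x \<bullet> b) * \<psi> x \<partial>lebesgue_on \<Omega>)"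
    using tendsto_minus[OF L2conv_inner[OF \<phi>(3) L2conv_const[OF L2_scaleR_Basis[OF test_function_L2[OF \<Omega> \<psi>] b]]]]
    by (simp add: mult.commute)
  have "(\<integral>x. \<phi> n x * (grad \<psi> x \<bullet> b) \<partial>lebesgue_on \<Omega>) = - (\<integral>x. (grad (\<phi> n) x \<bullet> b) * \<psi> x \<partial>lebesgue_on \<Omega>)" for n
    by (rule test_function_integral_by_parts[OF \<Omega> \<phi>(1) \<psi> b])
  then show "(\<integral>x. y x * (grad \<psi> x \<bullet> b) \<partial>lebesgue_on \<Omega>) = - (\<integral>x. (G x \<bullet> b) * \<psi> x \<partial>lebesgue_on \<Omega>)"
    using LIMSEQ_unique[OF 1] 2 by simp
qed

lemma H10_iff_H10_limit:
  assumes "bounded_domain \<Omega>" shows "y \<in> H10 \<Omega> \<longleftrightarrow> (\<exists>G. H10_limit \<Omega> y G)"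
proof
  assume "y \<in> H10 \<Omega>"
  then obtain G \<phi> where *: "has_weak_gradient \<Omega> y G" "\<And>n. \<phi> n \<in> test_functions \<Omega>"
      "(\<lambda>n::nat. L2norm (lebesgue_on \<Omega>) (\<lambda>x. y x - \<phi> n x)) \<longlonglongrightarrow> 0"
      "(\<lambda>n. L2norm (lebesgue_on \<Omega>) (\<lambda>x. G x - grad (\<phi> n) x)) \<longlonglongrightarrow> 0"
    unfolding H10_def by blast
  have "L2conv (lebesgue_on \<Omega>) \<phi> y" "L2conv (lebesgue_on \<Omega>) (\<lambda>n. grad (\<phi> n)) G"
    unfolding L2conv_def using *(1,3,4) test_function_L2[OF assms *(2)] grad_L2[OF assms *(2)]
    by (simp_all add: has_weak_gradient_def L2norm_minus_commute[of _ y] L2norm_minus_commute[of _ G])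
  then show "\<exists>G. H10_limit \<Omega> y G" using *(2) unfolding H10_limit_def by blast
next
  assume "\<exists>G. H10_limit \<Omega> y G"
  then obtain G where G: "H10_limit \<Omega> y G" by blast
  obtain \<phi> where \<phi>: "\<And>n. \<phi> n \<in> test_functions \<Omega>" "L2conv (lebesgue_on \<Omega>) \<phi> y"
    "L2conv (lebesgue_on \<Omega>) (\<lambda>n. grad (\<phi> n)) G" using H10_limitE[OF G] by blast
  have "(\<lambda>n. L2norm (lebesgue_on \<Omega>) (\<lambda>x. y x - \<phi> n x)) \<longlonglongrightarrow> 0"
    "(\<lambda>n. L2norm (lebesgue_on \<Omega>) (\<lambda>x. G x - grad (\<phi> n) x)) \<longlonglongrightarrow> 0"
    using L2convD(3)[OF \<phi>(2)] L2convD(3)[OF \<phi>(3)]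
    unfolding L2norm_minus_commute[of _ y] L2norm_minus_commute[of _ G] by auto
  with H10_limit_weak_gradient[OF assms G] \<phi>(1) show "y \<in> H10 \<Omega>"
    unfolding H10_def by auto
qed

text \<open>Partial derivatives of test functions are test functions. Inserting them into the definition of a
  weak gradient writes the pairing with \<open>grad \<phi>\<close> in terms of \<open>v\<close> alone, namely as the integral of
  \<open>- v \<Delta>\<phi>\<close>.\<close>

lemma integral_grad_weak_gradient:
  assumes \<Omega>: "bounded_domain \<Omega>" and v: "has_weak_gradient \<Omega> v V" and \<phi>: "\<phi> \<in> test_functions \<Omega>"
  shows "(\<integral>x. grad \<phi> x \<bullet> V x \<partial>lebesgue_on \<Omega>) =
    - (\<Sum>b\<in>Basis. \<integral>x. v x * (grad (\<lambda>x. frechet_derivative \<phi> (at x) b) x \<bullet> b) \<partial>lebesgue_on \<Omega>)"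
proof -
  have V: "V \<in> L2 (lebesgue_on \<Omega>)" using v by (simp add: has_weak_gradient_def)
  have d: "(\<lambda>x. frechet_derivative \<phi> (at x) b) \<in> test_functions \<Omega>" if "b \<in> Basis" for b
    using test_function_partial[OF \<phi> that] .
  have "(\<integral>x. grad \<phi> x \<bullet> V x \<partial>lebesgue_on \<Omega>) = (\<integral>x. (\<Sum>b\<in>Basis. (V x \<bullet> b) * frechet_derivative \<phi> (at x) b) \<partial>lebesgue_on \<Omega>)"
    by (subst euclidean_inner) (simp add: grad_inner_Basis mult.commute)
  also have "\<dots> = (\<Sum>b\<in>Basis. \<integral>x. (V x \<bullet> b) * frechet_derivative \<phi> (at x) b \<partial>lebesgue_on \<Omega>)"
    by (intro Bochner_Integration.integral_sum L2_mult_integrable L2_inner_Basis V test_function_L2[OF \<Omega> d])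
  also have "\<dots> = (\<Sum>b\<in>Basis. - (\<integral>x. v x * (grad (\<lambda>x. frechet_derivative \<phi> (at x) b) x \<bullet> b) \<partial>lebesgue_on \<Omega>))"
    using v d by (intro sum.cong refl) (simp add: has_weak_gradient_def)
  finally show ?thesis by (simp add: sum_negf)
qed

text \<open>This is the uniqueness of weak gradients that the weak formulation needs: two weak gradients of the
  same function have the same pairing with gradients of test functions and hence with their limits.\<close>

lemma integral_weak_gradient_unique:
  assumes \<Omega>: "bounded_domain \<Omega>" and v: "has_weak_gradient \<Omega> v V" "has_weak_gradient \<Omega> v W"
    and y: "H10_limit \<Omega> y G"
  shows "(\<integral>x. G x \<bullet> V x \<partial>lebesgue_on \<Omega>) = (\<integral>x. G x \<bullet> W x \<partial>lebesgue_on \<Omega>)"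
proof -
  obtain \<phi> where \<phi>: "\<And>n. \<phi> n \<in> test_functions \<Omega>" "L2conv (lebesgue_on \<Omega>) (\<lambda>n. grad (\<phi> n)) G"
    using H10_limitE[OF y] by blast
  have "(\<integral>x. grad (\<phi> n) x \<bullet> V x \<partial>lebesgue_on \<Omega>) = (\<integral>x. grad (\<phi> n) x \<bullet> W x \<partial>lebesgue_on \<Omega>)" for n
    using integral_grad_weak_gradient[OF \<Omega> v(1) \<phi>(1)] integral_grad_weak_gradient[OF \<Omega> v(2) \<phi>(1)] by simp
  moreover have "V \<in> L2 (lebesgue_on \<Omega>)" "W \<in> L2 (lebesgue_on \<Omega>)"
    using v by (auto simp: has_weak_gradient_def)
  ultimately show ?thesis
    using LIMSEQ_unique[OF L2conv_inner[OF \<phi>(2) L2conv_const] , of V] L2conv_inner[OF \<phi>(2) L2conv_const[of W]] by simp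
qed

text \<open>The weak formulation tested with test functions only. In this form it can be handled with classical
  gradients; its equivalence to \<open>weak_solution\<close> is shown next.\<close>

definition test_solution ::
    "'a::euclidean_space set \<Rightarrow> ('a \<Rightarrow> real) \<Rightarrow> (real \<Rightarrow> real) \<Rightarrow> ('a \<Rightarrow> real) \<Rightarrow> ('a \<Rightarrow> 'a) \<Rightarrow> bool" where
  "test_solution \<Omega> f g y G \<longleftrightarrow> H10_limit \<Omega> y G \<and> (\<forall>\<phi>\<in>test_functions \<Omega>.
     (\<integral>x. G x \<bullet> grad \<phi> x \<partial>lebesgue_on \<Omega>) + (\<integral>x. g (y x) * \<phi> x \<partial>lebesgue_on \<Omega>)
       = (\<integral>x. f x * \<phi> x \<partial>lebesgue_on \<Omega>))"

lemma weak_solution_imp_test_solution: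
  assumes \<Omega>: "bounded_domain \<Omega>" and y: "weak_solution \<Omega> f g y"
  shows "\<exists>G. test_solution \<Omega> f g y G"
proof -
  obtain G where G: "has_weak_gradient \<Omega> y G"
    "\<forall>v V. v \<in> H10 \<Omega> \<longrightarrow> has_weak_gradient \<Omega> v V \<longrightarrow>
          (\<integral>x. G x \<bullet> V x \<partial>lebesgue_on \<Omega>) + (\<integral>x. g (y x) * v x \<partial>lebesgue_on \<Omega>)
            = (\<integral>x. f x * v x \<partial>lebesgue_on \<Omega>)"
    using y unfolding weak_solution_def by blast
  obtain H where H: "H10_limit \<Omega> y H"
    using y H10_iff_H10_limit[OF \<Omega>] unfolding weak_solution_def by blast
  have "(\<integral>x. H x \<bullet> grad \<phi> x \<partial>lebesgue_on \<Omega>) + (\<integral>x. g (y x) * \<phi> x \<partial>lebesgue_on \<Omega>)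
       = (\<integral>x. f x * \<phi> x \<partial>lebesgue_on \<Omega>)" if \<phi>: "\<phi> \<in> test_functions \<Omega>" for \<phi>
  proof -
    have "(\<integral>x. H x \<bullet> grad \<phi> x \<partial>lebesgue_on \<Omega>) = (\<integral>x. G x \<bullet> grad \<phi> x \<partial>lebesgue_on \<Omega>)"
      using integral_weak_gradient_unique[OF \<Omega> H10_limit_weak_gradient[OF \<Omega> H] G(1) H10_limit_test[OF \<Omega> \<phi>]]
      by (simp add: inner_commute)
    moreover have "\<phi> \<in> H10 \<Omega>" using H10_limit_test[OF \<Omega> \<phi>] H10_iff_H10_limit[OF \<Omega>] by blast
    ultimately show ?thesis using G(2) test_function_has_weak_gradient[OF \<Omega> \<phi>] by metis
  qed
  then show ?thesis using H unfolding test_solution_def by blast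
qed

text \<open>Both sides are continuous in the quadratic mean with respect to \<open>(v, V)\<close>.\<close>

lemma test_solution_H10_limit:
  assumes f: "f \<in> L2 (lebesgue_on \<Omega>)" and y: "test_solution \<Omega> f g y G"
    and g: "(\<lambda>x. g (y x)) \<in> L2 (lebesgue_on \<Omega>)" and v: "H10_limit \<Omega> v V"
  shows "(\<integral>x. G x \<bullet> V x \<partial>lebesgue_on \<Omega>) + (\<integral>x. g (y x) * v x \<partial>lebesgue_on \<Omega>)
     = (\<integral>x. f x * v x \<partial>lebesgue_on \<Omega>)"
proof -
  obtain \<phi> where \<phi>: "\<And>n. \<phi> n \<in> test_functions \<Omega>" "L2conv (lebesgue_on \<Omega>) \<phi> v"
    "L2conv (lebesgue_on \<Omega>) (\<lambda>n. grad (\<phi> n)) V" using H10_limitE[OF v] by blast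
  have G: "G \<in> L2 (lebesgue_on \<Omega>)" using y H10_limit_L2 unfolding test_solution_def by blast
  have "(\<lambda>n. (\<integral>x. G x \<bullet> grad (\<phi> n) x \<partial>lebesgue_on \<Omega>) + (\<integral>x. g (y x) * \<phi> n x \<partial>lebesgue_on \<Omega>))
     \<longlonglongrightarrow> (\<integral>x. G x \<bullet> V x \<partial>lebesgue_on \<Omega>) + (\<integral>x. g (y x) * v x \<partial>lebesgue_on \<Omega>)"
    by (intro tendsto_add L2conv_inner[OF L2conv_const[OF G] \<phi>(3)] L2conv_mult[OF L2conv_const[OF g] \<phi>(2)])
  moreover have "(\<lambda>n. \<integral>x. f x * \<phi> n x \<partial>lebesgue_on \<Omega>) \<longlonglongrightarrow> (\<integral>x. f x * v x \<partial>lebesgue_on \<Omega>)"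
    by (intro L2conv_mult[OF L2conv_const[OF f] \<phi>(2)])
  ultimately show ?thesis using y \<phi>(1) LIMSEQ_unique unfolding test_solution_def by fastforce
qed

lemma test_solution_imp_weak_solution:
  assumes \<Omega>: "bounded_domain \<Omega>" and f: "f \<in> L2 (lebesgue_on \<Omega>)" and y: "test_solution \<Omega> f g y G"
    and g: "(\<lambda>x. g (y x)) \<in> L2 (lebesgue_on \<Omega>)"
  shows "weak_solution \<Omega> f g y"
  unfolding weak_solution_def
proof (intro conjI exI allI impI)
  have G: "H10_limit \<Omega> y G" using y by (simp add: test_solution_def)
  show "y \<in> H10 \<Omega>" using G H10_iff_H10_limit[OF \<Omega>] by blast
  show "has_weak_gradient \<Omega> y G" by (rule H10_limit_weak_gradient[OF \<Omega> G])
  fix v V assume v: "v \<in> H10 \<Omega>" and V: "has_weak_gradient \<Omega> v V"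
  obtain W where W: "H10_limit \<Omega> v W" using v H10_iff_H10_limit[OF \<Omega>] by blast
  show "(\<integral>x. G x \<bullet> V x \<partial>lebesgue_on \<Omega>) + (\<integral>x. g (y x) * v x \<partial>lebesgue_on \<Omega>) = (\<integral>x. f x * v x \<partial>lebesgue_on \<Omega>)"
    using test_solution_H10_limit[OF f y g W]
      integral_weak_gradient_unique[OF \<Omega> V H10_limit_weak_gradient[OF \<Omega> W] G] by simp
qed

lemma poincare:
  assumes \<Omega>: "bounded_domain (\<Omega> :: 'a::euclidean_space set)"
  obtains C where "0 < C"
    "\<And>y G. H10_limit \<Omega> y G \<Longrightarrow> L2norm (lebesgue_on \<Omega>) y \<le> C * L2norm (lebesgue_on \<Omega>) G"
proof -
  obtain C where C: "0 < C"
    "\<And>\<phi>. \<phi> \<in> test_functions \<Omega> \<Longrightarrow> L2norm (lebesgue_on \<Omega>) \<phi> \<le> C * L2norm (lebesgue_on \<Omega>) (grad \<phi>)"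
    using poincare_test[OF \<Omega>] by blast
  have "L2norm (lebesgue_on \<Omega>) y \<le> C * L2norm (lebesgue_on \<Omega>) G" if "H10_limit \<Omega> y G" for y G
  proof -
    obtain \<phi> where \<phi>: "\<And>n. \<phi> n \<in> test_functions \<Omega>" "L2conv (lebesgue_on \<Omega>) \<phi> y"
      "L2conv (lebesgue_on \<Omega>) (\<lambda>n. grad (\<phi> n)) G" using H10_limitE[OF \<open>H10_limit \<Omega> y G\<close>] by blast
    show ?thesis
      by (rule LIMSEQ_le[OF L2conv_norm[OF \<phi>(2)] tendsto_mult_left[OF L2conv_norm[OF \<phi>(3)]]])
         (use C(2)[OF \<phi>(1)] in auto)
  qed
  then show ?thesis using C(1) that by blast
qed

section \<open>Weak maximum principle\<close>

lemma L2conv_flat: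
  assumes \<Omega>: "bounded_domain \<Omega>" and \<phi>: "L2conv (lebesgue_on \<Omega>) \<phi> z"
  shows "L2conv (lebesgue_on \<Omega>) (\<lambda>n x. flat 0 (\<phi> n x - M)) (\<lambda>x. flat 0 (z x - M))"
proof -
  have cont: "continuous_on UNIV (flat 0)"
    using flat_deriv DERIV_isCont by (blast intro: continuous_at_imp_continuous_on)
  have m: "flat 0 \<in> borel_measurable borel" by (rule borel_measurable_continuous_onI[OF cont])
  have L: "(\<lambda>x. flat 0 (w x - M)) \<in> L2 (lebesgue_on \<Omega>)" if "w \<in> L2 (lebesgue_on \<Omega>)" for w
    using L2_measurable[OF that] measurable_compose[OF _ m, of "\<lambda>x. w x - M"] flat_le[of 0]
    by (intro L2_bounded[of _ _ 1] finite_measure_lebesgue_on \<Omega>) auto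
  show ?thesis
  proof (rule L2conv_dominated)
    note a = L2convD[OF \<phi>]
    show "(\<lambda>n. 2 * L2norm (lebesgue_on \<Omega>) (\<lambda>x. \<phi> n x - z x)) \<longlonglongrightarrow> 0"
      using tendsto_mult_right_zero[OF a(3)] .
    show "L2norm (lebesgue_on \<Omega>) (\<lambda>x. flat 0 (\<phi> n x - M) - flat 0 (z x - M))
      \<le> 2 * L2norm (lebesgue_on \<Omega>) (\<lambda>x. \<phi> n x - z x)" for n
    proof -
      have "L2norm (lebesgue_on \<Omega>) (\<lambda>x. flat 0 (\<phi> n x - M) - flat 0 (z x - M))
        \<le> L2norm (lebesgue_on \<Omega>) (\<lambda>x. 2 *\<^sub>R (\<phi> n x - z x))"
      proof (rule L2norm_mono)
        show "(\<lambda>x. 2 *\<^sub>R (\<phi> n x - z x)) \<in> L2 (lebesgue_on \<Omega>)"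
          using a by (intro L2_scaleR L2_diff)
        show "(\<lambda>x. flat 0 (\<phi> n x - M) - flat 0 (z x - M)) \<in> borel_measurable (lebesgue_on \<Omega>)"
          using a by (intro L2_measurable L2_diff L)
        show "AE x in lebesgue_on \<Omega>. norm (flat 0 (\<phi> n x - M) - flat 0 (z x - M)) \<le> norm (2 *\<^sub>R (\<phi> n x - z x))"
        proof (rule AE_I2)
          show "norm (flat 0 (\<phi> n x - M) - flat 0 (z x - M)) \<le> norm (2 *\<^sub>R (\<phi> n x - z x))" for x
            by (subst norm_scaleR) (use flat_lipschitz[of "\<phi> n x - M" "z x - M"] in simp)
        qed
      qed
      then show ?thesis unfolding L2norm_scaleR by simp
    qed
  qed (use L2convD[OF \<phi>] L in auto)
qed

text \<open>Let \<open>\<phi>\<^sub>n\<close> approximate \<open>z\<close>, and test with \<open>\<psi>\<^sub>n = flat 0 (\<phi>\<^sub>n - M)\<close>. Since the derivative of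
  \<open>flat 0\<close> lies between \<open>0\<close> and \<open>2\<close>, the square of the norm of \<open>grad \<psi>\<^sub>n\<close> is at most twice the
  integral of \<open>grad \<phi>\<^sub>n \<bullet> grad \<psi>\<^sub>n\<close>. By the equation this integral is, up to an error that tends to
  zero, minus the integral of \<open>a \<psi>\<^sub>n\<close>, and the limit of the latter is nonnegative because \<open>a\<close> is
  nonnegative where \<open>flat 0 (z - M)\<close> is not zero. The Poincare inequality then shows that
  \<open>flat 0 (z - M)\<close> vanishes, that is, \<open>z \<le> M\<close>.\<close>

lemma weak_maximum_principle:
  fixes \<Omega> :: "'a::euclidean_space set"
  assumes \<Omega>: "bounded_domain \<Omega>" and z: "H10_limit \<Omega> z Z" and a: "a \<in> L2 (lebesgue_on \<Omega>)"
    and eq: "\<And>\<phi>. \<phi> \<in> test_functions \<Omega> \<Longrightarrow>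
      (\<integral>x. Z x \<bullet> grad \<phi> x \<partial>lebesgue_on \<Omega>) + (\<integral>x. a x * \<phi> x \<partial>lebesgue_on \<Omega>) = 0"
    and sgn: "AE x in lebesgue_on \<Omega>. M < z x \<longrightarrow> 0 \<le> a x" and M: "0 \<le> M"
  shows "AE x in lebesgue_on \<Omega>. z x \<le> M"
proof -
  let ?M = "lebesgue_on \<Omega>"
  obtain \<phi> where \<phi>: "\<And>n. \<phi> n \<in> test_functions \<Omega>" "L2conv ?M \<phi> z" "L2conv ?M (\<lambda>n. grad (\<phi> n)) Z"
    using H10_limitE[OF z] by blast
  obtain C where C: "0 < C"
    "\<And>\<phi>. \<phi> \<in> test_functions \<Omega> \<Longrightarrow> L2norm ?M \<phi> \<le> C * L2norm ?M (grad \<phi>)"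
    using poincare_test[OF \<Omega>] by blast
  define \<psi> where "\<psi> n x = flat 0 (\<phi> n x - M)" for n x
  define w where "w x = flat 0 (z x - M)" for x
  have \<psi>: "\<psi> n \<in> test_functions \<Omega>" for n
    unfolding \<psi>_def using test_function_flat[OF \<phi>(1) M] by simp
  have g\<psi>: "grad (\<psi> n) x = flat 2 (\<phi> n x - M) *\<^sub>R grad (\<phi> n) x" for n x
    unfolding \<psi>_def using grad_flat[OF \<phi>(1)] by simp
  have conv: "L2conv ?M \<psi> w"
    unfolding \<psi>_def[abs_def] w_def[abs_def] by (rule L2conv_flat[OF \<Omega> \<phi>(2)])
  have f2: "flat 2 s \<le> 2" for s using flat_le[of 2 s] by (simp add: fact_2)
  let ?e = "\<lambda>n. L2norm ?M (\<lambda>x. grad (\<phi> n) x - Z x) * (2 * L2norm ?M (grad (\<phi> n))) - (\<integral>x. a x * \<psi> n x \<partial>?M)"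
  have bound: "(L2norm ?M (\<psi> n))\<^sup>2 \<le> C\<^sup>2 * (2 * ?e n)" for n
  proof -
    note L = grad_L2[OF \<Omega> \<phi>(1), of n] grad_L2[OF \<Omega> \<psi>, of n]
    have Z: "Z \<in> L2 ?M" using \<phi>(3) L2convD(2) by blast
    have n2: "L2norm ?M (grad (\<psi> n)) \<le> 2 * L2norm ?M (grad (\<phi> n))"
    proof -
      have "L2norm ?M (grad (\<psi> n)) \<le> L2norm ?M (\<lambda>x. 2 *\<^sub>R grad (\<phi> n) x)"
        using f2 by (intro L2norm_mono L2_scaleR L L2_measurable) (auto simp: g\<psi> intro!: mult_right_mono)
      then show ?thesis unfolding L2norm_scaleR by simp
    qed
    have "(L2norm ?M (grad (\<psi> n)))\<^sup>2 \<le> (\<integral>x. 2 * (grad (\<phi> n) x \<bullet> grad (\<psi> n) x) \<partial>?M)"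
      unfolding L2norm_sq
    proof (rule integral_mono)
      show "integrable ?M (\<lambda>x. (norm (grad (\<psi> n) x))\<^sup>2)" by (rule L2_sq_integrable[OF L(2)])
      show "integrable ?M (\<lambda>x. 2 * (grad (\<phi> n) x \<bullet> grad (\<psi> n) x))"
        using L2_inner_integrable[OF L] by simp
      fix x
      let ?s = "flat 2 (\<phi> n x - M)"
      have "?s * (?s * (norm (grad (\<phi> n) x))\<^sup>2) \<le> 2 * (?s * (norm (grad (\<phi> n) x))\<^sup>2)"
        using f2 by (intro mult_right_mono) auto
      then show "(norm (grad (\<psi> n) x))\<^sup>2 \<le> 2 * (grad (\<phi> n) x \<bullet> grad (\<psi> n) x)"
        by (simp add: g\<psi> power_mult_distrib power2_eq_square dot_square_norm[unfolded power2_eq_square] mult_ac)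
    qed
    also have "\<dots> = 2 * ((\<integral>x. (grad (\<phi> n) x - Z x) \<bullet> grad (\<psi> n) x \<partial>?M) + (\<integral>x. Z x \<bullet> grad (\<psi> n) x \<partial>?M))"
      using L2_inner_integrable[OF L] L2_inner_integrable[OF Z L(2)] by (simp add: inner_diff_left)
    also have "\<dots> \<le> 2 * ?e n"
    proof -
      have "(\<integral>x. (grad (\<phi> n) x - Z x) \<bullet> grad (\<psi> n) x \<partial>?M)
          \<le> L2norm ?M (\<lambda>x. grad (\<phi> n) x - Z x) * L2norm ?M (grad (\<psi> n))"
        using L2_Cauchy_Schwarz[OF L2_diff[OF L(1) Z] L(2)] by linarith
      also have "\<dots> \<le> L2norm ?M (\<lambda>x. grad (\<phi> n) x - Z x) * (2 * L2norm ?M (grad (\<phi> n)))"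
        using n2 by (intro mult_left_mono) auto
      finally show ?thesis using eq[OF \<psi>, of n] by simp
    qed
    finally have "(L2norm ?M (grad (\<psi> n)))\<^sup>2 \<le> 2 * ?e n" .
    then have "C\<^sup>2 * (L2norm ?M (grad (\<psi> n)))\<^sup>2 \<le> C\<^sup>2 * (2 * ?e n)"
      by (rule mult_left_mono) simp
    moreover have "(L2norm ?M (\<psi> n))\<^sup>2 \<le> (C * L2norm ?M (grad (\<psi> n)))\<^sup>2"
      using C(2)[OF \<psi>, of n] by (intro power_mono) auto
    ultimately show ?thesis by (simp add: power_mult_distrib)
  qed
  have "(\<lambda>n. C\<^sup>2 * (2 * ?e n)) \<longlonglongrightarrow> C\<^sup>2 * (2 * (0 * (2 * L2norm ?M Z) - (\<integral>x. a x * w x \<partial>?M)))"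
    by (intro tendsto_mult tendsto_diff tendsto_const L2convD(3)[OF \<phi>(3)] L2conv_norm[OF \<phi>(3)]
        L2conv_mult[OF L2conv_const[OF a] conv])
  moreover have "(\<lambda>n. (L2norm ?M (\<psi> n))\<^sup>2) \<longlonglongrightarrow> (L2norm ?M w)\<^sup>2"
    by (intro tendsto_power L2conv_norm[OF conv])
  ultimately have "(L2norm ?M w)\<^sup>2 \<le> C\<^sup>2 * (2 * (0 * (2 * L2norm ?M Z) - (\<integral>x. a x * w x \<partial>?M)))"
    using bound by (intro LIMSEQ_le) auto
  moreover have "0 \<le> (\<integral>x. a x * w x \<partial>?M)"
  proof (rule integral_nonneg_AE)
    show "AE x in ?M. 0 \<le> a x * w x" using sgn
    proof eventually_elim
      case (elim x)
      then show ?case by (cases "M < z x") (auto simp: w_def)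
    qed
  qed
  ultimately have "(L2norm ?M w)\<^sup>2 \<le> 0"
    by (smt (verit) mult_nonneg_nonneg mult_minus_right zero_le_power2)
  then have "AE x in ?M. w x = 0" using L2norm_eq_0_AE[OF L2convD(2)[OF conv]] by simp
  then show ?thesis
  proof eventually_elim
    case (elim x)
    then show ?case using flat_pos[of "z x - M" 0] by (force simp: w_def not_le[symmetric])
  qed
qed

section \<open>Existence of states\<close>

text \<open>The properties of the nonlinearities \<open>g_of u\<close> for nonnegative square integrable \<open>u\<close>, with
  \<open>K = \<parallel>u\<parallel>\<close>; see \<open>g_of_monotone_half_hoelder\<close>.\<close>

definition monotone_half_hoelder :: "real \<Rightarrow> (real \<Rightarrow> real) \<Rightarrow> bool" where
  "monotone_half_hoelder K g \<longleftrightarrow> mono g \<and> g 0 = 0 \<and> 0 \<le> K \<and> (\<forall>a b. \<bar>g a - g b\<bar> \<le> K * sqrt \<bar>a - b\<bar>)"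

lemma monotone_half_hoelderD:
  assumes "monotone_half_hoelder K g"
  shows "mono g" "g 0 = 0" "0 \<le> K" "\<bar>g a - g b\<bar> \<le> K * sqrt \<bar>a - b\<bar>"
  using assms by (auto simp: monotone_half_hoelder_def)

lemma monotone_half_hoelder_borel:
  "monotone_half_hoelder K g \<Longrightarrow> g \<in> borel_measurable borel"
  by (intro borel_measurable_mono) (simp add: monotone_half_hoelderD(1))

lemma monotone_half_hoelder_continuous:
  assumes "monotone_half_hoelder K g" shows "continuous_on A g"
proof -
  have "isCont g a" for a
  proof -
    have "((\<lambda>b. g b - g a) \<longlongrightarrow> 0) (at a)"
    proof (rule Lim_null_comparison)
      show "\<forall>\<^sub>F b in at a. norm (g b - g a) \<le> K * sqrt \<bar>b - a\<bar>"
        using monotone_half_hoelderD(4)[OF assms] by (intro always_eventually) simp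
      have "((\<lambda>b. K * sqrt \<bar>b - a\<bar>) \<longlongrightarrow> K * sqrt \<bar>a - a\<bar>) (at a)"
        by (intro tendsto_intros)
      then show "((\<lambda>b. K * sqrt \<bar>b - a\<bar>) \<longlongrightarrow> 0) (at a)" by simp
    qed
    then show ?thesis by (simp add: isCont_def LIM_zero_iff)
  qed
  then show ?thesis by (intro continuous_at_imp_continuous_on) auto
qed

lemma sqrt_le_one_plus: "0 \<le> t \<Longrightarrow> sqrt t \<le> 1 + t"
  by (rule real_le_lsqrt) (auto simp: power2_eq_square algebra_simps)

lemma monotone_half_hoelder_growth:
  assumes "monotone_half_hoelder K g" shows "\<bar>g t\<bar> \<le> K * (1 + \<bar>t\<bar>)"
proof -
  have "\<bar>g t\<bar> \<le> K * sqrt \<bar>t\<bar>" using monotone_half_hoelderD(2)[OF assms] monotone_half_hoelderD(4)[OF assms, of t 0] by simp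
  also have "\<dots> \<le> K * (1 + \<bar>t\<bar>)"
    using monotone_half_hoelderD(3)[OF assms] by (intro mult_left_mono sqrt_le_one_plus) auto
  finally show ?thesis .
qed

lemma monotone_half_hoelder_L2:
  assumes M: "finite_measure M" and g: "monotone_half_hoelder K g" and y: "y \<in> L2 M"
  shows "(\<lambda>x. g (y x)) \<in> L2 M"
    and "L2norm M (\<lambda>x. g (y x)) \<le> K * (L2norm M (\<lambda>x. 1::real) + L2norm M y)"
proof -
  have one: "(\<lambda>x. 1::real) \<in> L2 M" by (rule L2_bounded[OF M]) auto
  have b: "(\<lambda>x. K *\<^sub>R (1 + \<bar>y x\<bar>)) \<in> L2 M" by (intro L2_scaleR L2_add one L2_abs y)
  have m: "(\<lambda>x. g (y x)) \<in> borel_measurable M"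
    using measurable_compose[OF L2_measurable[OF y] monotone_half_hoelder_borel[OF g]] .
  have le: "AE x in M. norm (g (y x)) \<le> norm (K *\<^sub>R (1 + \<bar>y x\<bar>))"
    using monotone_half_hoelder_growth[OF g] monotone_half_hoelderD(3)[OF g] by (intro AE_I2) simp
  show "(\<lambda>x. g (y x)) \<in> L2 M" by (rule L2_dominated[OF b m le])
  have "L2norm M (\<lambda>x. g (y x)) \<le> L2norm M (\<lambda>x. K *\<^sub>R (1 + \<bar>y x\<bar>))" by (rule L2norm_mono[OF b m le])
  also have "\<dots> = K * L2norm M (\<lambda>x. 1 + \<bar>y x\<bar>)"
    unfolding L2norm_scaleR using monotone_half_hoelderD(3)[OF g] by simp
  also have "\<dots> \<le> K * (L2norm M (\<lambda>x. 1::real) + L2norm M y)"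
    using monotone_half_hoelderD(3)[OF g] L2norm_triangle[OF one L2_abs[OF y]]
    by (intro mult_left_mono) (auto simp: L2norm_abs)
  finally show "L2norm M (\<lambda>x. g (y x)) \<le> K * (L2norm M (\<lambda>x. 1::real) + L2norm M y)" .
qed

lemma g_of_eq_integral:
  assumes "\<And>a b. set_integrable lebesgue {a..b} u"
  shows "g_of u t = (if 0 \<le> t then integral {0..t} u else - integral {t..0} u)"
proof -
  have "(LINT x:{a<..<b}|lebesgue. u x) = integral {a..b} u" for a b
  proof -
    have "set_integrable lebesgue {a<..<b} u"
      by (rule set_integrable_subset[OF assms[of a b]]) auto
    then show ?thesis
      by (simp add: set_lebesgue_integral_eq_integral integral_open_interval_real)
  qed
  then show ?thesis
    by (simp add: g_of_def interval_lebesgue_integral_def zero_ereal_def)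
qed

text \<open>Additivity of the integral, in the three positions of \<open>0\<close> relative to \<open>a\<close> and \<open>b\<close>.\<close>

lemma g_of_diff:
  assumes u: "\<And>a b. set_integrable lebesgue {a..b} u" and ab: "a \<le> b"
  shows "g_of u b - g_of u a = integral {a..b} u"
proof -
  have int: "u integrable_on {a..b}" for a b
    by (rule set_lebesgue_integral_eq_integral(1)[OF u])
  have "integral {a..0} u + integral {0..b} u = integral {a..b} u" if "a \<le> 0" "0 \<le> b"
    using Henstock_Kurzweil_Integration.integral_combine[OF that int] .
  moreover have "integral {0..a} u + integral {a..b} u = integral {0..b} u" if "0 \<le> a"
    using Henstock_Kurzweil_Integration.integral_combine[OF that ab int] .
  moreover have "integral {a..b} u + integral {b..0} u = integral {a..0} u" if "b \<le> 0"
    using Henstock_Kurzweil_Integration.integral_combine[OF ab that int] .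
  ultimately show ?thesis using ab by (auto simp: g_of_eq_integral[OF u])
qed

text \<open>The primitive of a nondecreasing function is convex, with the function as a subgradient. All later
  estimates on \<open>\<Gamma>\<close> are consequences of the subgradient inequality.\<close>

lemma convex_primitive:
  assumes g: "monotone_half_hoelder K g"
  obtains \<Gamma> where "\<Gamma> 0 = 0" "\<And>a b. g a * (b - a) \<le> \<Gamma> b - \<Gamma> a" "continuous_on UNIV \<Gamma>"
proof -
  define \<Gamma> where "\<Gamma> = g_of g"
  have si: "set_integrable lebesgue {a..b} g" for a b
    by (intro absolutely_integrable_continuous_real monotone_half_hoelder_continuous[OF g])
  have int: "g integrable_on {a..b}" for a b
    by (rule integrable_continuous_real[OF monotone_half_hoelder_continuous[OF g]])
  note diff = g_of_diff[OF si, folded \<Gamma>_def]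
  have bounds: "g a * (b - a) \<le> \<Gamma> b - \<Gamma> a \<and> \<Gamma> b - \<Gamma> a \<le> g b * (b - a)" if "a \<le> b" for a b
  proof -
    have "integral {a..b} (\<lambda>t. g a) \<le> integral {a..b} g"
      using monotone_half_hoelderD(1)[OF g] by (intro integral_le int) (auto simp: mono_def)
    moreover have "integral {a..b} g \<le> integral {a..b} (\<lambda>t. g b)"
      using monotone_half_hoelderD(1)[OF g] by (intro integral_le int) (auto simp: mono_def)
    ultimately show ?thesis using that by (simp add: diff mult.commute)
  qed
  have sub: "g a * (b - a) \<le> \<Gamma> b - \<Gamma> a" for a b
    using bounds[of a b] bounds[of b a] by (cases "a \<le> b") (auto simp: algebra_simps)
  have cont: "isCont \<Gamma> a" for a
  proof -
    have "((\<lambda>b. \<Gamma> b - \<Gamma> a) \<longlongrightarrow> 0) (at a)"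
    proof (rule real_tendsto_sandwich)
      show "\<forall>\<^sub>F b in at a. g a * (b - a) \<le> \<Gamma> b - \<Gamma> a" by (simp add: sub)
      show "\<forall>\<^sub>F b in at a. \<Gamma> b - \<Gamma> a \<le> g b * (b - a)"
        using sub by (intro always_eventually allI) (smt (verit) mult_minus_right)
      have "((\<lambda>b. g a * (b - a)) \<longlongrightarrow> g a * (a - a)) (at a)" by (intro tendsto_intros)
      then show "((\<lambda>b. g a * (b - a)) \<longlongrightarrow> 0) (at a)" by simp
      have "isCont g a"
        using monotone_half_hoelder_continuous[OF g, of UNIV] by (simp add: continuous_on_eq_continuous_at)
      then have "((\<lambda>b. g b * (b - a)) \<longlongrightarrow> g a * (a - a)) (at a)" unfolding isCont_def by (intro tendsto_intros)
      then show "((\<lambda>b. g b * (b - a)) \<longlongrightarrow> 0) (at a)" by simp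
    qed
    then show ?thesis by (simp add: isCont_def LIM_zero_iff)
  qed
  have "\<Gamma> 0 = 0" by (simp add: \<Gamma>_def g_of_eq_integral[OF si])
  moreover have "continuous_on UNIV \<Gamma>" using cont by (intro continuous_at_imp_continuous_on) auto
  ultimately show ?thesis using that sub by blast
qed

text \<open>The subgradient inequality in both directions gives
  \<open>\<bar>\<Gamma> a - \<Gamma> b\<bar> \<le> \<bar>a - b\<bar> (\<bar>g a\<bar> + \<bar>g b\<bar>)\<close>, and \<open>g\<close> grows at most linearly.\<close>

lemma primitive_integral:
  fixes f :: "'a \<Rightarrow> real"
  assumes fin: "finite_measure M" and g: "monotone_half_hoelder K g" and \<Gamma>0: "\<Gamma> 0 = 0"
    and sub: "\<And>a b. g a * (b - a) \<le> \<Gamma> b - \<Gamma> a" and \<Gamma>c: "continuous_on UNIV \<Gamma>"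
  shows primitive_integrable: "f \<in> L2 M \<Longrightarrow> integrable M (\<lambda>x. \<Gamma> (f x))"
    and primitive_integral_converges:
      "L2conv M \<phi> f \<Longrightarrow> (\<lambda>n. \<integral>x. \<Gamma> (\<phi> n x) \<partial>M) \<longlonglongrightarrow> (\<integral>x. \<Gamma> (f x) \<partial>M)"
proof -
  have \<Gamma>_lip: "\<bar>\<Gamma> a - \<Gamma> b\<bar> \<le> \<bar>a - b\<bar> * (\<bar>g a\<bar> + \<bar>g b\<bar>)" for a b
  proof -
    have 1: "\<bar>g b * (a - b)\<bar> = \<bar>a - b\<bar> * \<bar>g b\<bar>" "\<bar>g a * (b - a)\<bar> = \<bar>a - b\<bar> * \<bar>g a\<bar>"
      by (simp_all add: abs_mult abs_minus_commute mult.commute)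
    have 2: "0 \<le> \<bar>a - b\<bar> * \<bar>g a\<bar>" "0 \<le> \<bar>a - b\<bar> * \<bar>g b\<bar>" by auto
    show ?thesis unfolding distrib_left using sub[of a b] sub[of b a] 1 2 by linarith
  qed
  note gL2 = monotone_half_hoelder_L2[OF fin g]
  have \<Gamma>m: "(\<lambda>x. \<Gamma> (v x)) \<in> borel_measurable M" if "v \<in> L2 M" for v
    using measurable_compose[OF L2_measurable[OF that] borel_measurable_continuous_onI[OF \<Gamma>c]] .
  have \<Gamma>int: "integrable M (\<lambda>x. \<Gamma> (v x))" if v: "v \<in> L2 M" for v
  proof (rule Bochner_Integration.integrable_bound)
    show "integrable M (\<lambda>x. \<bar>v x\<bar> * \<bar>g (v x)\<bar>)"
      by (intro L2_mult_integrable L2_abs v gL2)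
    show "AE x in M. norm (\<Gamma> (v x)) \<le> norm (\<bar>v x\<bar> * \<bar>g (v x)\<bar>)"
      using \<Gamma>_lip[of "v _" 0] \<Gamma>0 monotone_half_hoelderD(2)[OF g] by (intro AE_I2) (simp add: abs_mult)
  qed (rule \<Gamma>m[OF v])
  show "f \<in> L2 M \<Longrightarrow> integrable M (\<lambda>x. \<Gamma> (f x))" by (rule \<Gamma>int)
  assume \<phi>: "L2conv M \<phi> f"
  note a = L2convD[OF \<phi>]
  let ?c = "\<lambda>n. L2norm M (\<lambda>x. \<phi> n x - f x) * (K * (L2norm M (\<lambda>x. 1::real) + L2norm M (\<phi> n)) + L2norm M (\<lambda>x. g (f x)))"
  have le: "\<bar>(\<integral>x. \<Gamma> (\<phi> n x) \<partial>M) - (\<integral>x. \<Gamma> (f x) \<partial>M)\<bar> \<le> ?c n" for n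
  proof -
    let ?h = "\<lambda>x. \<bar>g (\<phi> n x)\<bar> + \<bar>g (f x)\<bar>"
    have hL: "?h \<in> L2 M" using a by (intro L2_add L2_abs gL2)
    have dL: "(\<lambda>x. \<bar>\<phi> n x - f x\<bar>) \<in> L2 M" using a by (intro L2_abs L2_diff)
    have "\<bar>\<integral>x. \<Gamma> (\<phi> n x) - \<Gamma> (f x) \<partial>M\<bar> \<le> (\<integral>x. \<bar>\<Gamma> (\<phi> n x) - \<Gamma> (f x)\<bar> \<partial>M)"
      by (rule integral_abs_bound)
    also have "\<dots> \<le> (\<integral>x. \<bar>\<phi> n x - f x\<bar> * ?h x \<partial>M)"
      using a \<Gamma>_lip by (intro integral_mono Bochner_Integration.integrable_abs Bochner_Integration.integrable_diff \<Gamma>int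
          L2_mult_integrable hL dL) auto
    also have "\<dots> \<le> L2norm M (\<lambda>x. \<phi> n x - f x) * L2norm M ?h"
      using L2_Cauchy_Schwarz_real[OF dL hL] by (simp add: L2norm_abs)
    also have "\<dots> \<le> ?c n"
      using L2norm_triangle[OF L2_abs[OF gL2(1)[OF a(1)[of n]]] L2_abs[OF gL2(1)[OF a(2)]]] gL2(2)[OF a(1)[of n]]
      by (intro mult_left_mono) (auto simp: L2norm_abs)
    finally show ?thesis using \<Gamma>int[OF a(1)] \<Gamma>int[OF a(2)] by simp
  qed
  have "?c \<longlonglongrightarrow> 0 * (K * (L2norm M (\<lambda>x. 1::real) + L2norm M f) + L2norm M (\<lambda>x. g (f x)))"
    by (intro tendsto_mult tendsto_add tendsto_const a(3) L2conv_norm[OF \<phi>])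
  then have "?c \<longlonglongrightarrow> 0" by simp
  then have "(\<lambda>n. (\<integral>x. \<Gamma> (\<phi> n x) \<partial>M) - (\<integral>x. \<Gamma> (f x) \<partial>M)) \<longlonglongrightarrow> 0"
    using le by (rule_tac Lim_null_comparison[where g = ?c]) (auto intro: always_eventually)
  then show "(\<lambda>n. \<integral>x. \<Gamma> (\<phi> n x) \<partial>M) \<longlonglongrightarrow> (\<integral>x. \<Gamma> (f x) \<partial>M)" by (simp add: LIM_zero_iff)
qed

text \<open>Divide by \<open>t\<close> and let \<open>t\<close> tend to \<open>0\<close>. The power \<open>3/2\<close> is the remainder of a primitive of a
  function that is Hoelder continuous with exponent \<open>1/2\<close>.\<close>

lemma nonneg_from_small_perturbations:
  assumes "0 < \<tau>" "\<And>t. 0 < t \<Longrightarrow> t < \<tau> \<Longrightarrow> 0 \<le> t * A + t\<^sup>2 * a + t * sqrt t * b"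
  shows "0 \<le> (A::real)"
proof -
  have "((\<lambda>t. A + t * a + sqrt t * b) \<longlongrightarrow> A + 0 * a + sqrt 0 * b) (at_right 0)"
    by (intro tendsto_intros)
  moreover have "\<forall>\<^sub>F t in at_right 0. 0 \<le> A + t * a + sqrt t * b"
  proof (rule eventually_at_rightI[of 0 \<tau>])
    fix t :: real assume t: "t \<in> {0<..<\<tau>}"
    then have "0 < t" by simp
    have "0 \<le> t * (A + t * a + sqrt t * b)"
      using assms(2)[of t] t by (simp add: algebra_simps power2_eq_square)
    then show "0 \<le> A + t * a + sqrt t * b" using \<open>0 < t\<close> by (simp add: zero_le_mult_iff)
  qed (rule assms(1))
  ultimately show ?thesis using tendsto_lowerbound by fastforce
qed

text \<open>The weak solution minimizes the convex energy \<open>1/2 \<parallel>V\<parallel>\<^sup>2 + \<integral> \<Gamma> v - \<integral> f v\<close>, where \<open>\<Gamma>\<close> is the primitive of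
  \<open>g\<close> and \<open>V\<close> is the gradient of \<open>v\<close>. By the parallelogram identity a minimizing sequence of test
  functions has gradients that form a Cauchy sequence; by the Poincare inequality so do the functions
  themselves. The limit has least energy among its perturbations by test functions, and the
  Euler equation of this minimum is the weak formulation.\<close>

lemma weak_solution_exists:
  fixes \<Omega> :: "'a::euclidean_space set"
  assumes \<Omega>: "bounded_domain \<Omega>" and f: "f \<in> L2 (lebesgue_on \<Omega>)" and g: "monotone_half_hoelder K g"
  shows "\<exists>y. weak_solution \<Omega> f g y"
proof -
  let ?M = "lebesgue_on \<Omega>"
  have fin: "finite_measure ?M" by (rule finite_measure_lebesgue_on[OF \<Omega>])
  obtain \<Gamma> where \<Gamma>0: "\<Gamma> 0 = 0" and sub: "\<And>a b. g a * (b - a) \<le> \<Gamma> b - \<Gamma> a" and \<Gamma>c: "continuous_on UNIV \<Gamma>"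
    using convex_primitive[OF g] by blast
  have \<Gamma>_nonneg: "0 \<le> \<Gamma> t" for t using sub[of 0 t] \<Gamma>0 monotone_half_hoelderD(2)[OF g] by simp
  note gL2 = monotone_half_hoelder_L2[OF fin g]
  note \<Gamma>int = primitive_integrable[where \<Gamma>=\<Gamma>, OF fin g \<Gamma>0 sub \<Gamma>c]
  define E where "E v V = (L2norm ?M V)\<^sup>2 / 2 + (\<integral>x. \<Gamma> (v x) \<partial>?M) - (\<integral>x. f x * v x \<partial>?M)"
    for v :: "'a \<Rightarrow> real" and V :: "'a \<Rightarrow> 'a"
  have E_conv: "(\<lambda>n. E (\<phi> n) (V n)) \<longlonglongrightarrow> E v W" if \<phi>: "L2conv ?M \<phi> v" and V: "L2conv ?M V W" for \<phi> v V W
  proof -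
    have "(\<lambda>n. \<integral>x. \<Gamma> (\<phi> n x) \<partial>?M) \<longlonglongrightarrow> (\<integral>x. \<Gamma> (v x) \<partial>?M)"
      by (rule primitive_integral_converges[where \<Gamma>=\<Gamma>, OF fin g \<Gamma>0 sub \<Gamma>c \<phi>])
    then show ?thesis unfolding E_def
      by (intro tendsto_intros L2conv_norm[OF V] L2conv_mult[OF L2conv_const[OF f] \<phi>]) auto
  qed
  let ?T = "test_functions \<Omega>"
  obtain C where C: "0 < C" "\<And>\<phi>. \<phi> \<in> ?T \<Longrightarrow> L2norm ?M \<phi> \<le> C * L2norm ?M (grad \<phi>)"
    using poincare_test[OF \<Omega>] by blast
  define A where "A = (\<lambda>\<phi>. E \<phi> (grad \<phi>)) ` ?T"
  \<comment> \<open>By the Poincare inequality and \<open>2 a b \<le> a\<^sup>2 + b\<^sup>2\<close> the energy is bounded below.\<close>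
  have below: "- (C * L2norm ?M f)\<^sup>2 / 2 \<le> E \<phi> (grad \<phi>)" if \<phi>: "\<phi> \<in> ?T" for \<phi>
  proof -
    have "(\<integral>x. f x * \<phi> x \<partial>?M) \<le> L2norm ?M f * L2norm ?M \<phi>"
      using L2_Cauchy_Schwarz_real[OF f test_function_L2[OF \<Omega> \<phi>]] by linarith
    also have "\<dots> \<le> L2norm ?M f * (C * L2norm ?M (grad \<phi>))"
      using C(2)[OF \<phi>] by (intro mult_left_mono) auto
    also have "\<dots> \<le> (C * L2norm ?M f)\<^sup>2 / 2 + (L2norm ?M (grad \<phi>))\<^sup>2 / 2"
      using sum_squares_bound[of "C * L2norm ?M f" "L2norm ?M (grad \<phi>)"] by (simp add: algebra_simps)
    finally have "(\<integral>x. f x * \<phi> x \<partial>?M) \<le> (C * L2norm ?M f)\<^sup>2 / 2 + (L2norm ?M (grad \<phi>))\<^sup>2 / 2" .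
    moreover have "0 \<le> (\<integral>x. \<Gamma> (\<phi> x) \<partial>?M)" using \<Gamma>_nonneg by (intro integral_nonneg_AE) simp
    ultimately show ?thesis by (simp add: E_def)
  qed
  have A_ne: "A \<noteq> {}" using test_function_zero[of \<Omega>] by (auto simp: A_def)
  have A_bdd: "bdd_below A" using below by (auto simp: A_def bdd_below_def)
  define I where "I = Inf A"
  have I_le: "I \<le> E \<phi> (grad \<phi>)" if "\<phi> \<in> ?T" for \<phi>
    unfolding I_def using that by (intro cInf_lower A_bdd) (auto simp: A_def)
  have "\<exists>\<phi>\<in>?T. E \<phi> (grad \<phi>) < I + 1 / (real n + 1)" for n
    using cInf_lessD[OF A_ne, of "I + 1 / (real n + 1)"] by (auto simp: I_def A_def)
  then obtain \<phi> where \<phi>: "\<And>n. \<phi> n \<in> ?T" "\<And>n. E (\<phi> n) (grad (\<phi> n)) < I + 1 / (real n + 1)" by metis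
  \<comment> \<open>Compare the midpoint of two members with the infimum: \<open>\<Gamma>\<close> is convex, and the squared norm of the
    gradient gains an eighth of the squared distance by the parallelogram identity.\<close>
  have close: "(L2norm ?M (\<lambda>x. grad (\<phi> i) x - grad (\<phi> j) x))\<^sup>2 \<le> 4 * (1 / (real i + 1) + 1 / (real j + 1))" for i j
  proof -
    define m where "m x = (1/2) * (\<phi> i x + \<phi> j x)" for x
    let ?a = "grad (\<phi> i)" and ?b = "grad (\<phi> j)"
    have mT: "m \<in> ?T" unfolding m_def[abs_def] by (intro test_function_cmult test_function_add \<phi>)
    have gm: "grad m = (\<lambda>x. (1/2) *\<^sub>R (?a x + ?b x))"
      unfolding m_def[abs_def] by (rule ext)
        (simp only: grad_cmult[OF test_function_add[OF \<phi>(1) \<phi>(1)]] grad_add[OF \<phi>(1) \<phi>(1)])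
    note L = grad_L2[OF \<Omega> \<phi>(1)] and L0 = test_function_L2[OF \<Omega> \<phi>(1)]
    have n1: "(L2norm ?M (grad m))\<^sup>2 = ((L2norm ?M ?a)\<^sup>2 + 2 * (\<integral>x. ?a x \<bullet> ?b x \<partial>?M) + (L2norm ?M ?b)\<^sup>2) / 4"
      unfolding gm L2norm_scaleR power_mult_distrib L2norm_sq_add[OF L L] by (simp add: power2_eq_square)
    have n2: "(L2norm ?M (\<lambda>x. ?a x - ?b x))\<^sup>2 = (L2norm ?M ?a)\<^sup>2 - 2 * (\<integral>x. ?a x \<bullet> ?b x \<partial>?M) + (L2norm ?M ?b)\<^sup>2"
      using L2norm_sq_add[OF L[of i] L2_uminus[OF L[of j]]] L2norm_scaleR[of ?M "-1" ?b] by simp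
    have "(\<integral>x. \<Gamma> (m x) \<partial>?M) \<le> (\<integral>x. (\<Gamma> (\<phi> i x) + \<Gamma> (\<phi> j x)) / 2 \<partial>?M)"
    proof (rule integral_mono)
      show "integrable ?M (\<lambda>x. \<Gamma> (m x))" by (rule \<Gamma>int[OF test_function_L2[OF \<Omega> mT]])
      show "integrable ?M (\<lambda>x. (\<Gamma> (\<phi> i x) + \<Gamma> (\<phi> j x)) / 2)"
        using \<Gamma>int[OF L0[of i]] \<Gamma>int[OF L0[of j]] by simp
      fix x
      show "\<Gamma> (m x) \<le> (\<Gamma> (\<phi> i x) + \<Gamma> (\<phi> j x)) / 2"
        using sub[of "m x" "\<phi> i x"] sub[of "m x" "\<phi> j x"] by (simp add: m_def field_simps)
    qed
    then have n3: "(\<integral>x. \<Gamma> (m x) \<partial>?M) \<le> ((\<integral>x. \<Gamma> (\<phi> i x) \<partial>?M) + (\<integral>x. \<Gamma> (\<phi> j x) \<partial>?M)) / 2"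
      using \<Gamma>int[OF L0[of i]] \<Gamma>int[OF L0[of j]] by simp
    have n4: "(\<integral>x. f x * m x \<partial>?M) = ((\<integral>x. f x * \<phi> i x \<partial>?M) + (\<integral>x. f x * \<phi> j x \<partial>?M)) / 2"
      using L2_mult_integrable[OF f L0[of i]] L2_mult_integrable[OF f L0[of j]]
      by (simp add: m_def distrib_left)
    have "E m (grad m) \<le> (E (\<phi> i) ?a + E (\<phi> j) ?b) / 2 - (L2norm ?M (\<lambda>x. ?a x - ?b x))\<^sup>2 / 8"
      unfolding E_def n1 n2 n4 using n3 by (simp add: field_simps)
    then show ?thesis using I_le[OF mT] \<phi>(2)[of i] \<phi>(2)[of j] by argo
  qed
  have small: "\<exists>N. \<forall>i\<ge>N. \<forall>j\<ge>N. L2norm ?M (\<lambda>x. grad (\<phi> i) x - grad (\<phi> j) x) < e" if e: "0 < e" for e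
  proof -
    obtain N where N: "real N > 8 / e\<^sup>2" using reals_Archimedean2 by blast
    have "L2norm ?M (\<lambda>x. grad (\<phi> i) x - grad (\<phi> j) x) < e" if "i \<ge> N" "j \<ge> N" for i j
    proof (rule power2_less_imp_less)
      have N0: "0 < real N" using N e by (smt (verit) divide_pos_pos zero_less_power)
      have "1 / (real i + 1) < 1 / real N" "1 / (real j + 1) < 1 / real N"
        using that N0 by (auto intro!: divide_strict_left_mono)
      moreover have "8 * (1 / real N) < e\<^sup>2" using N N0 e by (simp add: field_simps)
      ultimately show "(L2norm ?M (\<lambda>x. grad (\<phi> i) x - grad (\<phi> j) x))\<^sup>2 < e\<^sup>2"
        using close[of i j] by argo
    qed (use e in simp)
    then show ?thesis by blast
  qed
  obtain G where G: "L2conv ?M (\<lambda>n. grad (\<phi> n)) G"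
    using L2_complete[OF fin grad_L2[OF \<Omega> \<phi>(1)] small] by blast
  have small2: "\<exists>N. \<forall>i\<ge>N. \<forall>j\<ge>N. L2norm ?M (\<lambda>x. \<phi> i x - \<phi> j x) < e" if e: "0 < e" for e
  proof -
    obtain N where N: "\<forall>i\<ge>N. \<forall>j\<ge>N. L2norm ?M (\<lambda>x. grad (\<phi> i) x - grad (\<phi> j) x) < e / C"
      using small[of "e / C"] e C(1) by auto
    have "L2norm ?M (\<lambda>x. \<phi> i x - \<phi> j x) < e" if "i \<ge> N" "j \<ge> N" for i j
    proof -
      have "grad (\<lambda>x. \<phi> i x - \<phi> j x) = (\<lambda>x. grad (\<phi> i) x - grad (\<phi> j) x)"
        by (rule ext) (rule grad_diff[OF \<phi>(1) \<phi>(1)])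
      then have "L2norm ?M (\<lambda>x. \<phi> i x - \<phi> j x) \<le> C * L2norm ?M (\<lambda>x. grad (\<phi> i) x - grad (\<phi> j) x)"
        using C(2)[OF test_function_diff[OF \<phi>(1) \<phi>(1)], of i j] by simp
      also have "\<dots> < C * (e / C)" using N that C(1) by (intro mult_strict_left_mono) auto
      finally show ?thesis using C(1) by simp
    qed
    then show ?thesis by blast
  qed
  obtain y where y: "L2conv ?M \<phi> y"
    using L2_complete[OF fin test_function_L2[OF \<Omega> \<phi>(1)] small2] by blast
  have yG: "H10_limit \<Omega> y G" unfolding H10_limit_def using \<phi>(1) y G by blast
  note yL2 = H10_limit_L2[OF yG]
  have E_yG: "E y G \<le> I"
  proof (rule LIMSEQ_le[OF E_conv[OF y G]])
    have "(\<lambda>n. I + 1 / (real n + 1)) \<longlonglongrightarrow> I + 0"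
      using LIMSEQ_inverse_real_of_nat by (intro tendsto_intros) (simp add: inverse_eq_divide add.commute)
    then show "(\<lambda>n. I + 1 / (real n + 1)) \<longlonglongrightarrow> I" by simp
    show "\<exists>N. \<forall>n\<ge>N. E (\<phi> n) (grad (\<phi> n)) \<le> I + 1 / (real n + 1)" using \<phi>(2) less_imp_le by blast
  qed
  \<comment> \<open>Perturbing the minimizing sequence and passing to the limit shows that \<open>y\<close> is a minimum against test functions.\<close>
  have variation: "E y G \<le> E (\<lambda>x. y x + s * \<psi> x) (\<lambda>x. G x + s *\<^sub>R grad \<psi> x)" if \<psi>: "\<psi> \<in> ?T" for \<psi> s
  proof -
    have "(\<lambda>n. E (\<lambda>x. \<phi> n x + s * \<psi> x) (\<lambda>x. grad (\<phi> n) x + s *\<^sub>R grad \<psi> x))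
       \<longlonglongrightarrow> E (\<lambda>x. y x + s * \<psi> x) (\<lambda>x. G x + s *\<^sub>R grad \<psi> x)"
      using L2_cmult[OF test_function_L2[OF \<Omega> \<psi>], of s] L2_scaleR[OF grad_L2[OF \<Omega> \<psi>], of s]
      by (intro E_conv L2conv_add y G L2conv_const)
    moreover have "I \<le> E (\<lambda>x. \<phi> n x + s * \<psi> x) (\<lambda>x. grad (\<phi> n) x + s *\<^sub>R grad \<psi> x)" for n
    proof -
      have "grad (\<lambda>x. \<phi> n x + s * \<psi> x) = (\<lambda>x. grad (\<phi> n) x + s *\<^sub>R grad \<psi> x)"
        by (rule ext) (simp add: grad_add[OF \<phi>(1) test_function_cmult[OF \<psi>]] grad_cmult[OF \<psi>])
      then show ?thesis using I_le[OF test_function_add[OF \<phi>(1) test_function_cmult[OF \<psi>]], of n s] by simp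
    qed
    ultimately have "I \<le> E (\<lambda>x. y x + s * \<psi> x) (\<lambda>x. G x + s *\<^sub>R grad \<psi> x)"
      by (intro LIMSEQ_le_const) auto
    then show ?thesis using E_yG by simp
  qed
  \<comment> \<open>One inequality of the Euler equation; the other one follows for \<open>- \<psi>\<close>.\<close>
  have half: "0 \<le> (\<integral>x. G x \<bullet> grad \<psi> x \<partial>?M) + (\<integral>x. g (y x) * \<psi> x \<partial>?M) - (\<integral>x. f x * \<psi> x \<partial>?M)"
    if \<psi>: "\<psi> \<in> ?T" for \<psi>
  proof (rule nonneg_from_small_perturbations[OF zero_less_one])
    fix t :: real assume t: "0 < t"
    note L = test_function_L2[OF \<Omega> \<psi>] grad_L2[OF \<Omega> \<psi>]
    define P where "P = (\<integral>x. (1 + \<bar>\<psi> x\<bar>) * \<bar>\<psi> x\<bar> \<partial>?M)"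
    have one: "(\<lambda>x. 1::real) \<in> L2 ?M" by (rule L2_bounded[OF fin]) auto
    have Pint: "integrable ?M (\<lambda>x. (1 + \<bar>\<psi> x\<bar>) * \<bar>\<psi> x\<bar>)"
      by (intro L2_mult_integrable L2_add one L2_abs L)
    have gint: "integrable ?M (\<lambda>x. g (y x) * \<psi> x)" by (intro L2_mult_integrable gL2 yL2 L)
    have yt: "(\<lambda>x. y x + t * \<psi> x) \<in> L2 ?M" by (intro L2_add yL2 L2_cmult L)
    have "(\<integral>x. \<Gamma> (y x + t * \<psi> x) - \<Gamma> (y x) \<partial>?M) \<le> (\<integral>x. t * (g (y x) * \<psi> x) + t * sqrt t * K * ((1 + \<bar>\<psi> x\<bar>) * \<bar>\<psi> x\<bar>) \<partial>?M)"
    proof (rule integral_mono)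
      show "integrable ?M (\<lambda>x. \<Gamma> (y x + t * \<psi> x) - \<Gamma> (y x))"
        by (intro Bochner_Integration.integrable_diff \<Gamma>int yt yL2)
      show "integrable ?M (\<lambda>x. t * (g (y x) * \<psi> x) + t * sqrt t * K * ((1 + \<bar>\<psi> x\<bar>) * \<bar>\<psi> x\<bar>))"
        using Pint gint by simp
      fix x
      have "\<Gamma> (y x + t * \<psi> x) - \<Gamma> (y x) \<le> g (y x + t * \<psi> x) * (t * \<psi> x)"
        using sub[of "y x + t * \<psi> x" "y x"] by simp
      also have "\<dots> = t * (g (y x) * \<psi> x) + (g (y x + t * \<psi> x) - g (y x)) * (t * \<psi> x)"
        by (simp add: algebra_simps)
      also have "(g (y x + t * \<psi> x) - g (y x)) * (t * \<psi> x) \<le> \<bar>g (y x + t * \<psi> x) - g (y x)\<bar> * \<bar>t * \<psi> x\<bar>"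
        by (simp flip: abs_mult)
      also have "\<dots> \<le> (K * sqrt \<bar>t * \<psi> x\<bar>) * \<bar>t * \<psi> x\<bar>"
        using monotone_half_hoelderD(4)[OF g, of "y x + t * \<psi> x" "y x"] by (intro mult_right_mono) auto
      also have "\<dots> = t * sqrt t * K * (sqrt \<bar>\<psi> x\<bar> * \<bar>\<psi> x\<bar>)"
        using t by (simp add: abs_mult real_sqrt_mult mult_ac)
      also have "\<dots> \<le> t * sqrt t * K * ((1 + \<bar>\<psi> x\<bar>) * \<bar>\<psi> x\<bar>)"
        using t monotone_half_hoelderD(3)[OF g] sqrt_le_one_plus[of "\<bar>\<psi> x\<bar>"]
        by (intro mult_left_mono mult_right_mono) auto
      finally show "\<Gamma> (y x + t * \<psi> x) - \<Gamma> (y x) \<le> t * (g (y x) * \<psi> x) + t * sqrt t * K * ((1 + \<bar>\<psi> x\<bar>) * \<bar>\<psi> x\<bar>)"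
        by simp
    qed
    also have "\<dots> = t * (\<integral>x. g (y x) * \<psi> x \<partial>?M) + t * sqrt t * K * P"
      using Pint gint by (simp add: P_def)
    finally have 1: "(\<integral>x. \<Gamma> (y x + t * \<psi> x) \<partial>?M) - (\<integral>x. \<Gamma> (y x) \<partial>?M)
       \<le> t * (\<integral>x. g (y x) * \<psi> x \<partial>?M) + t * sqrt t * K * P"
      using \<Gamma>int[OF yt] \<Gamma>int[OF yL2(1)] by simp
    have 2: "(L2norm ?M (\<lambda>x. G x + t *\<^sub>R grad \<psi> x))\<^sup>2
      = (L2norm ?M G)\<^sup>2 + 2 * t * (\<integral>x. G x \<bullet> grad \<psi> x \<partial>?M) + t\<^sup>2 * (L2norm ?M (grad \<psi>))\<^sup>2"
      unfolding L2norm_sq_add[OF yL2(2) L2_scaleR[OF L(2)]] L2norm_scaleR by (simp add: power_mult_distrib)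
    have 3: "(\<integral>x. f x * (y x + t * \<psi> x) \<partial>?M) = (\<integral>x. f x * y x \<partial>?M) + t * (\<integral>x. f x * \<psi> x \<partial>?M)"
      using L2_mult_integrable[OF f yL2(1)] L2_mult_integrable[OF f L(1)]
      by (simp add: distrib_left mult.left_commute)
    show "0 \<le> t * ((\<integral>x. G x \<bullet> grad \<psi> x \<partial>?M) + (\<integral>x. g (y x) * \<psi> x \<partial>?M) - (\<integral>x. f x * \<psi> x \<partial>?M))
       + t\<^sup>2 * ((L2norm ?M (grad \<psi>))\<^sup>2 / 2) + t * sqrt t * (K * P)"
      using variation[OF \<psi>, of t] 1 unfolding E_def 2 3 by (simp add: field_simps)
  qed
  have "(\<integral>x. G x \<bullet> grad \<psi> x \<partial>?M) + (\<integral>x. g (y x) * \<psi> x \<partial>?M) = (\<integral>x. f x * \<psi> x \<partial>?M)" if \<psi>: "\<psi> \<in> ?T" for \<psi>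
  proof -
    have "grad (\<lambda>x. (-1) * \<psi> x) = (\<lambda>x. - grad \<psi> x)"
      by (rule ext) (simp only: grad_cmult[OF \<psi>], simp)
    then show ?thesis
      using half[OF \<psi>] half[OF test_function_cmult[OF \<psi>, of "-1"]] by simp
  qed
  then have "test_solution \<Omega> f g y G" using yG by (simp add: test_solution_def)
  from test_solution_imp_weak_solution[OF \<Omega> f this gL2(1)[OF yL2(1)]] show ?thesis by blast
qed

section \<open>Bounds and stability of states\<close>

lemma L2_indicator_Icc: "(\<lambda>x::real. indicator {a..b} x :: real) \<in> L2 lebesgue"
proof -
  have "{a..b} \<in> sets lebesgue" "emeasure lebesgue {a..b} < \<infinity>"
    by (auto simp: emeasure_lborel_Icc_eq)
  then show ?thesis
    by (auto simp: L2_def power2_eq_square borel_measurable_indicator integrable_real_indicator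
        simp flip: indicator_inter_arith)
qed

lemma L2_set_integrable:
  assumes "u \<in> L2 lebesgue" shows "set_integrable lebesgue {a..b::real} (u :: real \<Rightarrow> real)"
  unfolding set_integrable_def using L2_mult_integrable[OF L2_indicator_Icc assms] by simp

lemma integral_eq_lebesgue_indicator:
  fixes u :: "real \<Rightarrow> real"
  assumes "set_integrable lebesgue {a..b} u"
  shows "integral {a..b} u = (\<integral>x. indicator {a..b} x * u x \<partial>lebesgue)"
  using set_lebesgue_integral_eq_integral(2)[OF assms] by (simp add: set_lebesgue_integral_def)

text \<open>Hoelder continuity is the Cauchy-Schwarz inequality for \<open>u\<close> and the indicator of \<open>[a, b]\<close>.\<close>

lemma g_of_monotone_half_hoelder:
  assumes "u \<in> admissible"
  shows "monotone_half_hoelder (L2norm lebesgue u) (g_of u)"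
proof -
  have u: "u \<in> L2 lebesgue" and pos: "AE t in lebesgue. 0 \<le> u t"
    using assms by (auto simp: admissible_def)
  note si = L2_set_integrable[OF u]
  have diff: "g_of u b - g_of u a = (\<integral>x. indicator {a..b} x * u x \<partial>lebesgue)" if "a \<le> b" for a b
    using g_of_diff[OF si that] integral_eq_lebesgue_indicator[OF si] by simp
  have nonneg: "0 \<le> g_of u b - g_of u a" if "a \<le> b" for a b
    unfolding diff[OF that] using pos by (intro integral_nonneg_AE) (auto elim!: eventually_mono)
  have "\<bar>g_of u b - g_of u a\<bar> \<le> L2norm lebesgue u * sqrt \<bar>b - a\<bar>" if "a \<le> b" for a b
  proof -
    have "L2norm lebesgue (indicator {a..b} :: real \<Rightarrow> real) = sqrt \<bar>b - a\<bar>"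
      using that by (simp add: L2norm_def power2_eq_square flip: indicator_inter_arith)
    then show ?thesis unfolding diff[OF that]
      using L2_Cauchy_Schwarz_real[OF L2_indicator_Icc u, of a b] by (simp add: mult.commute)
  qed
  then have "\<bar>g_of u b - g_of u a\<bar> \<le> L2norm lebesgue u * sqrt \<bar>b - a\<bar>" for a b
    using linear[of a b] by (metis abs_minus_commute)
  moreover have "g_of u 0 = 0" by (simp add: g_of_eq_integral[OF si])
  moreover have "mono (g_of u)" using nonneg by (auto simp: mono_def)
  ultimately show ?thesis by (auto simp: monotone_half_hoelder_def)
qed

lemma g_of_add:
  assumes u: "\<And>a b. set_integrable lebesgue {a..b} u" and h: "\<And>a b. set_integrable lebesgue {a..b} h"
  shows "g_of (\<lambda>t. u t + h t) s = g_of u s + g_of h s"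
proof -
  have "integral {a..b} (\<lambda>t. u t + h t) = integral {a..b} u + integral {a..b} h" for a b
    by (intro Henstock_Kurzweil_Integration.integral_add set_lebesgue_integral_eq_integral(1) u h)
  then show ?thesis
    using g_of_eq_integral[OF u] g_of_eq_integral[OF h] g_of_eq_integral[OF set_integral_add(1)[OF u h]] by simp
qed

text \<open>Subtract the two equations. Where \<open>y - p > m\<close> one has \<open>y > p + m \<ge> 0\<close> and hence \<open>g y \<ge> 0\<close>, so
  the maximum principle gives \<open>y \<le> p + m \<le> 2 m\<close>. The lower bound is the same argument for
  \<open>p - y\<close>. This is where the factor in \<open>r_P\<close> comes from.\<close>

lemma weak_solution_bound:
  assumes \<Omega>: "bounded_domain \<Omega>" and f: "f \<in> L2 (lebesgue_on \<Omega>)" and g: "monotone_half_hoelder K g"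
    and y: "weak_solution \<Omega> f g y" and p: "weak_solution \<Omega> f (\<lambda>_. 0) p"
    and m: "AE x in lebesgue_on \<Omega>. \<bar>p x\<bar> \<le> m" "0 \<le> m"
  shows "AE x in lebesgue_on \<Omega>. \<bar>y x\<bar> \<le> 2 * m"
proof -
  let ?M = "lebesgue_on \<Omega>"
  have fin: "finite_measure ?M" by (rule finite_measure_lebesgue_on[OF \<Omega>])
  obtain G where G: "test_solution \<Omega> f g y G" using weak_solution_imp_test_solution[OF \<Omega> y] by blast
  obtain P where P: "test_solution \<Omega> f (\<lambda>_. 0) p P" using weak_solution_imp_test_solution[OF \<Omega> p] by blast
  have lim: "H10_limit \<Omega> y G" "H10_limit \<Omega> p P" using G P by (auto simp: test_solution_def)
  note L = H10_limit_L2[OF lim(1)] H10_limit_L2[OF lim(2)]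
  have gL: "(\<lambda>x. g (y x)) \<in> L2 ?M" by (rule monotone_half_hoelder_L2(1)[OF fin g L(1)])
  have z: "H10_limit \<Omega> (\<lambda>x. y x - p x) (\<lambda>x. G x - P x)" by (rule H10_limit_diff[OF lim])
  have eq: "(\<integral>x. (G x - P x) \<bullet> grad \<phi> x \<partial>?M) + (\<integral>x. g (y x) * \<phi> x \<partial>?M) = 0" if \<phi>: "\<phi> \<in> test_functions \<Omega>" for \<phi>
  proof -
    have "(\<integral>x. (G x - P x) \<bullet> grad \<phi> x \<partial>?M) = (\<integral>x. G x \<bullet> grad \<phi> x \<partial>?M) - (\<integral>x. P x \<bullet> grad \<phi> x \<partial>?M)"
      using L2_inner_integrable[OF L(2) grad_L2[OF \<Omega> \<phi>]] L2_inner_integrable[OF L(4) grad_L2[OF \<Omega> \<phi>]]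
      by (simp add: inner_diff_left)
    moreover have "(\<integral>x. G x \<bullet> grad \<phi> x \<partial>?M) + (\<integral>x. g (y x) * \<phi> x \<partial>?M) = (\<integral>x. f x * \<phi> x \<partial>?M)"
      "(\<integral>x. P x \<bullet> grad \<phi> x \<partial>?M) = (\<integral>x. f x * \<phi> x \<partial>?M)"
      using G P \<phi> by (auto simp: test_solution_def)
    ultimately show ?thesis by linarith
  qed
  have "AE x in ?M. y x - p x \<le> m"
  proof (rule weak_maximum_principle[OF \<Omega> z gL eq _ m(2)])
    show "AE x in ?M. m < y x - p x \<longrightarrow> 0 \<le> g (y x)" using m(1)
    proof eventually_elim
      case (elim x)
      then show ?case using monoD[OF monotone_half_hoelderD(1)[OF g], of 0 "y x"] monotone_half_hoelderD(2)[OF g] by auto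
    qed
  qed
  moreover have "AE x in ?M. (-1) * (y x - p x) \<le> m"
  proof (rule weak_maximum_principle[OF \<Omega> H10_limit_cmult[OF z] L2_uminus[OF gL] _ _ m(2)])
    show "(\<integral>x. ((-1) *\<^sub>R (G x - P x)) \<bullet> grad \<phi> x \<partial>?M) + (\<integral>x. - g (y x) * \<phi> x \<partial>?M) = 0"
      if "\<phi> \<in> test_functions \<Omega>" for \<phi>
    proof -
      have "(\<integral>x. ((-1) *\<^sub>R (G x - P x)) \<bullet> grad \<phi> x \<partial>?M) = - (\<integral>x. (G x - P x) \<bullet> grad \<phi> x \<partial>?M)"
        unfolding inner_scaleR_left by (subst integral_mult_right_zero) simp
      moreover have "(\<integral>x. - g (y x) * \<phi> x \<partial>?M) = - (\<integral>x. g (y x) * \<phi> x \<partial>?M)" by simp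
      ultimately show ?thesis using eq[OF that] by simp
    qed
    show "AE x in ?M. m < (-1) * (y x - p x) \<longrightarrow> 0 \<le> - g (y x)" using m(1)
    proof eventually_elim
      case (elim x)
      then show ?case using monoD[OF monotone_half_hoelderD(1)[OF g], of "y x" 0] monotone_half_hoelderD(2)[OF g] by auto
    qed
  qed
  ultimately show ?thesis using m(1) by eventually_elim (auto simp: abs_le_iff)
qed

text \<open>Test the difference of the equations with \<open>d = y\<^sub>1 - y\<^sub>2\<close>. By monotonicity
  \<open>(g\<^sub>1 y\<^sub>1 - g\<^sub>1 y\<^sub>2) d \<ge> 0\<close>, so the squared norm of the gradient of \<open>d\<close> is at most the integral of
  \<open>(g\<^sub>2 y\<^sub>2 - g\<^sub>1 y\<^sub>2) d\<close>, in which the nonlinearities differ by at most \<open>\<kappa>\<close>.\<close>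

lemma weak_solution_stability:
  fixes \<Omega> :: "'a::euclidean_space set"
  assumes \<Omega>: "bounded_domain \<Omega>"
  obtains C where "0 \<le> C"
    "\<And>f g\<^sub>1 g\<^sub>2 K\<^sub>1 K\<^sub>2 y\<^sub>1 y\<^sub>2 r \<kappa>. f \<in> L2 (lebesgue_on \<Omega>) \<Longrightarrow>
       monotone_half_hoelder K\<^sub>1 g\<^sub>1 \<Longrightarrow> monotone_half_hoelder K\<^sub>2 g\<^sub>2 \<Longrightarrow>
       weak_solution \<Omega> f g\<^sub>1 y\<^sub>1 \<Longrightarrow> weak_solution \<Omega> f g\<^sub>2 y\<^sub>2 \<Longrightarrow>
       AE x in lebesgue_on \<Omega>. \<bar>y\<^sub>2 x\<bar> \<le> r \<Longrightarrow> (\<And>s. \<bar>s\<bar> \<le> r \<Longrightarrow> \<bar>g\<^sub>1 s - g\<^sub>2 s\<bar> \<le> \<kappa>) \<Longrightarrow> 0 \<le> \<kappa> \<Longrightarrow>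
       L2norm (lebesgue_on \<Omega>) (\<lambda>x. y\<^sub>1 x - y\<^sub>2 x) \<le> C * \<kappa>"
proof -
  let ?M = "lebesgue_on \<Omega>"
  have fin: "finite_measure ?M" by (rule finite_measure_lebesgue_on[OF \<Omega>])
  obtain C where C: "0 < C" "\<And>y G. H10_limit \<Omega> y G \<Longrightarrow> L2norm ?M y \<le> C * L2norm ?M G"
    using poincare[OF \<Omega>] by blast
  define c where "c = sqrt (measure ?M (space ?M))"
  have "L2norm ?M (\<lambda>x. y\<^sub>1 x - y\<^sub>2 x) \<le> C\<^sup>2 * c * \<kappa>"
    if f: "f \<in> L2 ?M" and g: "monotone_half_hoelder K\<^sub>1 g\<^sub>1" "monotone_half_hoelder K\<^sub>2 g\<^sub>2"
      and y: "weak_solution \<Omega> f g\<^sub>1 y\<^sub>1" "weak_solution \<Omega> f g\<^sub>2 y\<^sub>2"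
      and r: "AE x in ?M. \<bar>y\<^sub>2 x\<bar> \<le> r" and \<kappa>: "\<And>s. \<bar>s\<bar> \<le> r \<Longrightarrow> \<bar>g\<^sub>1 s - g\<^sub>2 s\<bar> \<le> \<kappa>" "0 \<le> \<kappa>"
    for f g\<^sub>1 g\<^sub>2 K\<^sub>1 K\<^sub>2 y\<^sub>1 y\<^sub>2 r \<kappa>
  proof -
    obtain G\<^sub>1 where G\<^sub>1: "test_solution \<Omega> f g\<^sub>1 y\<^sub>1 G\<^sub>1" using weak_solution_imp_test_solution[OF \<Omega> y(1)] by blast
    obtain G\<^sub>2 where G\<^sub>2: "test_solution \<Omega> f g\<^sub>2 y\<^sub>2 G\<^sub>2" using weak_solution_imp_test_solution[OF \<Omega> y(2)] by blast
    have lim: "H10_limit \<Omega> y\<^sub>1 G\<^sub>1" "H10_limit \<Omega> y\<^sub>2 G\<^sub>2" using G\<^sub>1 G\<^sub>2 by (auto simp: test_solution_def)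
    define d where "d x = y\<^sub>1 x - y\<^sub>2 x" for x
    define D where "D x = G\<^sub>1 x - G\<^sub>2 x" for x
    define h where "h x = g\<^sub>2 (y\<^sub>2 x) - g\<^sub>1 (y\<^sub>2 x)" for x
    have dD: "H10_limit \<Omega> d D" unfolding d_def[abs_def] D_def[abs_def] by (rule H10_limit_diff[OF lim])
    note L = H10_limit_L2[OF lim(1)] H10_limit_L2[OF lim(2)] H10_limit_L2[OF dD]
    note gL = monotone_half_hoelder_L2(1)[OF fin]
    note g1 = gL[OF g(1) L(1)] and g2 = gL[OF g(2) L(3)] and g3 = gL[OF g(1) L(3)]
    have hL: "h \<in> L2 ?M" unfolding h_def[abs_def] by (intro L2_diff g2 g3)
    have "(L2norm ?M D)\<^sup>2 = (\<integral>x. D x \<bullet> D x \<partial>?M)" by (simp add: L2norm_sq power2_norm_eq_inner)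
    also have "\<dots> = (\<integral>x. G\<^sub>1 x \<bullet> D x \<partial>?M) - (\<integral>x. G\<^sub>2 x \<bullet> D x \<partial>?M)"
      using L2_inner_integrable[OF L(2) L(6)] L2_inner_integrable[OF L(4) L(6)] by (simp add: D_def inner_diff_left)
    also have "\<dots> = (\<integral>x. g\<^sub>2 (y\<^sub>2 x) * d x \<partial>?M) - (\<integral>x. g\<^sub>1 (y\<^sub>1 x) * d x \<partial>?M)"
      using test_solution_H10_limit[OF f G\<^sub>1 g1 dD] test_solution_H10_limit[OF f G\<^sub>2 g2 dD] by simp
    also have "\<dots> = (\<integral>x. g\<^sub>2 (y\<^sub>2 x) * d x - g\<^sub>1 (y\<^sub>1 x) * d x \<partial>?M)"
      using L2_mult_integrable[OF g1 L(5)] L2_mult_integrable[OF g2 L(5)] by simp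
    also have "\<dots> \<le> (\<integral>x. h x * d x \<partial>?M)"
    proof (rule integral_mono)
      show "integrable ?M (\<lambda>x. g\<^sub>2 (y\<^sub>2 x) * d x - g\<^sub>1 (y\<^sub>1 x) * d x)"
        using L2_mult_integrable[OF g1 L(5)] L2_mult_integrable[OF g2 L(5)] by simp
      show "integrable ?M (\<lambda>x. h x * d x)" by (rule L2_mult_integrable[OF hL L(5)])
      fix x
      have "0 \<le> (g\<^sub>1 (y\<^sub>1 x) - g\<^sub>1 (y\<^sub>2 x)) * d x"
        using monoD[OF monotone_half_hoelderD(1)[OF g(1)], of "y\<^sub>1 x" "y\<^sub>2 x"]
          monoD[OF monotone_half_hoelderD(1)[OF g(1)], of "y\<^sub>2 x" "y\<^sub>1 x"]
        by (cases "y\<^sub>1 x \<le> y\<^sub>2 x") (auto simp: d_def zero_le_mult_iff)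
      then show "g\<^sub>2 (y\<^sub>2 x) * d x - g\<^sub>1 (y\<^sub>1 x) * d x \<le> h x * d x"
        by (simp add: h_def algebra_simps)
    qed
    also have "\<dots> \<le> L2norm ?M h * L2norm ?M d" using L2_Cauchy_Schwarz_real[OF hL L(5)] by linarith
    also have "\<dots> \<le> (\<kappa> * c) * (C * L2norm ?M D)"
    proof (rule mult_mono)
      have "AE x in ?M. norm (h x) \<le> \<kappa>" using r
      proof eventually_elim
        case (elim x)
        then show ?case using \<kappa>(1)[of "y\<^sub>2 x"] by (simp add: h_def abs_minus_commute)
      qed
      then show "L2norm ?M h \<le> \<kappa> * c"
        unfolding c_def by (rule L2norm_bounded[OF fin L2_measurable[OF hL]]) (rule \<kappa>(2))
    qed (use C dD \<kappa>(2) in \<open>auto simp: c_def\<close>)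
    finally have "L2norm ?M D * L2norm ?M D \<le> (\<kappa> * c * C) * L2norm ?M D"
      by (simp add: power2_eq_square algebra_simps)
    moreover have "0 \<le> \<kappa> * c * C" using \<kappa>(2) C(1) by (simp add: c_def)
    ultimately have "L2norm ?M D \<le> \<kappa> * c * C"
      by (cases "L2norm ?M D = 0") (auto simp: mult_le_cancel_right less_le)
    then have "C * L2norm ?M D \<le> C * (\<kappa> * c * C)" using C(1) by simp
    moreover have "L2norm ?M d \<le> C * L2norm ?M D" using C(2)[OF dD] .
    ultimately have "L2norm ?M d \<le> C * (\<kappa> * c * C)" by linarith
    also have "\<dots> = C\<^sup>2 * c * \<kappa>" by (simp add: power2_eq_square)
    finally show ?thesis by (simp add: d_def[abs_def])
  qed
  then show ?thesis by (intro that[of "C\<^sup>2 * c"]) (auto simp: c_def)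
qed

lemma monotone_half_hoelder_zero: "monotone_half_hoelder 0 (\<lambda>_. 0)"
  by (simp add: monotone_half_hoelder_def mono_def)

lemma state_bound:
  assumes \<Omega>: "bounded_domain \<Omega>" and f: "f \<in> L2 (lebesgue_on \<Omega>)" and r: "r_P \<Omega> f \<le> ereal r"
  shows "0 \<le> r"
    and "u \<in> admissible \<Longrightarrow> weak_solution \<Omega> f (g_of u) (S \<Omega> f u)"
    and "u \<in> admissible \<Longrightarrow> AE x in lebesgue_on \<Omega>. \<bar>S \<Omega> f u x\<bar> \<le> r"
proof -
  let ?M = "lebesgue_on \<Omega>"
  define p where "p = pde_solution \<Omega> f (\<lambda>_. 0)"
  have p: "weak_solution \<Omega> f (\<lambda>_. 0) p"
    unfolding p_def pde_solution_def
    by (rule someI_ex[of "weak_solution \<Omega> f (\<lambda>_. 0)"]) (rule weak_solution_exists[OF \<Omega> f monotone_half_hoelder_zero])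
  have "AE x in ?M. ereal \<bar>p x\<bar> \<le> Linfty_norm ?M p" unfolding Linfty_norm_def by (rule esssup_AE)
  then have m: "AE x in ?M. \<bar>p x\<bar> \<le> r / 2"
  proof eventually_elim
    case (elim x)
    then have "2 * ereal \<bar>p x\<bar> \<le> 2 * Linfty_norm ?M p" by (intro ereal_mult_left_mono) auto
    also have "\<dots> \<le> ereal r" using r by (simp add: r_P_def p_def)
    finally show ?case by simp
  qed
  show r0: "0 \<le> r"
  proof (rule ccontr)
    assume "\<not> 0 \<le> r"
    then have "AE x in ?M. False" using m by (auto elim!: eventually_mono)
    then have "AE x in lebesgue. x \<notin> \<Omega>"
      using \<Omega> by (subst (asm) AE_restrict_space_iff) (auto simp: bounded_domain_def)
    then have "negligible \<Omega>"
      using \<Omega> by (simp add: negligible_iff_null_sets bounded_domain_def AE_iff_null_sets)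
    then show False using \<Omega> open_not_negligible by (auto simp: bounded_domain_def)
  qed
  show ws: "weak_solution \<Omega> f (g_of u) (S \<Omega> f u)" if "u \<in> admissible"
    unfolding S_def pde_solution_def
    by (rule someI_ex[of "weak_solution \<Omega> f (g_of u)"]) (rule weak_solution_exists[OF \<Omega> f g_of_monotone_half_hoelder[OF that]])
  show "AE x in ?M. \<bar>S \<Omega> f u x\<bar> \<le> r" if "u \<in> admissible"
    using weak_solution_bound[OF \<Omega> f g_of_monotone_half_hoelder[OF that] ws[OF that] p m] r0 by simp
qed

text \<open>A difference of squares whose factors are bounded by the stability estimate and by the uniform bound
  on the states.\<close>

lemma tracking_term_lipschitz:
  fixes \<Omega> :: "'a::euclidean_space set"
  assumes \<Omega>: "bounded_domain \<Omega>" and f: "f \<in> L2 (lebesgue_on \<Omega>)" and yD: "yD \<in> L2 (lebesgue_on \<Omega>)"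
    and r: "r_P \<Omega> f \<le> ereal r"
  obtains C where "0 \<le> C"
    "\<And>u v \<kappa>. u \<in> admissible \<Longrightarrow> v \<in> admissible \<Longrightarrow> 0 \<le> \<kappa> \<Longrightarrow> (\<And>s. \<bar>s\<bar> \<le> r \<Longrightarrow> \<bar>g_of u s - g_of v s\<bar> \<le> \<kappa>) \<Longrightarrow>
      \<bar>(L2norm (lebesgue_on \<Omega>) (\<lambda>x. S \<Omega> f u x - yD x))\<^sup>2 / 2
        - (L2norm (lebesgue_on \<Omega>) (\<lambda>x. S \<Omega> f v x - yD x))\<^sup>2 / 2\<bar> \<le> C * \<kappa>"
proof -
  let ?M = "lebesgue_on \<Omega>"
  have fin: "finite_measure ?M" by (rule finite_measure_lebesgue_on[OF \<Omega>])
  obtain C where C: "0 \<le> C"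
    "\<And>f g\<^sub>1 g\<^sub>2 K\<^sub>1 K\<^sub>2 y\<^sub>1 y\<^sub>2 r \<kappa>. f \<in> L2 ?M \<Longrightarrow>
       monotone_half_hoelder K\<^sub>1 g\<^sub>1 \<Longrightarrow> monotone_half_hoelder K\<^sub>2 g\<^sub>2 \<Longrightarrow>
       weak_solution \<Omega> f g\<^sub>1 y\<^sub>1 \<Longrightarrow> weak_solution \<Omega> f g\<^sub>2 y\<^sub>2 \<Longrightarrow>
       AE x in ?M. \<bar>y\<^sub>2 x\<bar> \<le> r \<Longrightarrow> (\<And>s. \<bar>s\<bar> \<le> r \<Longrightarrow> \<bar>g\<^sub>1 s - g\<^sub>2 s\<bar> \<le> \<kappa>) \<Longrightarrow> 0 \<le> \<kappa> \<Longrightarrow>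
       L2norm ?M (\<lambda>x. y\<^sub>1 x - y\<^sub>2 x) \<le> C * \<kappa>"
    by (rule weak_solution_stability[OF \<Omega>]) blast
  define B where "B = r * sqrt (measure ?M (space ?M)) + L2norm ?M yD"
  have B: "0 \<le> B" using state_bound(1)[OF \<Omega> f r] by (simp add: B_def)
  have SL: "S \<Omega> f u \<in> L2 ?M" if "u \<in> admissible" for u
    using weak_solution_imp_test_solution[OF \<Omega> state_bound(2)[OF \<Omega> f r that]] H10_limit_L2
    unfolding test_solution_def by blast
  have SB: "L2norm ?M (\<lambda>x. S \<Omega> f u x - yD x) \<le> B" if u: "u \<in> admissible" for u
  proof -
    have "L2norm ?M (\<lambda>x. - yD x) = L2norm ?M yD" by (simp add: L2norm_def)
    then have "L2norm ?M (\<lambda>x. S \<Omega> f u x - yD x) \<le> L2norm ?M (S \<Omega> f u) + L2norm ?M yD"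
      using L2norm_triangle[OF SL[OF u] L2_uminus[OF yD]] by simp
    also have "L2norm ?M (S \<Omega> f u) \<le> r * sqrt (measure ?M (space ?M))"
      using state_bound[OF \<Omega> f r] u by (intro L2norm_bounded[OF fin L2_measurable[OF SL[OF u]]]) auto
    finally show ?thesis by (simp add: B_def)
  qed
  have "\<bar>(L2norm ?M (\<lambda>x. S \<Omega> f u x - yD x))\<^sup>2 / 2 - (L2norm ?M (\<lambda>x. S \<Omega> f v x - yD x))\<^sup>2 / 2\<bar> \<le> C * B * \<kappa>"
    if u: "u \<in> admissible" and v: "v \<in> admissible" and \<kappa>: "0 \<le> \<kappa>" "\<And>s. \<bar>s\<bar> \<le> r \<Longrightarrow> \<bar>g_of u s - g_of v s\<bar> \<le> \<kappa>"
    for u v \<kappa>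
  proof -
    define a where "a = L2norm ?M (\<lambda>x. S \<Omega> f u x - yD x)"
    define b where "b = L2norm ?M (\<lambda>x. S \<Omega> f v x - yD x)"
    have ab: "0 \<le> a" "0 \<le> b" "a \<le> B" "b \<le> B" using SB[OF u] SB[OF v] by (auto simp: a_def b_def)
    have "\<bar>a - b\<bar> \<le> L2norm ?M (\<lambda>x. S \<Omega> f u x - S \<Omega> f v x)"
      using L2norm_triangle_diff[OF L2_diff[OF SL[OF u] yD] L2_diff[OF SL[OF v] yD]] by (simp add: a_def b_def)
    also have "\<dots> \<le> C * \<kappa>"
      by (rule C(2)[OF f g_of_monotone_half_hoelder[OF u] g_of_monotone_half_hoelder[OF v]
          state_bound(2)[OF \<Omega> f r u] state_bound(2)[OF \<Omega> f r v] state_bound(3)[OF \<Omega> f r v] \<kappa>(2) \<kappa>(1)])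
    finally have d: "\<bar>a - b\<bar> \<le> C * \<kappa>" .
    have "a\<^sup>2 / 2 - b\<^sup>2 / 2 = (a - b) * ((a + b) / 2)" by (simp add: power2_eq_square algebra_simps)
    then have "\<bar>a\<^sup>2 / 2 - b\<^sup>2 / 2\<bar> = \<bar>a - b\<bar> * ((a + b) / 2)" using ab by (simp only: abs_mult) simp
    also have "\<dots> \<le> (C * \<kappa>) * B" using d ab C(1) \<kappa>(1) by (intro mult_mono) auto
    finally show ?thesis by (simp add: a_def b_def mult_ac)
  qed
  then show ?thesis using C(1) B by (intro that[of "C * B"]) auto
qed

section \<open>The variational inequality\<close>

text \<open>A first-order condition for minimality at \<open>u\<close> in the cone of nonnegative functions. For \<open>C = 0\<close> it is
  the variational inequality of the pointwise projection of \<open>m\<close> to this cone; the term with \<open>\<kappa>\<close>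
  leaves room for a part of the objective that is Lipschitz in the primitive of the control.\<close>

definition descent_bound :: "real \<Rightarrow> real \<Rightarrow> (real \<Rightarrow> real) \<Rightarrow> (real \<Rightarrow> real) \<Rightarrow> bool" where
  "descent_bound C r u m \<longleftrightarrow> (\<forall>h \<kappa>. h \<in> L2 lebesgue \<longrightarrow> integrable lebesgue h \<longrightarrow>
     (AE t in lebesgue. 0 \<le> u t + h t) \<longrightarrow> 0 \<le> \<kappa> \<longrightarrow> (\<forall>s. \<bar>s\<bar> \<le> r \<longrightarrow> \<bar>g_of h s\<bar> \<le> \<kappa>) \<longrightarrow>
     0 \<le> (\<integral>t. (u t - m t) * h t \<partial>lebesgue) + C * \<kappa>)"

lemma g_of_cmult:
  assumes h: "\<And>a b. set_integrable lebesgue {a..b} h"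
  shows "g_of (\<lambda>t. c * h t) s = c * g_of h s"
proof -
  have ch: "set_integrable lebesgue {a..b} (\<lambda>t. c * h t)" for a b
    using h[of a b] by (rule set_integrable_mult_right)
  show ?thesis using g_of_eq_integral[OF h] g_of_eq_integral[OF ch] by simp
qed

lemma cost_eq_ennreal:
  assumes u: "AE t in lebesgue. 0 \<le> u t" and int: "0 < \<nu>1 \<Longrightarrow> integrable lebesgue u"
    and \<nu>: "0 \<le> \<nu>1" "0 \<le> \<nu>2"
  shows "J \<Omega> yD uD \<nu>1 \<nu>2 y u = ennreal ((L2norm (lebesgue_on \<Omega>) (\<lambda>x. y x - yD x))\<^sup>2 / 2
     + \<nu>1 * (\<integral>t. u t \<partial>lebesgue) + \<nu>2 / 2 * (L2norm lebesgue (\<lambda>t. u t - uD t))\<^sup>2)"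
proof -
  have nn: "0 \<le> (\<integral>t. u t \<partial>lebesgue)" using u by (rule integral_nonneg_AE)
  have "ennreal \<nu>1 * L1_norm lebesgue u = ennreal (\<nu>1 * (\<integral>t. u t \<partial>lebesgue))"
  proof (cases "\<nu>1 = 0")
    case False
    then have "0 < \<nu>1" using \<nu> by simp
    have "L1_norm lebesgue u = (\<integral>\<^sup>+t. ennreal (u t) \<partial>lebesgue)"
      unfolding L1_norm_def using u by (intro nn_integral_cong_AE) (auto elim!: eventually_mono)
    also have "\<dots> = ennreal (\<integral>t. u t \<partial>lebesgue)"
      using u by (rule nn_integral_eq_integral[OF int[OF \<open>0 < \<nu>1\<close>]])
    finally show ?thesis using \<nu> nn by (simp add: ennreal_mult)
  qed simp
  then show ?thesis unfolding J_def using \<nu> nn by (simp add: ennreal_plus[symmetric] del: ennreal_plus)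
qed

lemma admissible_truncation:
  assumes u: "u \<in> admissible"
  shows "(\<lambda>t. indicator {-a..a} t * u t) \<in> admissible"
    and "integrable lebesgue (\<lambda>t. indicator {-a..a} t * u t)"
proof -
  have uL: "u \<in> L2 lebesgue" and pos: "AE t in lebesgue. 0 \<le> u t" using u by (auto simp: admissible_def)
  show int: "integrable lebesgue (\<lambda>t. indicator {-a..a} t * u t)"
    by (rule L2_mult_integrable[OF L2_indicator_Icc uL])
  have "(\<lambda>t. indicator {-a..a} t * u t) \<in> L2 lebesgue"
    by (rule L2_dominated[OF uL borel_measurable_integrable[OF int]]) (auto simp: indicator_def)
  then show "(\<lambda>t. indicator {-a..a} t * u t) \<in> admissible"
    using pos by (auto simp: admissible_def elim!: eventually_mono)
qed

lemma truncation_converges: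
  fixes u :: "real \<Rightarrow> real"
  assumes u: "u \<in> L2 lebesgue"
  shows "(\<lambda>n. L2norm lebesgue (\<lambda>t. indicator {- real n..real n} t * u t - u t)) \<longlonglongrightarrow> 0"
proof -
  have um: "u \<in> borel_measurable lebesgue" using L2_measurable[OF u] .
  have "(\<lambda>n. \<integral>t. (norm (indicator {- real n..real n} t * u t - u t))\<^sup>2 \<partial>lebesgue) \<longlonglongrightarrow> (\<integral>t. 0 \<partial>(lebesgue :: real measure))"
  proof (rule integral_dominated_convergence[where w="\<lambda>t. (norm (u t))\<^sup>2"])
    show "integrable lebesgue (\<lambda>t. (norm (u t))\<^sup>2)" by (rule L2_sq_integrable[OF u])
    show "(\<lambda>t. (norm (indicator {- real n..real n} t * u t - u t))\<^sup>2) \<in> borel_measurable lebesgue" for n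
    proof -
      have "(\<lambda>t. indicator {- real n..real n} t * u t - u t) \<in> borel_measurable lebesgue"
        by (intro borel_measurable_diff borel_measurable_integrable[OF L2_mult_integrable[OF L2_indicator_Icc u]] um)
      then show ?thesis by simp
    qed
    show "AE t in lebesgue. (\<lambda>n. (norm (indicator {- real n..real n} t * u t - u t))\<^sup>2) \<longlonglongrightarrow> 0"
    proof (rule AE_I2)
      fix t :: real
      obtain N where N: "\<bar>t\<bar> \<le> real N" using real_arch_simple by blast
      have "(norm (indicator {- real n..real n} t * u t - u t))\<^sup>2 = 0" if "n \<ge> N" for n
      proof -
        have "\<bar>t\<bar> \<le> real n" using N that by linarith
        then have "t \<in> {- real n..real n}" by (auto simp: abs_le_iff)
        then show ?thesis by simp
      qed
      then show "(\<lambda>n. (norm (indicator {- real n..real n} t * u t - u t))\<^sup>2) \<longlonglongrightarrow> 0"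
        by (intro tendsto_eventually eventually_sequentiallyI[of N])
    qed
    show "AE t in lebesgue. norm ((norm (indicator {- real n..real n} t * u t - u t))\<^sup>2) \<le> (norm (u t))\<^sup>2" for n
      by (intro AE_I2) (auto simp: indicator_def)
  qed auto
  then have "(\<lambda>n. sqrt (\<integral>t. (norm (indicator {- real n..real n} t * u t - u t))\<^sup>2 \<partial>lebesgue)) \<longlonglongrightarrow> sqrt 0"
    by (intro tendsto_real_sqrt) simp
  then show ?thesis by (simp add: L2norm_def)
qed

text \<open>Otherwise the objective is infinite at \<open>u\<close>, whereas truncations of \<open>u\<close> have finite objective and lie
  arbitrarily close to \<open>u\<close>.\<close>

lemma local_solution_integrable:
  assumes loc: "local_solution \<Omega> f yD uD \<nu>1 \<nu>2 u" and \<nu>: "0 < \<nu>1" "0 < \<nu>2"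
  shows "integrable lebesgue u"
proof (rule ccontr)
  assume not: "\<not> integrable lebesgue u"
  have adm: "u \<in> admissible" using loc by (simp add: local_solution_def)
  then have uL: "u \<in> L2 lebesgue" by (simp add: admissible_def)
  obtain \<rho> where \<rho>: "0 < \<rho>" "\<And>v. v \<in> admissible \<Longrightarrow> L2norm lebesgue (\<lambda>t. v t - u t) \<le> \<rho> \<Longrightarrow>
      J \<Omega> yD uD \<nu>1 \<nu>2 (S \<Omega> f u) u \<le> J \<Omega> yD uD \<nu>1 \<nu>2 (S \<Omega> f v) v"
    using loc unfolding local_solution_def by blast
  have "L1_norm lebesgue u = \<infinity>"
    using not L2_measurable[OF uL] by (auto simp: L1_norm_def integrable_iff_bounded less_top[symmetric])
  then have inf: "J \<Omega> yD uD \<nu>1 \<nu>2 (S \<Omega> f u) u = \<infinity>"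
    using \<nu> by (simp add: J_def ennreal_mult_top)
  obtain n where n: "L2norm lebesgue (\<lambda>t. indicator {- real n..real n} t * u t - u t) < \<rho>"
    using order_tendstoD(2)[OF truncation_converges[OF uL] \<rho>(1)] by (auto simp: eventually_sequentially)
  let ?v = "\<lambda>t. indicator {- real n..real n} t * u t"
  have v: "?v \<in> admissible" by (rule admissible_truncation(1)[OF adm])
  have "J \<Omega> yD uD \<nu>1 \<nu>2 (S \<Omega> f ?v) ?v \<noteq> \<infinity>"
    using \<nu> v by (subst cost_eq_ennreal) (auto simp: admissible_def admissible_truncation(2)[OF adm])
  then show False using \<rho>(2)[OF v] n inf by (simp add: top_unique)
qed

text \<open>Compare \<open>u\<close> with \<open>u + t h\<close> for small \<open>t > 0\<close>. The tracking term changes by at most \<open>C t \<kappa>\<close>, the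
  \<open>L\<^sup>1\<close> term linearly in \<open>t\<close>, and the quadratic term by its derivative plus a multiple of \<open>t\<^sup>2\<close>.\<close>

lemma local_solution_descent_bound:
  fixes \<Omega> :: "'a::euclidean_space set"
  assumes \<Omega>: "bounded_domain \<Omega>" and f: "f \<in> L2 (lebesgue_on \<Omega>)" and yD: "yD \<in> L2 (lebesgue_on \<Omega>)"
    and uD: "uD \<in> L2 lebesgue" and \<nu>: "0 \<le> \<nu>1" "0 < \<nu>2" and r: "r_P \<Omega> f \<le> ereal r"
    and loc: "local_solution \<Omega> f yD uD \<nu>1 \<nu>2 u"
  obtains C where "0 \<le> C" "descent_bound C r u (\<lambda>t. uD t - \<nu>1 / \<nu>2)"
proof -
  let ?M = "lebesgue_on \<Omega>"
  define F where "F v = (L2norm ?M (\<lambda>x. S \<Omega> f v x - yD x))\<^sup>2 / 2" for v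
  obtain C where C: "0 \<le> C" "\<And>u v \<kappa>. u \<in> admissible \<Longrightarrow> v \<in> admissible \<Longrightarrow> 0 \<le> \<kappa> \<Longrightarrow>
      (\<And>s. \<bar>s\<bar> \<le> r \<Longrightarrow> \<bar>g_of u s - g_of v s\<bar> \<le> \<kappa>) \<Longrightarrow> \<bar>F u - F v\<bar> \<le> C * \<kappa>"
    unfolding F_def by (rule tracking_term_lipschitz[OF \<Omega> f yD r]) blast
  have adm: "u \<in> admissible" using loc by (simp add: local_solution_def)
  then have uL: "u \<in> L2 lebesgue" and pos: "AE t in lebesgue. 0 \<le> u t" by (auto simp: admissible_def)
  obtain \<rho> where \<rho>: "0 < \<rho>" "\<And>v. v \<in> admissible \<Longrightarrow> L2norm lebesgue (\<lambda>t. v t - u t) \<le> \<rho> \<Longrightarrow>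
      J \<Omega> yD uD \<nu>1 \<nu>2 (S \<Omega> f u) u \<le> J \<Omega> yD uD \<nu>1 \<nu>2 (S \<Omega> f v) v"
    using loc unfolding local_solution_def by blast
  have uint: "0 < \<nu>1 \<Longrightarrow> integrable lebesgue u"
    using local_solution_integrable[OF loc] \<nu> by simp
  have "descent_bound (C / \<nu>2) r u (\<lambda>t. uD t - \<nu>1 / \<nu>2)"
    unfolding descent_bound_def
  proof (intro allI impI)
    fix h \<kappa>
    assume hL: "h \<in> L2 lebesgue" and hint: "integrable lebesgue h" and hpos: "AE t in lebesgue. 0 \<le> u t + h t"
      and \<kappa>: "0 \<le> \<kappa>" "\<forall>s. \<bar>s\<bar> \<le> r \<longrightarrow> \<bar>g_of h s\<bar> \<le> \<kappa>"
    define d where "d t = u t - uD t" for t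
    have dL: "d \<in> L2 lebesgue" unfolding d_def[abs_def] by (rule L2_diff[OF uL uD])
    define A where "A = C * \<kappa> + \<nu>1 * (\<integral>t. h t \<partial>lebesgue) + \<nu>2 * (\<integral>t. d t * h t \<partial>lebesgue)"
    have "0 \<le> A"
    proof (rule nonneg_from_small_perturbations)
      show "0 < min 1 (\<rho> / (L2norm lebesgue h + 1))" using \<rho>(1) by (simp add: add_nonneg_pos)
      fix t :: real assume t0: "0 < t" and "t < min 1 (\<rho> / (L2norm lebesgue h + 1))"
      then have t1: "t < 1" and t2: "t < \<rho> / (L2norm lebesgue h + 1)" by auto
      define v where "v x = u x + t * h x" for x
      have vL: "v \<in> L2 lebesgue" unfolding v_def[abs_def] by (intro L2_add uL L2_cmult hL)
      have vpos: "AE x in lebesgue. 0 \<le> v x" using pos hpos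
      proof eventually_elim
        case (elim x)
        have "v x = (1 - t) * u x + t * (u x + h x)" by (simp add: v_def algebra_simps)
        then show ?case using elim t0 t1 by simp
      qed
      have vadm: "v \<in> admissible" using vL vpos by (simp add: admissible_def)
      have "L2norm lebesgue (\<lambda>x. v x - u x) = t * L2norm lebesgue h"
        using L2norm_scaleR[of lebesgue t h] t0 by (simp add: v_def)
      also have "\<dots> \<le> t * (L2norm lebesgue h + 1)" using t0 by simp
      also have "\<dots> \<le> \<rho>"
        using t2 pos_less_divide_eq[of "L2norm lebesgue h + 1" t \<rho>] L2norm_nonneg[of lebesgue h] by linarith
      finally have le: "J \<Omega> yD uD \<nu>1 \<nu>2 (S \<Omega> f u) u \<le> J \<Omega> yD uD \<nu>1 \<nu>2 (S \<Omega> f v) v" by (rule \<rho>(2)[OF vadm])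
      have vint: "integrable lebesgue v" if "0 < \<nu>1"
        unfolding v_def[abs_def] using uint[OF that] hint by simp
      \<comment> \<open>If \<open>\<nu>1 = 0\<close>, then \<open>u\<close> need not be integrable, and both sides are zero.\<close>
      have I: "\<nu>1 * (\<integral>x. v x \<partial>lebesgue) = \<nu>1 * (\<integral>x. u x \<partial>lebesgue) + t * (\<nu>1 * (\<integral>x. h x \<partial>lebesgue))"
      proof (cases "\<nu>1 = 0")
        case False
        then have "integrable lebesgue u" using uint \<nu> by simp
        then show ?thesis using hint by (simp add: v_def distrib_left)
      qed simp
      have Q: "(L2norm lebesgue (\<lambda>x. v x - uD x))\<^sup>2 = (L2norm lebesgue d)\<^sup>2
         + 2 * t * (\<integral>x. d x * h x \<partial>lebesgue) + t\<^sup>2 * (L2norm lebesgue h)\<^sup>2"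
      proof -
        have "(\<lambda>x. v x - uD x) = (\<lambda>x. d x + t *\<^sub>R h x)" by (auto simp: v_def d_def)
        then show ?thesis
          using L2norm_sq_add[OF dL L2_scaleR[OF hL, of t]] L2norm_scaleR[of lebesgue t h]
          by (simp add: power_mult_distrib mult.left_commute[of _ t])
      qed
      have nn: "0 \<le> F v + \<nu>1 * (\<integral>x. v x \<partial>lebesgue) + \<nu>2 / 2 * (L2norm lebesgue (\<lambda>x. v x - uD x))\<^sup>2"
        using \<nu> integral_nonneg_AE[OF vpos] by (auto simp: F_def)
      have "F u + \<nu>1 * (\<integral>x. u x \<partial>lebesgue) + \<nu>2 / 2 * (L2norm lebesgue d)\<^sup>2
         \<le> F v + \<nu>1 * (\<integral>x. v x \<partial>lebesgue) + \<nu>2 / 2 * (L2norm lebesgue (\<lambda>x. v x - uD x))\<^sup>2"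
      proof -
        have "J \<Omega> yD uD \<nu>1 \<nu>2 (S \<Omega> f u) u
            = ennreal (F u + \<nu>1 * (\<integral>x. u x \<partial>lebesgue) + \<nu>2 / 2 * (L2norm lebesgue d)\<^sup>2)"
          unfolding F_def d_def[abs_def] by (rule cost_eq_ennreal[OF pos uint]) (use \<nu> in auto)
        moreover have "J \<Omega> yD uD \<nu>1 \<nu>2 (S \<Omega> f v) v
            = ennreal (F v + \<nu>1 * (\<integral>x. v x \<partial>lebesgue) + \<nu>2 / 2 * (L2norm lebesgue (\<lambda>x. v x - uD x))\<^sup>2)"
          unfolding F_def by (rule cost_eq_ennreal[OF vpos vint]) (use \<nu> in auto)
        ultimately show ?thesis using le ennreal_le_iff[OF nn] by simp
      qed
      moreover have "\<bar>F v - F u\<bar> \<le> C * (t * \<kappa>)"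
      proof (rule C(2)[OF vadm adm])
        show "0 \<le> t * \<kappa>" using t0 \<kappa> by simp
        show "\<bar>g_of v s - g_of u s\<bar> \<le> t * \<kappa>" if "\<bar>s\<bar> \<le> r" for s
          using g_of_add[OF L2_set_integrable[OF uL] L2_set_integrable[OF L2_cmult[OF hL]], of t s]
            g_of_cmult[OF L2_set_integrable[OF hL], of t s] \<kappa>(2) that t0
          by (simp add: v_def[abs_def] abs_mult)
      qed
      ultimately show "0 \<le> t * A + t\<^sup>2 * (\<nu>2 / 2 * (L2norm lebesgue h)\<^sup>2) + t * sqrt t * 0"
        unfolding I Q A_def by (simp add: algebra_simps abs_le_iff)
    qed
    moreover have "(\<integral>t. (u t - (uD t - \<nu>1 / \<nu>2)) * h t \<partial>lebesgue)
       = (\<integral>t. d t * h t \<partial>lebesgue) + \<nu>1 / \<nu>2 * (\<integral>t. h t \<partial>lebesgue)"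
    proof -
      have "(\<integral>t. d t * h t + \<nu>1 / \<nu>2 * h t \<partial>lebesgue) = (\<integral>t. d t * h t \<partial>lebesgue) + \<nu>1 / \<nu>2 * (\<integral>t. h t \<partial>lebesgue)"
        using L2_mult_integrable[OF dL hL] hint by simp
      then show ?thesis by (simp add: d_def algebra_simps)
    qed
    ultimately have "0 \<le> \<nu>2 * ((\<integral>t. (u t - (uD t - \<nu>1 / \<nu>2)) * h t \<partial>lebesgue) + C / \<nu>2 * \<kappa>)"
      using \<nu> by (simp add: A_def algebra_simps)
    then show "0 \<le> (\<integral>t. (u t - (uD t - \<nu>1 / \<nu>2)) * h t \<partial>lebesgue) + C / \<nu>2 * \<kappa>"
      using \<nu> by (simp add: zero_le_mult_iff)
  qed
  then show ?thesis using that[of "C / \<nu>2"] C(1) \<nu> by simp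
qed

text \<open>Choose \<open>h\<close> as \<open>max 0 (w - c) - u\<close>, restricted to a bounded set outside \<open>[-r, r]\<close>. Pointwise
  \<open>(u - (w - c)) h \<le> - h\<^sup>2\<close>, so the condition forces \<open>h = 0\<close>.\<close>

lemma descent_bound_outside:
  assumes db: "descent_bound C r u (\<lambda>t. w t - c)" and r: "0 \<le> r" and u: "u \<in> admissible" and w: "w \<in> L2 lebesgue"
  shows "AE t in lebesgue. t \<notin> {-r<..<r} \<longrightarrow> u t = max 0 (w t - c)"
proof -
  have uL: "u \<in> L2 lebesgue" and pos: "AE t in lebesgue. 0 \<le> u t" using u by (auto simp: admissible_def)
  have ev: "AE t in lebesgue. t \<in> {- real n..real n} \<longrightarrow> t \<notin> {-r..r} \<longrightarrow> u t = max 0 (w t - c)" for n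
  proof -
    \<comment> \<open>The closed interval \<open>[-r, r]\<close> is cut out so that \<open>g_of h\<close> vanishes also at its end points.\<close>
    define h where "h t = indicator {- real n..real n} t * (indicator (- {-r..r}) t * (max 0 (w t - c) - u t))" for t
    have hm: "h \<in> borel_measurable lebesgue"
    proof -
      have "- {-r..r} \<in> sets lebesgue" by auto
      then show ?thesis unfolding h_def[abs_def]
        using L2_measurable[OF w] L2_measurable[OF uL] L2_measurable[OF L2_indicator_Icc]
        by (intro borel_measurable_times borel_measurable_diff borel_measurable_max borel_measurable_indicator borel_measurable_const) auto
    qed
    have dL: "(\<lambda>t. \<bar>w t\<bar> + (\<bar>c\<bar> * indicator {- real n..real n} t + \<bar>u t\<bar>)) \<in> L2 lebesgue"
      by (intro L2_add L2_abs w uL L2_cmult L2_indicator_Icc)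
    have hL: "h \<in> L2 lebesgue"
      by (rule L2_dominated[OF dL hm]) (auto simp: h_def indicator_def max_def)
    have hint: "integrable lebesgue h"
    proof -
      have "h = (\<lambda>t. indicator {- real n..real n} t * h t)" by (auto simp: h_def fun_eq_iff indicator_def)
      then show ?thesis using L2_mult_integrable[OF L2_indicator_Icc hL, of "- real n" "real n"] by simp
    qed
    have "g_of h s = 0" if "\<bar>s\<bar> \<le> r" for s
    proof -
      have "integral {a..b} h = 0" if "{a..b} \<subseteq> {-r..r}" for a b
      proof -
        have "integral {a..b} h = integral {a..b} (\<lambda>t. 0)"
          using that by (intro Henstock_Kurzweil_Integration.integral_cong) (auto simp: h_def indicator_def)
        then show ?thesis by simp
      qed
      then show ?thesis using that r by (auto simp: g_of_eq_integral[OF L2_set_integrable[OF hL]] abs_le_iff)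
    qed
    moreover have hpos: "AE t in lebesgue. 0 \<le> u t + h t"
      using pos by (auto simp: h_def indicator_def elim!: eventually_mono)
    ultimately have "0 \<le> (\<integral>t. (u t - (w t - c)) * h t \<partial>lebesgue) + C * 0"
      using db[unfolded descent_bound_def, rule_format, OF hL hint hpos order_refl] by simp
    also have "\<dots> \<le> - (\<integral>t. h t * h t \<partial>lebesgue)"
    proof -
      have i1: "integrable lebesgue (\<lambda>t. (u t - (w t - c)) * h t)"
      proof -
        have "integrable lebesgue (\<lambda>t. (u t - w t) * h t + c * h t)"
          using L2_mult_integrable[OF L2_diff[OF uL w] hL] hint by simp
        then show ?thesis by (simp add: algebra_simps)
      qed
      have "(\<integral>t. (u t - (w t - c)) * h t \<partial>lebesgue) \<le> (\<integral>t. - (h t * h t) \<partial>lebesgue)"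
      proof (rule integral_mono_AE[OF i1])
        show "integrable lebesgue (\<lambda>t. - (h t * h t))" using L2_mult_integrable[OF hL hL] by simp
        show "AE t in lebesgue. (u t - (w t - c)) * h t \<le> - (h t * h t)" using pos
        proof eventually_elim
          case (elim t)
          show ?case
          proof (cases "t \<in> {- real n..real n} \<and> t \<notin> {-r..r}")
            case True
            then have h: "h t = max 0 (w t - c) - u t" by (simp add: h_def indicator_def)
            show ?thesis
            proof (cases "0 \<le> w t - c")
              case True
              then show ?thesis by (simp add: h max_def algebra_simps)
            next
              case False
              then have "h t = - u t" "(w t - c) * u t \<le> 0" using elim by (auto simp: h max_def mult_nonpos_nonneg)
              then show ?thesis by (simp add: algebra_simps)
            qed
          qed (auto simp: h_def indicator_def)
        qed
      qed
      then show ?thesis by simp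
    qed
    finally have "(\<integral>t. h t * h t \<partial>lebesgue) \<le> 0" by simp
    then have "(L2norm lebesgue h)\<^sup>2 \<le> 0" by (simp add: L2norm_sq) (simp add: power2_eq_square)
    then have "AE t in lebesgue. h t = 0" using L2norm_eq_0_AE[OF hL] by simp
    then show ?thesis by eventually_elim (auto simp: h_def)
  qed
  have sing: "AE t in lebesgue. t \<noteq> x" for x :: real
    using AE_completion[OF AE_lborel_singleton] .
  have "AE t in lebesgue. \<forall>n. t \<in> {- real n..real n} \<longrightarrow> t \<notin> {-r..r} \<longrightarrow> u t = max 0 (w t - c)"
    unfolding AE_all_countable using ev by (rule allI)
  then show ?thesis using sing[of r] sing[of "- r"]
  proof eventually_elim
    case (elim t)
    obtain n where "\<bar>t\<bar> \<le> real n" using real_arch_simple by blast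
    then have "t \<in> {- real n..real n}" by (auto simp: abs_le_iff)
    then show ?case using elim by force
  qed
qed

section \<open>Total variation along Lebesgue points\<close>

text \<open>A density of mass one that sits immediately to the right of \<open>t\<close>. If \<open>v t\<close> is positive, the density is
  dominated by a multiple of \<open>v\<close>, so that a small multiple of it may be subtracted from \<open>v\<close> without
  loss of nonnegativity. The half-open interval makes the primitive vanish up to and including \<open>t\<close>.\<close>

definition bump :: "(real \<Rightarrow> real) \<Rightarrow> real \<Rightarrow> real \<Rightarrow> (real \<Rightarrow> real) \<Rightarrow> bool" where
  "bump v t \<delta> B \<longleftrightarrow> (\<forall>x. 0 \<le> B x) \<and> (\<forall>x. x \<notin> {t<..t + \<delta>} \<longrightarrow> B x = 0) \<and> B \<in> L2 lebesgue \<and>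
     integrable lebesgue B \<and> (\<integral>x. B x \<partial>lebesgue) = 1 \<and> (0 < v t \<longrightarrow> (\<exists>\<kappa>>0. \<forall>x. B x \<le> \<kappa> * v x))"

lemma Lebesgue_points:
  fixes f :: "real \<Rightarrow> real"
  assumes "\<And>a b. set_integrable lebesgue {a..b} f"
  obtains N where "negligible N"
    "\<And>t e. t \<notin> N \<Longrightarrow> 0 < e \<Longrightarrow> \<exists>d>0. \<forall>h. 0 < h \<and> h < d \<longrightarrow> \<bar>integral {t..t + h} f / h - f t\<bar> < e"
proof -
  have int: "f integrable_on cbox a b" for a b
    using set_lebesgue_integral_eq_integral(1)[OF assms[of a b]] by simp
  show ?thesis
  proof (rule integrable_ccontinuous_explicit[OF int])
    fix N assume N: "negligible N"
      and *: "\<And>x e. x \<notin> N \<Longrightarrow> 0 < e \<Longrightarrow> \<exists>d>0. \<forall>h. 0 < h \<and> h < d \<longrightarrow>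
        norm (integral (cbox x (x + h *\<^sub>R One)) f /\<^sub>R h ^ DIM(real) - f x) < e"
    show ?thesis
    proof (rule that[OF N])
      show "\<exists>d>0. \<forall>h. 0 < h \<and> h < d \<longrightarrow> \<bar>integral {t..t + h} f / h - f t\<bar> < e" if "t \<notin> N" "0 < e" for t e
        using *[OF that] by (simp add: divide_inverse mult.commute)
    qed
  qed
qed

lemma Lebesgue_point_small_interval:
  fixes f :: "real \<Rightarrow> real"
  assumes "\<And>e. 0 < e \<Longrightarrow> \<exists>d>0. \<forall>h. 0 < h \<and> h < d \<longrightarrow> \<bar>integral {t..t + h} f / h - f t\<bar> < e"
  shows "((\<lambda>h. integral {t..t + h} f / h) \<longlongrightarrow> f t) (at_right 0)"
proof (rule tendstoI)
  fix e :: real assume "0 < e"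
  then obtain d where d: "0 < d" "\<forall>h. 0 < h \<and> h < d \<longrightarrow> \<bar>integral {t..t + h} f / h - f t\<bar> < e"
    using assms by blast
  show "\<forall>\<^sub>F h in at_right 0. dist (integral {t..t + h} f / h) (f t) < e"
    by (rule eventually_at_rightI[OF _ d(1)]) (use d(2) in \<open>simp add: dist_real_def\<close>)
qed

lemma integral_eq_lebesgue_indicator_Ioc:
  fixes u :: "real \<Rightarrow> real"
  assumes "set_integrable lebesgue {a..b} u"
  shows "integral {a..b} u = (\<integral>x. indicator {a<..b} x * u x \<partial>lebesgue)"
    and "integrable lebesgue (\<lambda>x. indicator {a<..b} x * u x)"
proof -
  have "set_integrable lebesgue {a<..b} u" by (rule set_integrable_subset[OF assms]) auto
  then show int: "integrable lebesgue (\<lambda>x. indicator {a<..b} x * u x)" by (simp add: set_integrable_def)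
  have "AE x in lebesgue. x \<noteq> a" using AE_completion[OF AE_lborel_singleton] .
  then have "(\<integral>x. indicator {a..b} x * u x \<partial>lebesgue) = (\<integral>x. indicator {a<..b} x * u x \<partial>lebesgue)"
    using assms int by (intro integral_cong_AE borel_measurable_integrable)
      (auto simp: set_integrable_def indicator_def elim!: eventually_mono)
  then show "integral {a..b} u = (\<integral>x. indicator {a<..b} x * u x \<partial>lebesgue)"
    by (simp add: integral_eq_lebesgue_indicator[OF assms])
qed

text \<open>If \<open>v t > 0\<close>, take the normalized restriction of \<open>v\<close> to \<open>(t, t + h]\<close>; its pairing with \<open>q\<close> is a
  quotient of averages and tends to \<open>q t * v t / v t\<close> at common Lebesgue points of \<open>v\<close> and \<open>q v\<close>. If
  \<open>v t = 0\<close>, take the normalized indicator of \<open>(t, t + h]\<close>.\<close>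

lemma bump_exists:
  fixes v q :: "real \<Rightarrow> real"
  assumes v: "v \<in> L2 lebesgue" "\<And>x. 0 \<le> v x" and q: "q \<in> borel_measurable lebesgue"
    "\<And>a b. (\<lambda>x. indicator {a..b} x * q x) \<in> L2 lebesgue"
  obtains N where "negligible N"
    "\<And>t \<delta>. t \<notin> N \<Longrightarrow> 0 < \<delta> \<Longrightarrow> \<exists>B. bump v t \<delta> B \<and> \<bar>(\<integral>x. q x * B x \<partial>lebesgue) - q t\<bar> < \<delta>"
proof -
  note vi = L2_set_integrable[OF v(1)]
  have qi: "set_integrable lebesgue {a..b} q" for a b
  proof -
    have "(\<lambda>x. indicator {a..b} x * (indicator {a..b} x * q x)) = (\<lambda>x. indicator {a..b} x * q x)"
      by (auto simp: indicator_def)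
    then show ?thesis using L2_mult_integrable[OF L2_indicator_Icc q(2)[of a b], of a b]
      by (simp add: set_integrable_def)
  qed
  have qvi: "set_integrable lebesgue {a..b} (\<lambda>x. q x * v x)" for a b
    using L2_mult_integrable[OF q(2)[of a b] v(1)] by (simp add: set_integrable_def mult.assoc)
  obtain N1 where N1: "negligible N1"
    "\<And>t e. t \<notin> N1 \<Longrightarrow> 0 < e \<Longrightarrow> \<exists>d>0. \<forall>h. 0 < h \<and> h < d \<longrightarrow> \<bar>integral {t..t + h} v / h - v t\<bar> < e"
    using Lebesgue_points[OF vi] by blast
  obtain N2 where N2: "negligible N2"
    "\<And>t e. t \<notin> N2 \<Longrightarrow> 0 < e \<Longrightarrow> \<exists>d>0. \<forall>h. 0 < h \<and> h < d \<longrightarrow> \<bar>integral {t..t + h} q / h - q t\<bar> < e"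
    using Lebesgue_points[OF qi] by blast
  obtain N3 where N3: "negligible N3"
    "\<And>t e. t \<notin> N3 \<Longrightarrow> 0 < e \<Longrightarrow> \<exists>d>0. \<forall>h. 0 < h \<and> h < d \<longrightarrow>
        \<bar>integral {t..t + h} (\<lambda>x. q x * v x) / h - q t * v t\<bar> < e"
    using Lebesgue_points[OF qvi] by blast
  have "\<exists>B. bump v t \<delta> B \<and> \<bar>(\<integral>x. q x * B x \<partial>lebesgue) - q t\<bar> < \<delta>"
    if t: "t \<notin> N1 \<union> N2 \<union> N3" and \<delta>: "0 < \<delta>" for t \<delta>
  proof -
    have lv: "((\<lambda>h. integral {t..t + h} v / h) \<longlongrightarrow> v t) (at_right 0)"
      by (rule Lebesgue_point_small_interval) (use N1(2) t in auto)
    have lq: "((\<lambda>h. integral {t..t + h} q / h) \<longlongrightarrow> q t) (at_right 0)"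
      by (rule Lebesgue_point_small_interval) (use N2(2) t in auto)
    have lqv: "((\<lambda>h. integral {t..t + h} (\<lambda>x. q x * v x) / h) \<longlongrightarrow> q t * v t) (at_right 0)"
      by (rule Lebesgue_point_small_interval) (use N3(2) t in auto)
    have small: "\<forall>\<^sub>F h in at_right 0. 0 < h \<and> h < \<delta>"
      by (rule eventually_at_rightI[OF _ \<delta>]) simp
    define I where "I h x = (indicator {t<..t + h} x :: real)" for h x
    have IL: "I h \<in> L2 lebesgue" for h
    proof (rule L2_dominated[OF L2_indicator_Icc[of t "t + h"]])
      show "I h \<in> borel_measurable lebesgue" unfolding I_def[abs_def] by (intro borel_measurable_indicator) auto
    qed (auto simp: I_def indicator_def)
    show ?thesis
    proof (cases "0 < v t")
      case True
      have "((\<lambda>h. (integral {t..t + h} (\<lambda>x. q x * v x) / h) / (integral {t..t + h} v / h)) \<longlongrightarrow> q t * v t / v t) (at_right 0)"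
        by (intro tendsto_divide lqv lv) (use True in simp)
      then have "\<forall>\<^sub>F h in at_right 0. dist ((integral {t..t + h} (\<lambda>x. q x * v x) / h) / (integral {t..t + h} v / h)) (q t) < \<delta>"
        using True \<delta> by (intro tendstoD) auto
      moreover have "\<forall>\<^sub>F h in at_right 0. 0 < integral {t..t + h} v / h"
        using order_tendstoD(1)[OF lv True] .
      ultimately have "\<forall>\<^sub>F h in at_right 0. 0 < h \<and> h < \<delta> \<and> 0 < integral {t..t + h} v / h \<and>
          dist ((integral {t..t + h} (\<lambda>x. q x * v x) / h) / (integral {t..t + h} v / h)) (q t) < \<delta>"
        using small by eventually_elim simp
      then obtain h where h: "0 < h" "h < \<delta>" "0 < integral {t..t + h} v / h"
          "dist ((integral {t..t + h} (\<lambda>x. q x * v x) / h) / (integral {t..t + h} v / h)) (q t) < \<delta>"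
        using eventually_happens' [OF trivial_limit_at_right_real[of 0]] by blast
      define k where "k = integral {t..t + h} v"
      have k: "0 < k" using h(1,3) by (simp add: k_def zero_less_divide_iff)
      define B where "B x = I h x * v x / k" for x
      note Iv = integral_eq_lebesgue_indicator_Ioc[OF vi, of t "t + h"]
      have Bi: "integrable lebesgue B" unfolding B_def[abs_def] I_def using Iv(2) by simp
      have "(\<lambda>x. (1 / k) * v x) \<in> L2 lebesgue" by (rule L2_cmult[OF v(1)])
      then have "B \<in> L2 lebesgue"
        by (rule L2_dominated[OF _ borel_measurable_integrable[OF Bi]])
           (use v(2) k in \<open>auto simp: B_def I_def indicator_def\<close>)
      moreover have "(\<integral>x. B x \<partial>lebesgue) = 1"
        using Iv(1) k by (simp add: B_def I_def k_def)
      moreover have "B x \<le> (1 / k) * v x" "0 \<le> B x" for x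
        using v(2)[of x] k by (auto simp: B_def I_def indicator_def)
      moreover have "B x = 0" if "x \<notin> {t<..t + \<delta>}" for x
        using that h(2) by (auto simp: B_def I_def indicator_def)
      ultimately have "bump v t \<delta> B"
        unfolding bump_def using Bi k by (auto intro!: exI[of _ "1 / k"])
      moreover have "(\<integral>x. q x * B x \<partial>lebesgue) = integral {t..t + h} (\<lambda>x. q x * v x) / k"
        unfolding integral_eq_lebesgue_indicator_Ioc(1)[OF qvi] B_def I_def by (simp add: mult_ac)
      ultimately show ?thesis using h(1,4) by (auto simp: k_def dist_real_def)
    next
      case False
      have "\<forall>\<^sub>F h in at_right 0. dist (integral {t..t + h} q / h) (q t) < \<delta>"
        using lq \<delta> by (rule tendstoD)
      then have "\<forall>\<^sub>F h in at_right 0. 0 < h \<and> h < \<delta> \<and> dist (integral {t..t + h} q / h) (q t) < \<delta>"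
        using small by eventually_elim simp
      then obtain h where h: "0 < h" "h < \<delta>" "dist (integral {t..t + h} q / h) (q t) < \<delta>"
        using eventually_happens' [OF trivial_limit_at_right_real[of 0]] by blast
      define B where "B x = I h x * (1 / h)" for x
      have one: "set_integrable lebesgue {t..t + h} (\<lambda>x. 1::real)"
        using L2_mult_integrable[OF L2_indicator_Icc L2_indicator_Icc, of t "t + h" t "t + h"]
        by (simp add: set_integrable_def flip: indicator_inter_arith)
      note I1 = integral_eq_lebesgue_indicator_Ioc[OF one]
      have Bi: "integrable lebesgue B" unfolding B_def[abs_def] I_def using I1(2) by simp
      have "B \<in> L2 lebesgue"
        unfolding B_def[abs_def] using L2_cmult[OF IL, of "1 / h" h] by (simp add: mult.commute)
      moreover have "(\<integral>x. B x \<partial>lebesgue) = 1"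
        using I1(1) h(1) by (simp add: B_def I_def)
      moreover have "0 \<le> B x" for x using h(1) by (simp add: B_def I_def)
      moreover have "B x = 0" if "x \<notin> {t<..t + \<delta>}" for x
        using that h(2) by (auto simp: B_def I_def indicator_def)
      ultimately have "bump v t \<delta> B" unfolding bump_def using Bi False by auto
      moreover have "(\<integral>x. q x * B x \<partial>lebesgue) = integral {t..t + h} q / h"
        unfolding integral_eq_lebesgue_indicator_Ioc(1)[OF qi] B_def I_def by (simp add: mult_ac)
      ultimately show ?thesis using h(3) by (auto simp: dist_real_def)
    qed
  qed
  then show ?thesis using N1(1) N2(1) N3(1) by (intro that[of "N1 \<union> N2 \<union> N3"]) auto
qed

lemma bump_cumulative:
  assumes B: "bump v t \<delta> B" and a: "a \<le> t"
  shows "0 \<le> g_of B s - g_of B a" "g_of B s - g_of B a \<le> 1"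
    and "s \<le> t \<Longrightarrow> g_of B s - g_of B a = 0" "t + \<delta> \<le> s \<Longrightarrow> a \<le> s \<Longrightarrow> g_of B s - g_of B a = 1"
proof -
  have B0: "0 \<le> B x" and supp: "x \<notin> {t<..t + \<delta>} \<Longrightarrow> B x = 0" for x
    using B unfolding bump_def by blast+
  have BL: "B \<in> L2 lebesgue" and Bi: "integrable lebesgue B" and one: "(\<integral>x. B x \<partial>lebesgue) = 1"
    using B unfolding bump_def by blast+
  note si = L2_set_integrable[OF BL]
  have diff: "g_of B y - g_of B x = (\<integral>z. indicator {x..y} z * B z \<partial>lebesgue)" if "x \<le> y" for x y
    using g_of_diff[OF si that] integral_eq_lebesgue_indicator[OF si] by simp
  have int: "integrable lebesgue (\<lambda>z. indicator {x..y} z * B z)" for x y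
    by (rule L2_mult_integrable[OF L2_indicator_Icc BL])
  have zero: "g_of B s - g_of B a = 0" if "s \<le> t"
  proof (cases "a \<le> s")
    case True
    have "(\<lambda>z. indicator {a..s} z * B z) = (\<lambda>z. 0)" using supp that by (auto simp: indicator_def fun_eq_iff)
    then show ?thesis by (simp add: diff[OF True])
  next
    case False
    then have "(\<lambda>z. indicator {s..a} z * B z) = (\<lambda>z. 0)" using supp a by (auto simp: indicator_def fun_eq_iff)
    then show ?thesis using diff[of s a] False by simp
  qed
  then show "s \<le> t \<Longrightarrow> g_of B s - g_of B a = 0" .
  have range: "0 \<le> g_of B s - g_of B a \<and> g_of B s - g_of B a \<le> 1"
  proof (cases "s \<le> t")
    case False
    then have as: "a \<le> s" using a by simp
    have "(\<integral>z. indicator {a..s} z * B z \<partial>lebesgue) \<le> (\<integral>z. B z \<partial>lebesgue)"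
      using B0 by (intro integral_mono int Bi) (auto simp: indicator_def)
    moreover have "0 \<le> (\<integral>z. indicator {a..s} z * B z \<partial>lebesgue)"
      using B0 by (intro integral_nonneg_AE) auto
    ultimately show ?thesis by (simp add: diff[OF as] one)
  qed (use zero in simp)
  then show "0 \<le> g_of B s - g_of B a" "g_of B s - g_of B a \<le> 1" by auto
  show "g_of B s - g_of B a = 1" if "t + \<delta> \<le> s" "a \<le> s"
  proof -
    have "z \<in> {a..s}" if "B z \<noteq> 0" for z
    proof -
      have "z \<in> {t<..t + \<delta>}" using supp that by blast
      then show ?thesis using \<open>t + \<delta> \<le> s\<close> a by simp
    qed
    then have "(\<lambda>z. indicator {a..s} z * B z) = B" by (auto simp: indicator_def fun_eq_iff)
    then show ?thesis by (simp add: diff[OF that(2)] one)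
  qed
qed

lemma g_of_sum:
  assumes "finite A" "\<And>i. i \<in> A \<Longrightarrow> h i \<in> L2 lebesgue"
  shows "(\<lambda>t. \<Sum>i\<in>A. h i t) \<in> L2 lebesgue \<and> g_of (\<lambda>t. \<Sum>i\<in>A. h i t) s = (\<Sum>i\<in>A. g_of (h i) s)"
  using assms
proof (induction rule: finite_induct)
  case empty
  have "set_integrable lebesgue {a..b} (\<lambda>t::real. 0::real)" for a b by (simp add: set_integrable_def)
  then show ?case by (simp add: g_of_eq_integral)
next
  case (insert i A)
  then have "h i \<in> L2 lebesgue" "(\<lambda>t. \<Sum>i\<in>A. h i t) \<in> L2 lebesgue" by auto
  then show ?case
    using insert g_of_add[OF L2_set_integrable L2_set_integrable, of "h i" "\<lambda>t. \<Sum>i\<in>A. h i t" s]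
    by (auto intro!: L2_add)
qed

abbreviation chain :: "nat \<Rightarrow> real set \<Rightarrow> (nat \<Rightarrow> real) \<Rightarrow> bool" where
  "chain n A t \<equiv> (\<forall>i\<le>n. t i \<in> A) \<and> (\<forall>i<n. t i \<le> t (Suc i))"

abbreviation chain_variation :: "(real \<Rightarrow> real) \<Rightarrow> nat \<Rightarrow> (nat \<Rightarrow> real) \<Rightarrow> real" where
  "chain_variation f n t \<equiv> (\<Sum>i<n. \<bar>f (t (Suc i)) - f (t i)\<bar>)"

lemma mono_chain:
  fixes t :: "nat \<Rightarrow> real"
  assumes "\<And>i. i < n \<Longrightarrow> t i \<le> t (Suc i)" "i \<le> j" "j \<le> n"
  shows "t i \<le> t j"
  using assms(2,3)
proof (induction j rule: dec_induct)
  case (step j)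
  then show ?case using assms(1)[of j] by force
qed simp

lemma chain_gap:
  fixes t :: "nat \<Rightarrow> real"
  obtains \<delta> where "0 < \<delta>" "\<And>i. i < n \<Longrightarrow> t i < t (Suc i) \<Longrightarrow> t i + \<delta> \<le> t (Suc i)"
proof -
  define A where "A = insert 1 ((\<lambda>i. t (Suc i) - t i) ` {i. i < n \<and> t i < t (Suc i)})"
  have A: "finite A" "A \<noteq> {}" by (auto simp: A_def)
  have "0 < Min A" using A by (subst Min_gr_iff) (auto simp: A_def)
  moreover have "t i + Min A \<le> t (Suc i)" if "i < n" "t i < t (Suc i)" for i
  proof -
    have "t (Suc i) - t i \<in> A" unfolding A_def using that by blast
    then show ?thesis using Min_le[OF A(1)] by fastforce
  qed
  ultimately show ?thesis using that by blast
qed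

text \<open>Insert \<open>h = \<Sum> \<sigma>\<^sub>i (b\<^sub>i - b\<^sub>i\<^sub>+\<^sub>1)\<close> into the descent bound, where \<open>b\<^sub>i\<close> is a bump next to \<open>t\<^sub>i\<close> and
  \<open>\<sigma>\<^sub>i\<close> is the sign of \<open>v t\<^sub>i\<^sub>+\<^sub>1 - v t\<^sub>i\<close>. When the bumps shrink, the integral of \<open>(v - w) h\<close> tends to
  \<open>\<Sum> \<sigma>\<^sub>i ((v - w) t\<^sub>i - (v - w) t\<^sub>i\<^sub>+\<^sub>1)\<close>, in which the part with \<open>v\<close> is minus the variation of \<open>v\<close>
  along the chain. The primitive of \<open>h\<close> is bounded by \<open>2\<close> for every length of the chain.\<close>

lemma descent_bound_chain_variation:
  fixes v w :: "real \<Rightarrow> real"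
  assumes db: "descent_bound C r v (\<lambda>t. w t - c)" and C: "0 \<le> C"
    and v: "v \<in> L2 lebesgue" "\<And>x. 0 \<le> v x" and w: "w \<in> L2 lebesgue"
  obtains N where "negligible N"
    "\<forall>n t. chain n (- N) t \<longrightarrow> chain_variation v n t \<le> 2 * C + chain_variation w n t"
proof -
  define q where "q t = v t - (w t - c)" for t
  have qL: "(\<lambda>x. indicator {a..b} x * q x) \<in> L2 lebesgue" for a b
  proof -
    have "(\<lambda>x. (v x - w x) + c * indicator {a..b} x) \<in> L2 lebesgue"
      by (intro L2_add L2_diff v w L2_cmult L2_indicator_Icc)
    moreover have "(\<lambda>x. indicator {a..b} x * q x) \<in> borel_measurable lebesgue"
      unfolding q_def using L2_measurable[OF v(1)] L2_measurable[OF w] L2_measurable[OF L2_indicator_Icc[of a b]]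
      by (intro borel_measurable_times borel_measurable_diff borel_measurable_const)
    ultimately show ?thesis by (rule L2_dominated) (auto simp: q_def indicator_def)
  qed
  have qm: "q \<in> borel_measurable lebesgue"
    unfolding q_def[abs_def] using L2_measurable[OF v(1)] L2_measurable[OF w] by simp
  obtain N where N: "negligible N"
    "\<And>t \<delta>. t \<notin> N \<Longrightarrow> 0 < \<delta> \<Longrightarrow> \<exists>B. bump v t \<delta> B \<and> \<bar>(\<integral>x. q x * B x \<partial>lebesgue) - q t\<bar> < \<delta>"
    using bump_exists[OF v qm qL] by blast
  have "chain_variation v n t \<le> 2 * C + chain_variation w n t" if ch: "chain n (- N) t" for n t
  proof -
    have tN: "t i \<notin> N" if "i \<le> n" for i using ch that by blast
    have t: "t i \<le> t (Suc i)" if "i < n" for i using ch that by blast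
    obtain \<delta>0 where \<delta>0: "0 < \<delta>0" "\<And>i. i < n \<Longrightarrow> t i < t (Suc i) \<Longrightarrow> t i + \<delta>0 \<le> t (Suc i)"
      using chain_gap[of n t] by blast
    define \<sigma> where "\<sigma> i = sgn (v (t (Suc i)) - v (t i))" for i
    have approx: "chain_variation v n t \<le> 2 * C + chain_variation w n t + 2 * real n * \<delta>"
      if \<delta>: "0 < \<delta>" "\<delta> \<le> \<delta>0" for \<delta>
    proof -
      obtain B where B: "\<And>x. x \<notin> N \<Longrightarrow> bump v x \<delta> (B x)"
          "\<And>x. x \<notin> N \<Longrightarrow> \<bar>(\<integral>z. q z * B x z \<partial>lebesgue) - q x\<bar> < \<delta>"
        using N(2)[OF _ \<delta>(1)] by metis
      define b where "b i = B (t i)" for i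
      have b: "bump v (t i) \<delta> (b i)" "\<bar>(\<integral>z. q z * b i z \<partial>lebesgue) - q (t i)\<bar> < \<delta>" if "i \<le> n" for i
        using B tN[OF that] by (auto simp: b_def)
      have bL: "b i \<in> L2 lebesgue" "integrable lebesgue (b i)" "\<And>x. 0 \<le> b i x" if "i \<le> n" for i
        using b(1)[OF that] by (auto simp: bump_def)
      have qb: "integrable lebesgue (\<lambda>z. q z * b i z)" if "i \<le> n" for i
      proof -
        have "integrable lebesgue (\<lambda>z. (v z - w z) * b i z + c * b i z)"
          using L2_mult_integrable[OF L2_diff[OF v(1) w] bL(1)[OF that]] bL(2)[OF that] by simp
        then show ?thesis by (simp add: q_def algebra_simps)
      qed
      define h where "h x = (\<Sum>i<n. \<sigma> i * (b i x - b (Suc i) x))" for x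
      have sL: "(\<lambda>x. \<sigma> i * (b i x - b (Suc i) x)) \<in> L2 lebesgue" if "i < n" for i
        using that by (intro L2_cmult L2_diff bL) auto
      have hL: "h \<in> L2 lebesgue"
        unfolding h_def[abs_def] using g_of_sum[of "{..<n}" "\<lambda>i x. \<sigma> i * (b i x - b (Suc i) x)"] sL by simp
      have hi: "integrable lebesgue h"
        unfolding h_def[abs_def] using bL(2)
        by (intro Bochner_Integration.integrable_sum integrable_mult_right Bochner_Integration.integrable_diff) auto
      \<comment> \<open>Of the two bumps in a summand, the one that enters with a minus sign sits where \<open>v\<close> is larger,
        hence positive, and is dominated by a multiple of \<open>v\<close>.\<close>
      have "\<exists>k\<ge>0. \<forall>x. - (k * v x) \<le> \<sigma> i * (b i x - b (Suc i) x)" if i: "i < n" for i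
      proof -
        have i': "i \<le> n" "Suc i \<le> n" using i by auto
        consider "v (t i) < v (t (Suc i))" | "v (t (Suc i)) < v (t i)" | "v (t i) = v (t (Suc i))" by linarith
        then show ?thesis
        proof cases
          case 1
          then have "0 < v (t (Suc i))" using v(2)[of "t i"] by linarith
          then obtain k where k: "0 < k" "\<forall>x. b (Suc i) x \<le> k * v x"
            using b(1)[OF i'(2)] by (auto simp: bump_def)
          have "- (k * v x) \<le> b i x - b (Suc i) x" for x using k(2)[rule_format, of x] bL(3)[OF i'(1), of x] by linarith
          then show ?thesis using 1 k(1) by (intro exI[of _ k]) (simp add: \<sigma>_def)
        next
          case 2
          then have "0 < v (t i)" using v(2)[of "t (Suc i)"] by linarith
          then obtain k where k: "0 < k" "\<forall>x. b i x \<le> k * v x"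
            using b(1)[OF i'(1)] by (auto simp: bump_def)
          have "- (k * v x) \<le> b (Suc i) x - b i x" for x
            using k(2)[rule_format, of x] bL(3)[OF i'(2), of x] by linarith
          moreover have "\<sigma> i = -1" using 2 by (simp add: \<sigma>_def)
          ultimately show ?thesis using k(1) by (intro exI[of _ k]) simp
        next
          case 3
          then show ?thesis by (intro exI[of _ 0]) (simp add: \<sigma>_def)
        qed
      qed
      then obtain k where k: "\<And>i. i < n \<Longrightarrow> 0 \<le> k i" "\<And>i x. i < n \<Longrightarrow> - (k i * v x) \<le> \<sigma> i * (b i x - b (Suc i) x)"
        by metis
      define K where "K = 1 + (\<Sum>i<n. k i)"
      have K: "0 < K" using sum_nonneg[of "{..<n}" k] k(1) by (simp add: K_def add_pos_nonneg)
      have hK: "0 \<le> v x + (1 / K) * h x" for x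
      proof -
        have "(\<Sum>i<n. - (k i * v x)) \<le> h x" unfolding h_def using k(2) by (intro sum_mono) auto
        then have "- (K * v x) \<le> h x" using v(2)[of x] by (simp add: K_def sum_negf sum_distrib_right distrib_right)
        then show ?thesis using K by (simp add: field_simps)
      qed
      \<comment> \<open>The primitives \<open>\<beta> i\<close> are steps from \<open>0\<close> to \<open>1\<close> that start one after the other, so they decrease in
        \<open>i\<close> and the sum of their differences telescopes.\<close>
      define \<beta> where "\<beta> i s = g_of (b i) s - g_of (b i) (t 0)" for i s
      have t0: "t 0 \<le> t i" if "i \<le> n" for i using mono_chain[of n t 0 i] t that by auto
      have \<beta>01: "0 \<le> \<beta> i s" "\<beta> i s \<le> 1" if "i \<le> n" for i s
        using bump_cumulative(1,2)[OF b(1)[OF that] t0[OF that]] by (auto simp: \<beta>_def)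
      have \<beta>_mono: "\<beta> (Suc i) s \<le> \<beta> i s" if i: "i < n" for i s
      proof (cases "t i = t (Suc i)")
        case True
        then show ?thesis by (simp add: \<beta>_def b_def)
      next
        case False
        have i': "i \<le> n" "Suc i \<le> n" using i by auto
        have gap: "t i + \<delta> \<le> t (Suc i)" using \<delta>0(2)[OF i] t[OF i] False \<delta>(2) by simp
        show ?thesis
        proof (cases "s \<le> t (Suc i)")
          case True
          then show ?thesis
            using bump_cumulative(3)[OF b(1)[OF i'(2)] t0[OF i'(2)]] \<beta>01(1)[OF i'(1)] by (simp add: \<beta>_def)
        next
          case False
          then have "\<beta> i s = 1"
            using bump_cumulative(4)[OF b(1)[OF i'(1)] t0[OF i'(1)], of s] gap t0[OF i'(2)] by (simp add: \<beta>_def)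
          then show ?thesis using \<beta>01(2)[OF i'(2)] by simp
        qed
      qed
      have gh: "g_of h s - g_of h (t 0) = (\<Sum>i<n. \<sigma> i * (\<beta> i s - \<beta> (Suc i) s))" for s
      proof -
        have "g_of (\<lambda>x. \<sigma> i * (b i x - b (Suc i) x)) s = \<sigma> i * (g_of (b i) s - g_of (b (Suc i)) s)" if "i < n" for i s
        proof -
          have 1: "b i \<in> L2 lebesgue" "(\<lambda>x. (-1) * b (Suc i) x) \<in> L2 lebesgue" "b (Suc i) \<in> L2 lebesgue"
            using bL(1)[of i] bL(1)[of "Suc i"] that by (auto intro: L2_uminus)
          have "g_of (\<lambda>x. b i x + (-1) * b (Suc i) x) s = g_of (b i) s + (-1) * g_of (b (Suc i)) s"
            by (simp only: g_of_add[OF L2_set_integrable[OF 1(1)] L2_set_integrable[OF 1(2)]]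
                g_of_cmult[OF L2_set_integrable[OF 1(3)]])
          then show ?thesis
            using g_of_cmult[OF L2_set_integrable[OF L2_diff[OF 1(1) 1(3)]], of "\<sigma> i" s] by simp
        qed
        then have "g_of h s = (\<Sum>i<n. \<sigma> i * (g_of (b i) s - g_of (b (Suc i)) s))" for s
          unfolding h_def[abs_def]
          using g_of_sum[of "{..<n}" "\<lambda>i x. \<sigma> i * (b i x - b (Suc i) x)" s] sL by simp
        then show ?thesis by (simp add: \<beta>_def sum_subtractf[symmetric] algebra_simps)
      qed
      have gh1: "\<bar>g_of h s - g_of h (t 0)\<bar> \<le> 1" for s
      proof -
        have "\<bar>\<Sum>i<n. \<sigma> i * (\<beta> i s - \<beta> (Suc i) s)\<bar> \<le> (\<Sum>i<n. \<beta> i s - \<beta> (Suc i) s)"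
        proof (rule order_trans[OF sum_abs sum_mono])
          fix i assume "i \<in> {..<n}"
          then have "0 \<le> \<beta> i s - \<beta> (Suc i) s" using \<beta>_mono by simp
          moreover have "\<bar>\<sigma> i\<bar> \<le> 1" by (simp add: \<sigma>_def sgn_if)
          ultimately show "\<bar>\<sigma> i * (\<beta> i s - \<beta> (Suc i) s)\<bar> \<le> \<beta> i s - \<beta> (Suc i) s"
            by (simp add: abs_mult mult_left_le_one_le)
        qed
        also have "\<dots> = \<beta> 0 s - \<beta> n s" by (rule sum_lessThan_telescope')
        also have "\<dots> \<le> 1" using \<beta>01(2)[of 0 s] \<beta>01(1)[of n s] by simp
        finally show ?thesis by (simp add: gh)
      qed
      have g0: "g_of h 0 = 0" by (simp add: g_of_eq_integral[OF L2_set_integrable[OF hL]])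
      \<comment> \<open>Twice the previous bound, because the primitive \<open>g_of h\<close> is normalized at \<open>0\<close> rather than at \<open>t 0\<close>.\<close>
      have gh2: "\<bar>g_of h s\<bar> \<le> 2" for s using gh1[of s] gh1[of 0] g0 by linarith
      have "0 \<le> (\<integral>x. (v x - (w x - c)) * ((1 / K) * h x) \<partial>lebesgue) + C * (2 / K)"
      proof (rule db[unfolded descent_bound_def, rule_format])
        show "(\<lambda>x. (1 / K) * h x) \<in> L2 lebesgue" by (rule L2_cmult[OF hL])
        show "integrable lebesgue (\<lambda>x. (1 / K) * h x)" using hi by (rule integrable_mult_right)
        show "AE x in lebesgue. 0 \<le> v x + (1 / K) * h x" using hK by (intro AE_I2) auto
        show "0 \<le> 2 / K" using K by simp
        show "\<bar>g_of (\<lambda>x. (1 / K) * h x) s\<bar> \<le> 2 / K" for s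
          using gh2[of s] K unfolding g_of_cmult[OF L2_set_integrable[OF hL]] abs_mult
          by (simp add: divide_right_mono)
      qed
      moreover have "(\<integral>x. (v x - (w x - c)) * ((1 / K) * h x) \<partial>lebesgue) = (1 / K) * (\<integral>x. q x * h x \<partial>lebesgue)"
        by (simp add: q_def)
      ultimately have "0 \<le> (1 / K) * (\<integral>x. q x * h x \<partial>lebesgue) + C * (2 / K)" by (simp only:)
      also have "\<dots> = ((\<integral>x. q x * h x \<partial>lebesgue) + 2 * C) / K" by (simp add: add_divide_distrib)
      finally have A: "0 \<le> (\<integral>x. q x * h x \<partial>lebesgue) + 2 * C" using K by (simp add: zero_le_divide_iff)
      have "(\<integral>x. q x * h x \<partial>lebesgue) = (\<Sum>i<n. \<sigma> i * ((\<integral>x. q x * b i x \<partial>lebesgue) - (\<integral>x. q x * b (Suc i) x \<partial>lebesgue)))"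
      proof -
        have "(\<lambda>x. q x * h x) = (\<lambda>x. \<Sum>i<n. \<sigma> i * (q x * b i x - q x * b (Suc i) x))"
          by (auto simp: h_def sum_distrib_left algebra_simps)
        then show ?thesis using qb by simp
      qed
      also have "\<dots> \<le> (\<Sum>i<n. - \<bar>v (t (Suc i)) - v (t i)\<bar> + \<bar>w (t (Suc i)) - w (t i)\<bar> + 2 * \<delta>)"
      proof (rule sum_mono)
        fix i assume "i \<in> {..<n}"
        then have i': "i \<le> n" "Suc i \<le> n" by auto
        let ?Q = "\<lambda>i. \<integral>x. q x * b i x \<partial>lebesgue"
        have s1: "\<bar>\<sigma> i\<bar> \<le> 1" by (simp add: \<sigma>_def sgn_if)
        have le: "\<sigma> i * x \<le> \<bar>x\<bar>" for x
          using s1 mult_left_le_one_le[of "\<bar>x\<bar>" "\<bar>\<sigma> i\<bar>"] abs_ge_self[of "\<sigma> i * x"] by (simp add: abs_mult)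
        have "\<sigma> i * (v (t i) - v (t (Suc i))) = - \<bar>v (t (Suc i)) - v (t i)\<bar>"
          by (auto simp: \<sigma>_def sgn_if)
        moreover have "\<sigma> i * (w (t (Suc i)) - w (t i)) \<le> \<bar>w (t (Suc i)) - w (t i)\<bar>" by (rule le)
        moreover have "\<sigma> i * ((?Q i - q (t i)) - (?Q (Suc i) - q (t (Suc i)))) \<le> 2 * \<delta>"
          using le[of "(?Q i - q (t i)) - (?Q (Suc i) - q (t (Suc i)))"] b(2)[OF i'(1)] b(2)[OF i'(2)] by linarith
        moreover have "\<sigma> i * (?Q i - ?Q (Suc i)) = \<sigma> i * (v (t i) - v (t (Suc i))) + \<sigma> i * (w (t (Suc i)) - w (t i))
            + \<sigma> i * ((?Q i - q (t i)) - (?Q (Suc i) - q (t (Suc i))))"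
          by (simp add: q_def algebra_simps)
        ultimately show "\<sigma> i * (?Q i - ?Q (Suc i)) \<le> - \<bar>v (t (Suc i)) - v (t i)\<bar> + \<bar>w (t (Suc i)) - w (t i)\<bar> + 2 * \<delta>"
          by linarith
      qed
      also have "\<dots> = - chain_variation v n t + chain_variation w n t + 2 * real n * \<delta>"
        by (simp add: sum.distrib sum_subtractf)
      finally show ?thesis using A by linarith
    qed
    have "((\<lambda>\<delta>. 2 * C + chain_variation w n t + 2 * real n * \<delta>)
        \<longlongrightarrow> 2 * C + chain_variation w n t + 2 * real n * 0) (at_right 0)"
      by (intro tendsto_intros)
    moreover have "\<forall>\<^sub>F \<delta> in at_right 0. chain_variation v n t
        \<le> 2 * C + chain_variation w n t + 2 * real n * \<delta>"
      by (rule eventually_at_rightI[OF _ \<delta>0(1)]) (use approx in auto)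
    ultimately show ?thesis
      using tendsto_lowerbound[OF _ _ trivial_limit_at_right_real] by fastforce
  qed
  then show ?thesis by (intro that[OF N(1)]) blast
qed

section \<open>From Lebesgue points to a representative\<close>

lemma negligible_if_AE:
  assumes "AE t in lebesgue. t \<notin> A" shows "negligible (A :: real set)"
proof -
  obtain N where "N \<in> null_sets lebesgue" "A \<subseteq> N" using assms by (auto simp: eventually_ae_filter)
  then show ?thesis using null_sets_completion_subset[of A N lborel] by (simp add: negligible_iff_null_sets)
qed

lemma conull_interval_meets:
  fixes D :: "real set"
  assumes "negligible ({-r<..<r} - D)" "-r \<le> a" "b \<le> r" "a < b"
  obtains x where "x \<in> D" "a < x" "x < b"
proof -
  have "\<not> {a<..<b} \<subseteq> {-r<..<r} - D"
    using negligible_subset[OF assms(1)] open_not_negligible[of "{a<..<b}"] assms(4) by auto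
  then show ?thesis using assms(2,3) that by force
qed

text \<open>A bounded function on a dense set has cluster values everywhere; on the set itself the value of the
  function is one of them.\<close>

lemma cluster_value_exists:
  fixes v :: "real \<Rightarrow> real"
  assumes r: "0 < r" and D: "negligible ({-r<..<r} - D)" and v: "\<And>x. x \<in> D \<Longrightarrow> \<bar>v x\<bar> \<le> b" and t: "t \<in> {-r..r}"
  shows "\<exists>l. (t \<in> D \<longrightarrow> l = v t) \<and> (\<forall>\<delta>>0. \<exists>x\<in>D. \<bar>x - t\<bar> < \<delta> \<and> \<bar>v x - l\<bar> < \<delta>)"
proof (cases "t \<in> D")
  case True
  then show ?thesis by (intro exI[of _ "v t"]) (auto intro!: bexI[of _ t])
next
  case False
  have "\<exists>x\<in>D. \<bar>x - t\<bar> < 1 / (real k + 1)" for k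
  proof -
    define e where "e = 1 / (real k + 1)"
    have e: "0 < e" by (simp add: e_def)
    have "max (- r) (t - e) < min r (t + e)" using r t e by auto
    then obtain x where "x \<in> D" "max (- r) (t - e) < x" "x < min r (t + e)"
      using conull_interval_meets[OF D, of "max (- r) (t - e)" "min r (t + e)"] by auto
    then show ?thesis unfolding e_def[symmetric] by (intro bexI[of _ x]) (auto simp: abs_less_iff)
  qed
  then obtain x where x: "\<And>k. x k \<in> D" "\<And>k. \<bar>x k - t\<bar> < 1 / (real k + 1)" by metis
  have "seq_compact {-b..b}" by (simp add: compact_imp_seq_compact)
  moreover have "\<forall>k. v (x k) \<in> {-b..b}" using v[OF x(1)] by (auto simp: abs_le_iff) (smt (verit))
  ultimately obtain l s where s: "strict_mono (s :: nat \<Rightarrow> nat)" "((\<lambda>k. v (x k)) \<circ> s) \<longlonglongrightarrow> l"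
    unfolding seq_compact_def by metis
  have "\<exists>y\<in>D. \<bar>y - t\<bar> < \<delta> \<and> \<bar>v y - l\<bar> < \<delta>" if \<delta>: "0 < \<delta>" for \<delta>
  proof -
    obtain n where n: "1 / (real n + 1) < \<delta>"
      using reals_Archimedean[OF \<delta>] by (auto simp: inverse_eq_divide add.commute)
    have "\<forall>\<^sub>F k in sequentially. dist (v (x (s k))) l < \<delta>"
      using tendstoD[OF s(2) \<delta>] by simp
    then obtain N where N: "\<And>k. k \<ge> N \<Longrightarrow> dist (v (x (s k))) l < \<delta>" by (auto simp: eventually_sequentially)
    define k where "k = s (max n N)"
    have "n \<le> k" using seq_suble[OF s(1), of "max n N"] by (simp add: k_def)
    then have "1 / (real k + 1) \<le> 1 / (real n + 1)" by (intro divide_left_mono) auto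
    then have "\<bar>x k - t\<bar> < \<delta>" using x(2)[of k] n by linarith
    moreover have "\<bar>v (x k) - l\<bar> < \<delta>" using N[of "max n N"] by (simp add: k_def dist_real_def)
    ultimately show ?thesis using x(1) by blast
  qed
  then show ?thesis using False by blast
qed

text \<open>Each \<open>w t\<close> is a cluster value of \<open>v\<close> at \<open>t\<close>, hence nearly attained by \<open>v\<close> at points of \<open>D\<close> near \<open>t\<close>.
  A chain for \<open>w\<close> can therefore be moved into \<open>D\<close>, and kept in any open set that contains it, at an
  arbitrarily small cost in variation; the cost \<open>1\<close> is enough for what follows.\<close>

lemma conull_extension:
  fixes v :: "real \<Rightarrow> real"
  assumes r: "0 < r" and D: "negligible ({-r<..<r} - D)" "D \<subseteq> {-r..r}" and v: "\<And>x. x \<in> D \<Longrightarrow> \<bar>v x\<bar> \<le> b"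
  obtains w where "\<forall>x\<in>D. w x = v x"
    "\<forall>n t U. open U \<longrightarrow> chain n ({-r..r} \<inter> U) t \<longrightarrow>
      (\<exists>t'. chain n (D \<inter> U) t' \<and> chain_variation w n t \<le> chain_variation v n t' + 1)"
proof -
  have "\<forall>t\<in>{-r..r}. \<exists>l. (t \<in> D \<longrightarrow> l = v t) \<and> (\<forall>\<delta>>0. \<exists>x\<in>D. \<bar>x - t\<bar> < \<delta> \<and> \<bar>v x - l\<bar> < \<delta>)"
    by (intro ballI cluster_value_exists[OF r D(1) v])
  from bchoice[OF this] obtain w where w: "\<forall>t\<in>{-r..r}. (t \<in> D \<longrightarrow> w t = v t) \<and> (\<forall>\<delta>>0. \<exists>x\<in>D. \<bar>x - t\<bar> < \<delta> \<and> \<bar>v x - w t\<bar> < \<delta>)"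
    by (rule exE)
  show ?thesis
  proof (rule that)
    show "\<forall>x\<in>D. w x = v x" using w D(2) by blast
    show "\<forall>n t U. open U \<longrightarrow> chain n ({-r..r} \<inter> U) t \<longrightarrow>
      (\<exists>t'. chain n (D \<inter> U) t' \<and> chain_variation w n t \<le> chain_variation v n t' + 1)"
    proof (intro allI impI)
      fix n :: nat and t :: "nat \<Rightarrow> real" and U
      assume U: "open U" and ch: "chain n ({-r..r} \<inter> U) t"
      have tU: "t i \<in> {-r..r} \<inter> U" if "i \<le> n" for i using ch that by blast
      have t: "t i \<le> t (Suc i)" if "i < n" for i using ch that by blast
      obtain \<delta>0 where \<delta>0: "0 < \<delta>0" "\<And>i. i < n \<Longrightarrow> t i < t (Suc i) \<Longrightarrow> t i + \<delta>0 \<le> t (Suc i)"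
        using chain_gap[of n t] by blast
      have "compact (t ` {..n})" "t ` {..n} \<subseteq> U" using tU by (auto intro: finite_imp_compact)
      then obtain e where e: "0 < e" "(\<Union>x\<in>t ` {..n}. ball x e) \<subseteq> U"
        using compact_subset_open_imp_ball_epsilon_subset[OF _ U] by metis
      \<comment> \<open>The error is \<open>2 * \<eta>\<close> per step, at most \<open>1\<close> in total; displacements below half the smallest gap keep
      the order of the chain.\<close>
      define \<eta> where "\<eta> = 1 / (2 * (real n + 1))"
      define \<delta> where "\<delta> = min (\<delta>0 / 2) (min e \<eta>)"
      have \<delta>: "0 < \<delta>" "\<delta> \<le> \<delta>0 / 2" "\<delta> \<le> e" "\<delta> \<le> \<eta>" using \<delta>0(1) e(1) by (auto simp: \<delta>_def \<eta>_def)
      have "\<forall>x\<in>{-r..r}. \<exists>y. y \<in> D \<and> \<bar>y - x\<bar> < \<delta> \<and> \<bar>v y - w x\<bar> < \<delta>" using w \<delta>(1) by blast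
      from bchoice[OF this] obtain T
        where T: "\<forall>x\<in>{-r..r}. T x \<in> D \<and> \<bar>T x - x\<bar> < \<delta> \<and> \<bar>v (T x) - w x\<bar> < \<delta>"
        by (rule exE)
      \<comment> \<open>The displacement depends on the point only, so repeated points of the chain stay equal.\<close>
      define t' where "t' i = T (t i)" for i
      have t': "t' i \<in> D" "\<bar>t' i - t i\<bar> < \<delta>" "\<bar>v (t' i) - w (t i)\<bar> < \<delta>" if "i \<le> n" for i
        using T[rule_format, of "t i"] tU[OF that] by (auto simp: t'_def)
      have "t' i \<in> U" if "i \<le> n" for i
      proof -
        have "t' i \<in> ball (t i) e" using t'(2)[OF that] \<delta>(3) by (simp add: dist_real_def)
        then show ?thesis using e(2) that by blast
    qed
    moreover have "t' i \<le> t' (Suc i)" if i: "i < n" for i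
    proof (cases "t i = t (Suc i)")
      case False
      then have "t i + \<delta>0 \<le> t (Suc i)" using \<delta>0(2)[OF i] t[OF i] by simp
      then show ?thesis using t'(2)[of i] t'(2)[of "Suc i"] i \<delta>(2) by linarith
    qed (simp add: t'_def)
    moreover have "chain_variation w n t \<le> chain_variation v n t' + 1"
    proof -
      have "chain_variation w n t \<le> (\<Sum>i<n. \<bar>v (t' (Suc i)) - v (t' i)\<bar> + 2 * \<eta>)"
      proof (rule sum_mono)
        fix i assume "i \<in> {..<n}"
        then show "\<bar>w (t (Suc i)) - w (t i)\<bar> \<le> \<bar>v (t' (Suc i)) - v (t' i)\<bar> + 2 * \<eta>"
          using t'(3)[of i] t'(3)[of "Suc i"] \<delta>(4) by simp
      qed
      also have "\<dots> = chain_variation v n t' + real n * (2 * \<eta>)" by (simp add: sum.distrib)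
      also have "real n * (2 * \<eta>) \<le> 1" by (simp add: \<eta>_def field_simps)
      finally show ?thesis by simp
    qed
    ultimately show "\<exists>t'. chain n (D \<inter> U) t' \<and> chain_variation w n t \<le> chain_variation v n t' + 1"
      using t'(1) by (intro exI[of _ t']) auto
    qed
  qed
qed

lemma right_limit_of_Cauchy:
  fixes w :: "real \<Rightarrow> real"
  assumes "\<And>e. 0 < e \<Longrightarrow> \<exists>d>a. \<forall>x\<in>{a<..<d}. \<forall>y\<in>{a<..<d}. \<bar>w x - w y\<bar> \<le> e"
  shows "\<exists>l. (w \<longlongrightarrow> l) (at_right a)"
proof -
  define x where "x k = a + 1 / (real k + 1)" for k
  have xl: "x \<longlonglongrightarrow> a"
  proof -
    have "x \<longlonglongrightarrow> a + 0" unfolding x_def[abs_def]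
      using LIMSEQ_inverse_real_of_nat by (intro tendsto_intros) (simp add: inverse_eq_divide add.commute)
    then show ?thesis by simp
  qed
  have ev: "\<exists>N. \<forall>k\<ge>N. x k \<in> {a<..<d}" if "a < d" for d
    using order_tendstoD(2)[OF xl that] by (auto simp: eventually_sequentially x_def)
  have "Cauchy (\<lambda>k. w (x k))"
  proof (rule metric_CauchyI)
    fix e :: real assume e: "0 < e"
    then obtain d where d: "a < d" "\<forall>x\<in>{a<..<d}. \<forall>y\<in>{a<..<d}. \<bar>w x - w y\<bar> \<le> e / 2"
      using assms[of "e / 2"] by auto
    obtain N where "\<forall>k\<ge>N. x k \<in> {a<..<d}" using ev[OF d(1)] by blast
    then have "dist (w (x i)) (w (x j)) < e" if "i \<ge> N" "j \<ge> N" for i j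
      using d(2)[rule_format, of "x i" "x j"] that e by (simp add: dist_real_def)
    then show "\<exists>N. \<forall>i\<ge>N. \<forall>j\<ge>N. dist (w (x i)) (w (x j)) < e" by blast
  qed
  then obtain l where l: "(\<lambda>k. w (x k)) \<longlonglongrightarrow> l" using Cauchy_convergent convergent_def by blast
  have "(w \<longlongrightarrow> l) (at_right a)"
  proof (rule tendstoI)
    fix e :: real assume e: "0 < e"
    then obtain d where d: "a < d" "\<forall>x\<in>{a<..<d}. \<forall>y\<in>{a<..<d}. \<bar>w x - w y\<bar> \<le> e / 2"
      using assms[of "e / 2"] by auto
    obtain N where N: "\<forall>k\<ge>N. x k \<in> {a<..<d}" using ev[OF d(1)] by blast
    have "dist (w y) l < e" if y: "y \<in> {a<..<d}" for y
    proof -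
      have "(\<lambda>k. \<bar>w y - w (x k)\<bar>) \<longlonglongrightarrow> \<bar>w y - l\<bar>" by (intro tendsto_intros l)
      moreover have "\<forall>k\<ge>N. \<bar>w y - w (x k)\<bar> \<le> e / 2" using d(2) N y by blast
      ultimately have "\<bar>w y - l\<bar> \<le> e / 2" by (intro LIMSEQ_le_const2) auto
      then show ?thesis using e by (simp add: dist_real_def)
    qed
    then show "\<forall>\<^sub>F y in at_right a. dist (w y) l < e" by (intro eventually_at_rightI[OF _ d(1)])
  qed
  then show ?thesis by blast
qed

text \<open>The variation of \<open>w\<close> along a chain of \<open>n\<close> steps in an interval where \<open>m\<close> oscillates by at most \<open>e\<close>
  is bounded by \<open>c + n e\<close>. This is the form in which the regularity of a regulated \<open>m\<close> is passed on.\<close>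

definition chain_controlled :: "real \<Rightarrow> real \<Rightarrow> real \<Rightarrow> (real \<Rightarrow> real) \<Rightarrow> (real \<Rightarrow> real) \<Rightarrow> bool" where
  "chain_controlled a b c m w \<longleftrightarrow> (\<forall>a' b' e n t. a \<le> a' \<longrightarrow> b' \<le> b \<longrightarrow>
     (\<forall>x\<in>{a'<..<b'}. \<forall>y\<in>{a'<..<b'}. \<bar>m x - m y\<bar> \<le> e) \<longrightarrow>
     (\<forall>i\<le>n. t i \<in> {a'<..<b'}) \<longrightarrow> (\<forall>i<n. t i \<le> t (Suc i)) \<longrightarrow>
     chain_variation w n t \<le> c + real (n::nat) * e)"

text \<open>If the Cauchy criterion fails for some \<open>e\<close>, then every right neighbourhood of \<open>a\<close> contains a pair of
  points at which \<open>w\<close> differs by more than \<open>e\<close>. Collecting \<open>N\<close> such pairs, each to the left of the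
  previous one, yields chains of at most \<open>2 N\<close> steps with variation at least \<open>N e\<close>. Near \<open>a\<close> the
  function \<open>m\<close> oscillates by at most \<open>e / 4\<close>, so the variation is at most \<open>c + N e / 2\<close>; this fails for
  large \<open>N\<close>.\<close>

lemma chain_controlled_right_limit:
  fixes w m :: "real \<Rightarrow> real"
  assumes ab: "a < b" and ctrl: "chain_controlled a b c m w" and lim: "(m \<longlongrightarrow> l) (at_right a)"
  shows "\<exists>l. (w \<longlongrightarrow> l) (at_right a)"
proof (rule right_limit_of_Cauchy, rule ccontr)
  fix e :: real assume e: "0 < e"
    and neg: "\<not> (\<exists>d>a. \<forall>x\<in>{a<..<d}. \<forall>y\<in>{a<..<d}. \<bar>w x - w y\<bar> \<le> e)"
  have osc: "\<exists>x y. a < x \<and> x < y \<and> y < d \<and> e < \<bar>w y - w x\<bar>" if d: "a < d" for d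
  proof -
    have "\<exists>x\<in>{a<..<d}. \<exists>y\<in>{a<..<d}. e < \<bar>w x - w y\<bar>" using neg d by (meson not_le)
    then obtain x y where xy: "x \<in> {a<..<d}" "y \<in> {a<..<d}" "e < \<bar>w x - w y\<bar>" by blast
    then have "x \<noteq> y" using e by auto
    then consider "x < y" | "y < x" by linarith
    then show ?thesis
    proof cases
      case 1
      then show ?thesis using xy by (intro exI[of _ x] exI[of _ y]) (auto simp: abs_minus_commute)
    next
      case 2
      then show ?thesis using xy by (intro exI[of _ y] exI[of _ x]) auto
    qed
  qed
  have "\<forall>\<^sub>F x in at_right a. dist (m x) l < e / 8" using lim e by (intro tendstoD) auto
  then obtain b0 where b0: "a < b0" "\<And>x. a < x \<Longrightarrow> x < b0 \<Longrightarrow> dist (m x) l < e / 8"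
    unfolding eventually_at_right_field by blast
  define b1 where "b1 = min b b0"
  have b1: "a < b1" "b1 \<le> b" using ab b0(1) by (auto simp: b1_def)
  \<comment> \<open>Over at most \<open>2 N\<close> steps this costs at most \<open>N e / 2\<close>, half of what \<open>N\<close> pairs contribute.\<close>
  have mosc: "\<bar>m x - m y\<bar> \<le> e / 4" if "x \<in> {a<..<b1}" "y \<in> {a<..<b1}" for x y
  proof -
    have "\<bar>m x - l\<bar> < e / 8" "\<bar>m y - l\<bar> < e / 8"
      using b0(2)[of x] b0(2)[of y] that by (auto simp: b1_def dist_real_def)
    then show ?thesis by linarith
  qed
  have chain: "\<exists>n t. n \<le> 2 * N \<and> (\<forall>i\<le>n. t i \<in> {a<..<d}) \<and> (\<forall>i<n. t i \<le> t (Suc i)) \<and>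
      real N * e \<le> chain_variation w n t" if "a < d" for N and d :: real
    using that
  proof (induction N arbitrary: d)
    case 0
    then obtain x where "a < x" "x < d" using dense by blast
    then show ?case by (intro exI[of _ 0] exI[of _ "\<lambda>_. x"]) auto
  next
    case (Suc N)
    obtain x y where xy: "a < x" "x < y" "y < d" "e < \<bar>w y - w x\<bar>" using osc[OF Suc.prems] by blast
    obtain n t where nt: "n \<le> 2 * N" "\<forall>i\<le>n. t i \<in> {a<..<x}" "\<forall>i<n. t i \<le> t (Suc i)"
        "real N * e \<le> chain_variation w n t"
      using Suc.IH[OF xy(1)] by blast
    define t' where "t' i = (if i \<le> n then t i else if i = Suc n then x else y)" for i
    have "(\<Sum>i<Suc (Suc n). \<bar>w (t' (Suc i)) - w (t' i)\<bar>)
        = chain_variation w n t + \<bar>w x - w (t n)\<bar> + \<bar>w y - w x\<bar>"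
      by (simp add: t'_def)
    then have "real (Suc N) * e \<le> (\<Sum>i<Suc (Suc n). \<bar>w (t' (Suc i)) - w (t' i)\<bar>)"
      using nt(4) xy(4) by (simp add: distrib_right)
    moreover have "t' i \<in> {a<..<d}" if "i \<le> Suc (Suc n)" for i
      using nt(2) xy that unfolding t'_def by (cases "i \<le> n") force+
    moreover have "t' i \<le> t' (Suc i)" if "i < Suc (Suc n)" for i
    proof -
      consider "i < n" | "i = n" | "i = Suc n" using \<open>i < Suc (Suc n)\<close> by linarith
      then show ?thesis
      proof cases
        case 2
        then show ?thesis using nt(2)[rule_format, of n] by (simp add: t'_def)
      qed (use nt(3) xy in \<open>auto simp: t'_def\<close>)
    qed
    ultimately show ?case using nt(1) by (intro exI[of _ "Suc (Suc n)"] exI[of _ t']) auto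
  qed
  have bound: "real N * e \<le> 2 * c" for N
  proof -
    obtain n t where nt: "n \<le> 2 * N" "\<forall>i\<le>n. t i \<in> {a<..<b1}" "\<forall>i<n. t i \<le> t (Suc i)"
        "real N * e \<le> chain_variation w n t"
      using chain[OF b1(1), of N] by blast
    have "chain_variation w n t \<le> c + real n * (e / 4)"
      using ctrl[unfolded chain_controlled_def, rule_format, of a b1 "e / 4" n t] b1(2) mosc nt(2,3) by blast
    also have "real n * (e / 4) \<le> real (2 * N) * (e / 4)"
      using nt(1) e by (intro mult_right_mono) (auto simp del: of_nat_mult)
    finally show ?thesis using nt(4) by (simp add: mult.commute)
  qed
  obtain N where "2 * c / e < real N" using reals_Archimedean2 by blast
  then show False using bound[of N] e by (simp add: field_simps)
qed

text \<open>The condition is symmetric under reversal of the line, which reduces limits from the left to limits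
  from the right.\<close>

lemma chain_controlled_reflect:
  assumes "chain_controlled a b c m w"
  shows "chain_controlled (- b) (- a) c (\<lambda>x. m (- x)) (\<lambda>x. w (- x))"
  unfolding chain_controlled_def
proof (intro allI impI)
  fix a' b' e :: real and n :: nat and t :: "nat \<Rightarrow> real"
  assume ab: "- b \<le> a'" "b' \<le> - a" and osc: "\<forall>x\<in>{a'<..<b'}. \<forall>y\<in>{a'<..<b'}. \<bar>m (- x) - m (- y)\<bar> \<le> e"
    and tin: "\<forall>i\<le>n. t i \<in> {a'<..<b'}" and t: "\<forall>i<n. t i \<le> t (Suc i)"
  define s where "s i = - t (n - i)" for i
  have "chain_variation w n s \<le> c + real n * e"
  proof (rule assms[unfolded chain_controlled_def, rule_format])
    show "a \<le> - b'" "- a' \<le> b" using ab by auto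
    show "\<bar>m x - m y\<bar> \<le> e" if "x \<in> {- b'<..<- a'}" "y \<in> {- b'<..<- a'}" for x y
      using osc[rule_format, of "- x" "- y"] that by auto
    show "s i \<in> {- b'<..<- a'}" if "i \<le> n" for i using tin[rule_format, of "n - i"] by (simp add: s_def)
    show "s i \<le> s (Suc i)" if "i < n" for i
      using t[rule_format, of "n - Suc i"] that by (simp add: s_def Suc_diff_Suc)
  qed
  also have "chain_variation w n s = (\<Sum>i<n. \<bar>w (- t (Suc (n - Suc i))) - w (- t (n - Suc i))\<bar>)"
    by (intro sum.cong refl) (simp add: s_def Suc_diff_Suc abs_minus_commute)
  also have "\<dots> = (\<Sum>i<n. \<bar>w (- t (Suc i)) - w (- t i)\<bar>)"
    by (rule sum.nat_diff_reindex)
  finally show "(\<Sum>i<n. \<bar>w (- t (Suc i)) - w (- t i)\<bar>) \<le> c + real n * e" .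
qed

lemma chain_controlled_mono:
  assumes ctrl: "chain_controlled a b c m w" and sub: "a \<le> a'" "b' \<le> b"
  shows "chain_controlled a' b' c m w"
  unfolding chain_controlled_def
proof (intro allI impI)
  fix a'' b'' e :: real and n :: nat and t :: "nat \<Rightarrow> real"
  assume *: "a' \<le> a''" "b'' \<le> b'" "\<forall>x\<in>{a''<..<b''}. \<forall>y\<in>{a''<..<b''}. \<bar>m x - m y\<bar> \<le> e"
    "\<forall>i\<le>n. t i \<in> {a''<..<b''}" "\<forall>i<n. t i \<le> t (Suc i)"
  show "chain_variation w n t \<le> c + real n * e"
    by (rule ctrl[unfolded chain_controlled_def, rule_format, OF order_trans[OF sub(1) *(1)]
          order_trans[OF *(2) sub(2)]]) (use *(3-5) in blast)+
qed

lemma chain_controlled_regulated: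
  assumes ctrl: "chain_controlled a b c m w" and m: "regulated_on a b m"
  shows "regulated_on a b w"
  unfolding regulated_on_def
proof (intro conjI ballI)
  fix t assume t: "t \<in> {a<..b}"
  obtain l where "(m \<longlongrightarrow> l) (at_left t)" using m t unfolding regulated_on_def by blast
  then have "((\<lambda>x. m (- x)) \<longlongrightarrow> l) (at_right (- t))" by (simp add: filterlim_at_left_to_right)
  moreover have "chain_controlled (- t) (- a) c (\<lambda>x. m (- x)) (\<lambda>x. w (- x))"
    using chain_controlled_reflect[OF chain_controlled_mono[OF ctrl order_refl, of t]] t by simp
  moreover have "- t < - a" using t by simp
  ultimately have "\<exists>l. ((\<lambda>x. w (- x)) \<longlongrightarrow> l) (at_right (- t))"
    using chain_controlled_right_limit[of "- t" "- a" c "\<lambda>x. m (- x)" "\<lambda>x. w (- x)" l] by blast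
  then show "\<exists>l. (w \<longlongrightarrow> l) (at_left t)" by (simp add: filterlim_at_left_to_right)
next
  fix t assume t: "t \<in> {a..<b}"
  obtain l where "(m \<longlongrightarrow> l) (at_right t)" using m t unfolding regulated_on_def by blast
  then show "\<exists>l. (w \<longlongrightarrow> l) (at_right t)"
    using t chain_controlled_mono[OF ctrl, of t b] chain_controlled_right_limit[of t b c m w l] by simp
qed

section \<open>Regularity of local solutions\<close>

lemma descent_bound_cong_AE:
  assumes db: "descent_bound C r u (\<lambda>t. w t - c)" and eq: "AE t in lebesgue. u t = v t"
    and L: "u \<in> L2 lebesgue" "v \<in> L2 lebesgue" "w \<in> L2 lebesgue"
  shows "descent_bound C r v (\<lambda>t. w t - c)"
  unfolding descent_bound_def
proof (intro allI impI)
  fix h \<kappa>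
  assume h: "h \<in> L2 lebesgue" "integrable lebesgue h" "AE t in lebesgue. 0 \<le> v t + h t"
    and \<kappa>: "0 \<le> \<kappa>" "\<forall>s. \<bar>s\<bar> \<le> r \<longrightarrow> \<bar>g_of h s\<bar> \<le> \<kappa>"
  have "AE t in lebesgue. 0 \<le> u t + h t" using h(3) eq by eventually_elim simp
  then have "0 \<le> (\<integral>t. (u t - (w t - c)) * h t \<partial>lebesgue) + C * \<kappa>"
    using db[unfolded descent_bound_def, rule_format, OF h(1,2) _ \<kappa>(1)] \<kappa>(2) by blast
  also have "(\<integral>t. (u t - (w t - c)) * h t \<partial>lebesgue) = (\<integral>t. (v t - (w t - c)) * h t \<partial>lebesgue)"
    using L2_measurable[OF L(1)] L2_measurable[OF L(2)] L2_measurable[OF L(3)] L2_measurable[OF h(1)] eq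
    by (intro integral_cong_AE) (auto intro!: borel_measurable_times borel_measurable_diff elim!: eventually_mono)
  finally show "0 \<le> (\<integral>t. (v t - (w t - c)) * h t \<partial>lebesgue) + C * \<kappa>" .
qed

text \<open>The set \<open>D\<close> consists of the points at which the variation estimate holds and \<open>uD\<close> agrees with its
  representative \<open>m\<close>. The estimate for chains of two points bounds \<open>u\<close> on \<open>D\<close> because \<open>uD\<close> is bounded, and
  the extension by cluster values provides \<open>w\<close>.\<close>

lemma descent_bound_representative:
  assumes db: "descent_bound C r u (\<lambda>t. uD t - c)" and C: "0 \<le> C" and r: "0 \<le> r"
    and u: "u \<in> admissible" and uD: "uD \<in> L2 lebesgue" "uD \<in> Linfty (lebesgue_on {-r<..<r})"
    and m: "AE t in lebesgue_on {-r<..<r}. uD t = m t"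
  obtains w where "u \<in> Linfty (lebesgue_on {-r<..<r})" "AE t in lebesgue_on {-r<..<r}. u t = w t"
    "\<forall>n t U. open U \<longrightarrow> chain n ({-r..r} \<inter> U) t \<longrightarrow>
      (\<exists>t'. chain n ({-r..r} \<inter> U) t' \<and> chain_variation w n t \<le> 2 * C + 1 + chain_variation m n t')"
proof (cases "r = 0")
  case True
  have "u \<in> L2 lebesgue" using u by (simp add: admissible_def)
  then have um: "u \<in> borel_measurable (lebesgue_on {-r<..<r})"
    by (intro measurable_restrict_space1 L2_measurable)
  have ae: "AE t in lebesgue_on {-r<..<r}. P t" for P using True by (intro AE_I2) (simp add: space_restrict_space)
  show ?thesis
  proof (rule that[of "\<lambda>_. 0"])
    show "u \<in> Linfty (lebesgue_on {-r<..<r})" using um ae by (simp add: Linfty_def)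
    show "AE t in lebesgue_on {-r<..<r}. u t = 0" by (rule ae)
    show "\<forall>n t U. open U \<longrightarrow> chain n ({-r..r} \<inter> U) t \<longrightarrow>
      (\<exists>t'. chain n ({-r..r} \<inter> U) t' \<and> chain_variation (\<lambda>_. 0) n t \<le> 2 * C + 1 + chain_variation m n t')"
    proof (intro allI impI)
      fix n :: nat and t :: "nat \<Rightarrow> real" and U
      assume "chain n ({-r..r} \<inter> U) t"
      then show "\<exists>t'. chain n ({-r..r} \<inter> U) t' \<and> chain_variation (\<lambda>_. 0) n t \<le> 2 * C + 1 + chain_variation m n t'"
        using C by (intro exI[of _ t] conjI) (auto intro!: add_nonneg_nonneg sum_nonneg)
    qed
  qed
next
  case False
  then have r0: "0 < r" using r by simp
  have uL: "u \<in> L2 lebesgue" and pos: "AE t in lebesgue. 0 \<le> u t" using u by (auto simp: admissible_def)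
  define v where "v t = max 0 (u t)" for t
  have vL: "v \<in> L2 lebesgue"
    using L2_measurable[OF uL] by (intro L2_dominated[OF uL]) (auto simp: v_def[abs_def] max_def)
  have uv: "AE t in lebesgue. u t = v t" using pos by eventually_elim (simp add: v_def)
  have dbv: "descent_bound C r v (\<lambda>t. uD t - c)" by (rule descent_bound_cong_AE[OF db uv uL vL uD(1)])
  have v0: "0 \<le> v x" for x by (simp add: v_def)
  obtain N where N: "negligible N"
    "\<forall>n t. chain n (- N) t \<longrightarrow> chain_variation v n t \<le> 2 * C + chain_variation uD n t"
    by (rule descent_bound_chain_variation[OF dbv C vL v0 uD(1)])
  obtain b where b: "AE t in lebesgue_on {-r<..<r}. \<bar>uD t\<bar> \<le> b" using uD(2) by (auto simp: Linfty_def)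
  define D where "D = {t \<in> {-r<..<r}. t \<notin> N \<and> u t = v t \<and> uD t = m t \<and> \<bar>uD t\<bar> \<le> b}"
  have ae_iff: "(AE t in lebesgue_on {-r<..<r}. P t) \<longleftrightarrow> (AE t in lebesgue. t \<in> {-r<..<r} \<longrightarrow> P t)" for P
    by (rule AE_restrict_space_iff) simp
  have aeN: "AE t in lebesgue. t \<notin> N" using N(1) by (simp add: negligible_iff_null_sets AE_not_in)
  have "AE t in lebesgue. t \<notin> {-r<..<r} - D"
    using aeN uv m[unfolded ae_iff] b[unfolded ae_iff] by eventually_elim (auto simp: D_def)
  moreover have Dsub: "D \<subseteq> {-r..r}" by (auto simp: D_def)
  ultimately have Dneg: "negligible ({-r<..<r} - D)"
    using negligible_if_AE by blast
  have chain: "chain_variation v n t \<le> 2 * C + chain_variation m n t"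
    if "\<And>i. i \<le> n \<Longrightarrow> t i \<in> D" "\<And>i. i < n \<Longrightarrow> t i \<le> t (Suc i)" for n t
  proof -
    have "chain_variation uD n t = chain_variation m n t"
    proof (rule sum.cong[OF refl])
      fix i assume "i \<in> {..<n}"
      then have "t i \<in> D" "t (Suc i) \<in> D" using that(1) by auto
      then show "\<bar>uD (t (Suc i)) - uD (t i)\<bar> = \<bar>m (t (Suc i)) - m (t i)\<bar>" by (simp add: D_def)
    qed
    moreover have "t i \<notin> N" if "i \<le> n" for i using \<open>\<And>i. i \<le> n \<Longrightarrow> t i \<in> D\<close>[OF that] by (simp add: D_def)
    ultimately show ?thesis using N(2)[rule_format, of n t] that(2) by simp
  qed
  obtain x0 where x0: "x0 \<in> D" using conull_interval_meets[OF Dneg, of "- r" r] r0 by auto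
  have vb: "\<bar>v x\<bar> \<le> v x0 + 2 * C + 2 * b" if x: "x \<in> D" for x
  proof -
    have "\<bar>v (max x x0) - v (min x x0)\<bar> \<le> 2 * C + \<bar>m (max x x0) - m (min x x0)\<bar>"
      using chain[of 1 "\<lambda>i. if i = 0 then min x x0 else max x x0"] x x0 by (auto simp: min_def max_def split: if_splits)
    moreover have "\<bar>v (max x x0) - v (min x x0)\<bar> = \<bar>v x - v x0\<bar>" "\<bar>m (max x x0) - m (min x x0)\<bar> = \<bar>m x - m x0\<bar>"
      by (auto simp: min_def max_def)
    moreover have "\<bar>m x\<bar> \<le> b" "\<bar>m x0\<bar> \<le> b" using x x0 by (auto simp: D_def)
    ultimately show ?thesis using v0[of x] v0[of x0] by linarith
  qed
  obtain w where w: "\<forall>x\<in>D. w x = v x"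
    "\<forall>n t U. open U \<longrightarrow> chain n ({-r..r} \<inter> U) t \<longrightarrow>
      (\<exists>t'. chain n (D \<inter> U) t' \<and> chain_variation w n t \<le> chain_variation v n t' + 1)"
    by (rule conull_extension[OF r0 Dneg Dsub vb])
  have aeD: "AE t in lebesgue_on {-r<..<r}. t \<in> D"
    unfolding ae_iff using \<open>AE t in lebesgue. t \<notin> {-r<..<r} - D\<close> by eventually_elim auto
  show ?thesis
  proof (rule that[of w])
    have "u \<in> borel_measurable (lebesgue_on {-r<..<r})"
      by (intro measurable_restrict_space1 L2_measurable uL)
    moreover have "AE t in lebesgue_on {-r<..<r}. \<bar>u t\<bar> \<le> v x0 + 2 * C + 2 * b"
      using aeD
    proof eventually_elim
      case (elim t)
      then show ?case using vb[OF elim] by (simp add: D_def)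
    qed
    ultimately show "u \<in> Linfty (lebesgue_on {-r<..<r})" by (auto simp: Linfty_def)
    show "AE t in lebesgue_on {-r<..<r}. u t = w t"
      using aeD
    proof eventually_elim
      case (elim t)
      then show ?case using w(1) elim by (auto simp: D_def)
    qed
    show "\<forall>n t U. open U \<longrightarrow> chain n ({-r..r} \<inter> U) t \<longrightarrow>
      (\<exists>t'. chain n ({-r..r} \<inter> U) t' \<and> chain_variation w n t \<le> 2 * C + 1 + chain_variation m n t')"
    proof (intro allI impI)
      fix n :: nat and t :: "nat \<Rightarrow> real" and U
      assume U: "open U" and t: "chain n ({-r..r} \<inter> U) t"
      obtain t' where t': "\<forall>i\<le>n. t' i \<in> D \<inter> U" "\<forall>i<n. t' i \<le> t' (Suc i)"
          "chain_variation w n t \<le> chain_variation v n t' + 1"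
        using w(2)[rule_format, OF U t] by blast
      moreover have "chain_variation v n t' \<le> 2 * C + chain_variation m n t'"
        using t' by (intro chain) auto
      moreover have "D \<subseteq> {-r..r}" by (auto simp: D_def)
      ultimately show "\<exists>t'. chain n ({-r..r} \<inter> U) t' \<and> chain_variation w n t \<le> 2 * C + 1 + chain_variation m n t'"
        by (intro exI[of _ t']) auto
    qed
  qed
qed

lemma descent_bound_Linfty_G:
  assumes db: "descent_bound C r u (\<lambda>t. uD t - c)" and C: "0 \<le> C" and r: "0 \<le> r"
    and u: "u \<in> admissible" and uD: "uD \<in> L2 lebesgue" "uD \<in> Linfty_G r"
  shows "u \<in> Linfty_G r"
proof -
  obtain m where m: "regulated_on (-r) r m" "AE t in lebesgue_on {-r<..<r}. uD t = m t"
      and uDi: "uD \<in> Linfty (lebesgue_on {-r<..<r})"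
    using uD(2) by (auto simp: Linfty_G_def)
  obtain w where w: "u \<in> Linfty (lebesgue_on {-r<..<r})" "AE t in lebesgue_on {-r<..<r}. u t = w t"
    "\<forall>n t U. open U \<longrightarrow> chain n ({-r..r} \<inter> U) t \<longrightarrow>
      (\<exists>t'. chain n ({-r..r} \<inter> U) t' \<and> chain_variation w n t \<le> 2 * C + 1 + chain_variation m n t')"
    by (rule descent_bound_representative[OF db C r u uD(1) uDi m(2)])
  have "chain_controlled (-r) r (2 * C + 1) m w"
    unfolding chain_controlled_def
  proof (intro allI impI)
    fix a b e :: real and n :: nat and t :: "nat \<Rightarrow> real"
    assume ab: "-r \<le> a" "b \<le> r" and osc: "\<forall>x\<in>{a<..<b}. \<forall>y\<in>{a<..<b}. \<bar>m x - m y\<bar> \<le> e"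
      and t: "\<forall>i\<le>n. t i \<in> {a<..<b}" "\<forall>i<n. t i \<le> t (Suc i)"
    have "t i \<in> {-r..r} \<inter> {a<..<b}" if "i \<le> n" for i using t(1)[rule_format, OF that] ab by auto
    then obtain t' where t': "\<forall>i\<le>n. t' i \<in> {-r..r} \<inter> {a<..<b}"
      "chain_variation w n t \<le> 2 * C + 1 + chain_variation m n t'"
      using w(3)[rule_format, of "{a<..<b}" n t] t(2) by auto
    have "chain_variation m n t' \<le> (\<Sum>i<n. e)"
      using t'(1) osc by (intro sum_mono) auto
    then show "chain_variation w n t \<le> 2 * C + 1 + real n * e" using t'(2) by simp
  qed
  then have "regulated_on (-r) r w" using m(1) by (rule chain_controlled_regulated)
  then show ?thesis using w(1,2) unfolding Linfty_G_def by blast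
qed

lemma descent_bound_Linfty_BV:
  assumes db: "descent_bound C r u (\<lambda>t. uD t - c)" and C: "0 \<le> C" and r: "0 \<le> r"
    and u: "u \<in> admissible" and uD: "uD \<in> L2 lebesgue" "uD \<in> Linfty_BV r"
  shows "u \<in> Linfty_BV r"
proof -
  obtain m where m: "BV_on (-r) r m" "AE t in lebesgue_on {-r<..<r}. uD t = m t"
      and uDi: "uD \<in> Linfty (lebesgue_on {-r<..<r})"
    using uD(2) by (auto simp: Linfty_BV_def)
  obtain w where w: "u \<in> Linfty (lebesgue_on {-r<..<r})" "AE t in lebesgue_on {-r<..<r}. u t = w t"
    "\<forall>n t U. open U \<longrightarrow> chain n ({-r..r} \<inter> U) t \<longrightarrow>
      (\<exists>t'. chain n ({-r..r} \<inter> U) t' \<and> chain_variation w n t \<le> 2 * C + 1 + chain_variation m n t')"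
    by (rule descent_bound_representative[OF db C r u uD(1) uDi m(2)])
  obtain V where V: "\<And>n t. (\<forall>i\<le>n. t i \<in> {-r..r}) \<and> (\<forall>i<n. t i \<le> t (Suc i)) \<Longrightarrow>
      chain_variation m n t \<le> V"
    using m(1) unfolding BV_on_def by blast
  have "chain_variation w n t \<le> 2 * C + 1 + V"
    if ch: "chain n {-r..r} t" for n t
  proof -
    obtain t' where t': "\<forall>i\<le>n. t' i \<in> {-r..r}" "\<forall>i<n. t' i \<le> t' (Suc i)"
      "chain_variation w n t \<le> 2 * C + 1 + chain_variation m n t'"
      using w(3)[rule_format, of UNIV n t] ch by auto
    then show ?thesis using V[of n t'] by simp
  qed
  then have "BV_on (-r) r w" unfolding BV_on_def by blast
  then show ?thesis using w(1,2) unfolding Linfty_BV_def by blast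
qed

theorem theorem5p7:
  fixes \<Omega> :: "'a::euclidean_space set" and f yD :: "'a \<Rightarrow> real"
    and uD :: "real \<Rightarrow> real" and \<nu>1 \<nu>2 r :: real
  assumes "DIM('a) \<in> {1, 2, 3}"
    and "bounded_domain \<Omega>" and "convex \<Omega> \<or> C11_boundary \<Omega>"
    and "yD \<in> L2 (lebesgue_on \<Omega>)" and "uD \<in> L2 lebesgue"
    and "\<nu>1 \<ge> 0" and "\<nu>2 > 0"
    and "f \<in> L2 (lebesgue_on \<Omega>)" and "\<not> (AE x in lebesgue_on \<Omega>. f x = 0)"
    and "ereal r \<ge> r_P \<Omega> f"
  shows "(uD \<in> Linfty_G r \<longrightarrow>
           (\<forall>ubar. local_solution \<Omega> f yD uD \<nu>1 \<nu>2 ubar \<longrightarrow>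
              (AE t in lebesgue. t \<notin> {-r<..<r} \<longrightarrow> ubar t = max 0 (uD t - \<nu>1 / \<nu>2)) \<and>
              ubar \<in> Linfty_G r))
       \<and> (uD \<in> Linfty_BV r \<longrightarrow>
           (\<forall>ubar. local_solution \<Omega> f yD uD \<nu>1 \<nu>2 ubar \<longrightarrow>
              (AE t in lebesgue. t \<notin> {-r<..<r} \<longrightarrow> ubar t = max 0 (uD t - \<nu>1 / \<nu>2)) \<and>
              ubar \<in> Linfty_BV r))"
proof -
  have *: "(AE t in lebesgue. t \<notin> {-r<..<r} \<longrightarrow> ubar t = max 0 (uD t - \<nu>1 / \<nu>2))"
      "uD \<in> Linfty_G r \<Longrightarrow> ubar \<in> Linfty_G r" "uD \<in> Linfty_BV r \<Longrightarrow> ubar \<in> Linfty_BV r"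
    if loc: "local_solution \<Omega> f yD uD \<nu>1 \<nu>2 ubar" for ubar
  proof -
    have r: "0 \<le> r" by (rule state_bound(1)[OF assms(2,8,10)])
    have adm: "ubar \<in> admissible" using loc by (simp add: local_solution_def)
    obtain C where C: "0 \<le> C" "descent_bound C r ubar (\<lambda>t. uD t - \<nu>1 / \<nu>2)"
      by (rule local_solution_descent_bound[OF assms(2,8,4,5,6,7,10) loc])
    show "AE t in lebesgue. t \<notin> {-r<..<r} \<longrightarrow> ubar t = max 0 (uD t - \<nu>1 / \<nu>2)"
      by (rule descent_bound_outside[OF C(2) r adm assms(5)])
    show "uD \<in> Linfty_G r \<Longrightarrow> ubar \<in> Linfty_G r"
      by (rule descent_bound_Linfty_G[OF C(2,1) r adm assms(5)])
    show "uD \<in> Linfty_BV r \<Longrightarrow> ubar \<in> Linfty_BV r"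
      by (rule descent_bound_Linfty_BV[OF C(2,1) r adm assms(5)])
  qed
  then show ?thesis by blast
qed

end
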